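(* Let $(\mu;\nu)\in\mathcal{Q}_n$, and let $\lambda=\mu+\nu$. Let $(v,x)\in\mathcal{O}_{\mu;\nu}$, and let $\{v_{ij}\}$ be a normal basis for $(v,x)$ (necessarily of type $(\mu;\nu)$). 1. $E^x$ has basis $\{y_{i_1,i_2,s}\mid 1\le i_1,i_2\le\ell(\lambda),\ \max\{0,\lambda_{i_1}-\lambda_{i_2}\}\le s\le\lambda_{i_1}-1\}$, where $y_{i_1,i_2,s}v_{ij}=v_{i_2,j-s}$ if $i=i_1$ and $s+1\le j\le\lambda_i$, and $y_{i_1,i_2,s}v_{ij}=0$ otherwise. 2. $\dim E^x=n+2n(\lambda)$. 3. $G^x$ is a connected algebraic group of dimension $n+2n(\lambda)$. 4. $\dim\mathcal{O}_\lambda=n^2-n-2n(\lambda)$. 5. $E^xv=\mathrm{span}\{v_{ij}\mid 1\le i\le\ell(\mu),\ 1\le j\le\mu_i\}$. 6. $\dim E^{(v,x)}=b(\mu;\nu)$. 7. $G^{(v,x)}$ is a connected algebraic group of dimension $b(\mu;\nu)$. 8. $\dim\mathcal{O}_{\mu;\nu}=\dim\mathcal{O}_\lambda+|\mu|=n^2-b(\mu;\nu)$.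
   Context: $\mathbb{F}$ is an algebraically closed field, $V$ an $n$-dimensional $\mathbb{F}$-vector space, $G=\mathrm{GL}(V)$, $\mathcal{N}$ the variety of nilpotent endomorphisms of $V$; $G$ acts on $V\times\mathcal{N}$ by $g\cdot(v,x)=(gv,gxg^{-1})$. For a partition $\lambda$, $|\lambda|=\sum_i\lambda_i$, $\ell(\lambda)$ is the number of nonzero parts, and $n(\lambda)=\sum_i(i-1)\lambda_i$; sums of partitions are termwise. $\mathcal{Q}_n$ is the set of bipartitions $(\mu;\nu)$ (ordered pairs of partitions) with $|\mu|+|\nu|=n$, and $b(\mu;\nu)=2n(\mu)+2n(\nu)+|\nu|$. A Jordan basis for $x\in\mathcal{N}$ of Jordan type $\lambda$ is a basis $\{v_{ij}\mid 1\le i\le\ell(\lambda),1\le j\le\lambda_i\}$ with $xv_{ij}=v_{i,j-1}$ for $j>1$, $xv_{i1}=0$. $\mathcal{O}_\lambda\subset\mathcal{N}$ is the $G$-orbit of nilpotents of Jordan type $\lambda$. A normal basis of type $(\mu;\nu)$ for $(v,x)$ is a Jordan basis for $x$, of Jordan type $\mu+\nu$, with $v=\sum_{i=1}^{\ell(\mu)}v_{i,\mu_i}$. $\mathcal{O}_{\mu;\nu}$ is the set of $(v,x)\in V\times\mathcal{N}$ admitting a normal basis of type $(\mu;\nu)$; the $\mathcal{O}_{\mu;\nu}$, $(\mu;\nu)\in\mathcal{Q}_n$, are exactly the distinct $G$-orbits in $V\times\mathcal{N}$. $E^x=\{y\in\mathrm{End}(V)\mid xy=yx\}$, $G^x=G\cap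 E^x$, $E^{(v,x)}=\{y\in E^x\mid yv=0\}$, $G^{(v,x)}=\{g\in G^x\mid gv=v\}$, and $E^xv=\{yv\mid y\in E^x\}$. *)

theory Defs
  imports
    "HOL-Algebra.Group"
    "HOL-Analysis.Abstract_Topology"
    "HOL-Computational_Algebra.Polynomial"
    "HOL-Library.Extended_Real"
    "HOL-Library.Function_Algebras"
    "HOL-Library.Product_Plus"
begin

section \<open>Partitions and bipartitions\<close>

text \<open>
  Parts are numbered from 1, so the function carries a dummy value at 0; fixing that value
  makes the representation of a partition by a function unique.  Termwise sums of partitions
  are sums of functions.
\<close>

definition is_partition :: "(nat \<Rightarrow> nat) \<Rightarrow> bool" where
  "is_partition p \<longleftrightarrow>
     p 0 = 0 \<and> (\<forall>i\<ge>1. p (Suc i) \<le> p i) \<and> finite {i. p i \<noteq> 0}"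

definition psize :: "(nat \<Rightarrow> nat) \<Rightarrow> nat" where
  "psize p = (\<Sum>i | p i \<noteq> 0. p i)"

definition plength :: "(nat \<Rightarrow> nat) \<Rightarrow> nat" where
  "plength p = card {i. p i \<noteq> 0}"

definition pn :: "(nat \<Rightarrow> nat) \<Rightarrow> nat" where
  "pn p = (\<Sum>i | p i \<noteq> 0. (i - 1) * p i)"

definition bipartitions :: "nat \<Rightarrow> ((nat \<Rightarrow> nat) \<times> (nat \<Rightarrow> nat)) set" where
  "bipartitions n = {(mu, nu). is_partition mu \<and> is_partition nu \<and> psize mu + psize nu = n}"

definition bstat :: "(nat \<Rightarrow> nat) \<Rightarrow> (nat \<Rightarrow> nat) \<Rightarrow> nat" where
  "bstat mu nu = 2 * pn mu + 2 * pn nu + psize nu"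

definition boxes :: "(nat \<Rightarrow> nat) \<Rightarrow> (nat \<times> nat) set" where
  "boxes p = {(i, j). 1 \<le> i \<and> i \<le> plength p \<and> 1 \<le> j \<and> j \<le> p i}"

section \<open>Endomorphisms\<close>

text \<open>
  The vector space \<open>V\<close> is a whole type, with scalar multiplication \<open>scale\<close>.
  Endomorphisms are functions, living in the space of all functions with pointwise operations.
\<close>

definition fun_scale :: "('a \<Rightarrow> 'b \<Rightarrow> 'b) \<Rightarrow> 'a \<Rightarrow> ('c \<Rightarrow> 'b) \<Rightarrow> ('c \<Rightarrow> 'b)" where
  "fun_scale scale c f = (\<lambda>u. scale c (f u))"

definition prod_scale ::
    "('a \<Rightarrow> 'b \<Rightarrow> 'b) \<Rightarrow> ('a \<Rightarrow> 'c \<Rightarrow> 'c) \<Rightarrow> 'a \<Rightarrow> 'b \<times> 'c \<Rightarrow> 'b \<times> 'c" where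
  "prod_scale s1 s2 c p = (s1 c (fst p), s2 c (snd p))"

lemma vector_space_fun_scale:
  assumes "vector_space scale"
  shows "vector_space (fun_scale scale)"
  using assms unfolding vector_space_def fun_scale_def by (auto simp: fun_eq_iff)

lemma vector_space_prod_scale:
  assumes "vector_space s1" "vector_space s2"
  shows "vector_space (prod_scale s1 s2)"
  using assms unfolding vector_space_def prod_scale_def by (auto simp: plus_prod_def)

definition basis_family ::
    "('a::field \<Rightarrow> 'b::ab_group_add \<Rightarrow> 'b) \<Rightarrow> ('i \<Rightarrow> 'b) \<Rightarrow> 'i set \<Rightarrow> 'b set \<Rightarrow> bool" where
  "basis_family scale f I W \<longleftrightarrow>
     inj_on f I \<and> \<not> module.dependent scale (f ` I) \<and> module.span scale (f ` I) = W"

definition End :: "('a::field \<Rightarrow> 'b::ab_group_add \<Rightarrow> 'b) \<Rightarrow> ('b \<Rightarrow> 'b) set" where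
  "End scale = {f. Vector_Spaces.linear scale scale f}"

definition GL :: "('a::field \<Rightarrow> 'b::ab_group_add \<Rightarrow> 'b) \<Rightarrow> ('b \<Rightarrow> 'b) monoid" where
  "GL scale = \<lparr>carrier = {g \<in> End scale. bij g}, monoid.mult = (\<lambda>f g. f \<circ> g), one = id\<rparr>"

definition Nilp :: "('a::field \<Rightarrow> 'b::ab_group_add \<Rightarrow> 'b) \<Rightarrow> ('b \<Rightarrow> 'b) set" where
  "Nilp scale = {x \<in> End scale. \<exists>k. x ^^ k = (\<lambda>_. 0)}"

definition End_cent ::
    "('a::field \<Rightarrow> 'b::ab_group_add \<Rightarrow> 'b) \<Rightarrow> ('b \<Rightarrow> 'b) \<Rightarrow> ('b \<Rightarrow> 'b) set" where
  "End_cent scale x = {y \<in> End scale. x \<circ> y = y \<circ> x}"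

definition End_ann ::
    "('a::field \<Rightarrow> 'b::ab_group_add \<Rightarrow> 'b) \<Rightarrow> 'b \<Rightarrow> ('b \<Rightarrow> 'b) \<Rightarrow> ('b \<Rightarrow> 'b) set" where
  "End_ann scale v x = {y \<in> End_cent scale x. y v = 0}"

definition GL_cent ::
    "('a::field \<Rightarrow> 'b::ab_group_add \<Rightarrow> 'b) \<Rightarrow> ('b \<Rightarrow> 'b) \<Rightarrow> ('b \<Rightarrow> 'b) set" where
  "GL_cent scale x = carrier (GL scale) \<inter> End_cent scale x"

definition GL_stab ::
    "('a::field \<Rightarrow> 'b::ab_group_add \<Rightarrow> 'b) \<Rightarrow> 'b \<Rightarrow> ('b \<Rightarrow> 'b) \<Rightarrow> ('b \<Rightarrow> 'b) set" where
  "GL_stab scale v x = {g \<in> GL_cent scale x. g v = v}"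

section \<open>Jordan bases, normal bases and orbits\<close>

definition jordan_basis ::
    "('a::field \<Rightarrow> 'b::ab_group_add \<Rightarrow> 'b) \<Rightarrow> (nat \<Rightarrow> nat) \<Rightarrow> ('b \<Rightarrow> 'b) \<Rightarrow> (nat \<Rightarrow> nat \<Rightarrow> 'b) \<Rightarrow> bool"
  where
  "jordan_basis scale p x e \<longleftrightarrow>
     basis_family scale (\<lambda>(i, j). e i j) (boxes p) UNIV \<and>
     (\<forall>(i, j) \<in> boxes p. x (e i j) = (if j > 1 then e i (j - 1) else 0))"

definition normal_basis ::
    "('a::field \<Rightarrow> 'b::ab_group_add \<Rightarrow> 'b) \<Rightarrow> (nat \<Rightarrow> nat) \<Rightarrow> (nat \<Rightarrow> nat) \<Rightarrow> 'b \<Rightarrow> ('b \<Rightarrow> 'b) \<Rightarrow>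
      (nat \<Rightarrow> nat \<Rightarrow> 'b) \<Rightarrow> bool" where
  "normal_basis scale mu nu v x e \<longleftrightarrow>
     jordan_basis scale (mu + nu) x e \<and> v = (\<Sum>i = 1..plength mu. e i (mu i))"

definition nilp_orbit ::
    "('a::field \<Rightarrow> 'b::ab_group_add \<Rightarrow> 'b) \<Rightarrow> (nat \<Rightarrow> nat) \<Rightarrow> ('b \<Rightarrow> 'b) set" where
  "nilp_orbit scale p = {x \<in> Nilp scale. \<exists>e. jordan_basis scale p x e}"

definition enh_orbit ::
    "('a::field \<Rightarrow> 'b::ab_group_add \<Rightarrow> 'b) \<Rightarrow> (nat \<Rightarrow> nat) \<Rightarrow> (nat \<Rightarrow> nat) \<Rightarrow> ('b \<times> ('b \<Rightarrow> 'b)) set"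
  where
  "enh_orbit scale mu nu =
     {(v, x). x \<in> Nilp scale \<and> (\<exists>e. normal_basis scale mu nu v x e)}"

text \<open>
  The endomorphism \<open>y\<^bsub>i1,i2,s\<^esub>\<close> attached to a Jordan basis \<open>e\<close> of type \<open>p\<close>; it is specified,
  as a linear map, by its values on the basis.  In its index set, truncated subtraction gives
  \<open>max 0 (p i1 - p i2)\<close>, and \<open>p i1 - 1\<close> is a true difference since \<open>p i1 \<ge> 1\<close>.
\<close>

definition cent_map ::
    "('a::field \<Rightarrow> 'b::ab_group_add \<Rightarrow> 'b) \<Rightarrow> (nat \<Rightarrow> nat) \<Rightarrow> (nat \<Rightarrow> nat \<Rightarrow> 'b) \<Rightarrow>
      nat \<Rightarrow> nat \<Rightarrow> nat \<Rightarrow> ('b \<Rightarrow> 'b)" where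
  "cent_map scale p e i1 i2 s =
     (THE y. y \<in> End scale \<and>
        (\<forall>(i, j) \<in> boxes p. y (e i j) =
           (if i = i1 \<and> s + 1 \<le> j \<and> j \<le> p i then e i2 (j - s) else 0)))"

definition cent_index :: "(nat \<Rightarrow> nat) \<Rightarrow> (nat \<times> nat \<times> nat) set" where
  "cent_index p =
     {(i1, i2, s). 1 \<le> i1 \<and> i1 \<le> plength p \<and> 1 \<le> i2 \<and> i2 \<le> plength p \<and>
        p i1 - p i2 \<le> s \<and> s \<le> p i1 - 1}"

section \<open>Zariski topology and dimension\<close>

inductive_set poly_funs ::
    "('a::field \<Rightarrow> 'b::ab_group_add \<Rightarrow> 'b) \<Rightarrow> ('b \<Rightarrow> 'a) set"
  for scale :: "'a::field \<Rightarrow> 'b::ab_group_add \<Rightarrow> 'b" where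
  const: "(\<lambda>_. c) \<in> poly_funs scale"
| lin: "Vector_Spaces.linear scale (*) l \<Longrightarrow> l \<in> poly_funs scale"
| add: "f \<in> poly_funs scale \<Longrightarrow> g \<in> poly_funs scale \<Longrightarrow> (\<lambda>w. f w + g w) \<in> poly_funs scale"
| mult: "f \<in> poly_funs scale \<Longrightarrow> g \<in> poly_funs scale \<Longrightarrow> (\<lambda>w. f w * g w) \<in> poly_funs scale"

text \<open>
  \<open>zariski scale W\<close> is meant for a finite-dimensional subspace \<open>W\<close>.  Linear forms on \<open>W\<close> are the
  restrictions of linear forms on the ambient space, so the functions in \<open>poly_funs scale\<close>
  restrict to exactly the polynomial functions on \<open>W\<close>.  Locally closed subsets of \<open>W\<close>
  carry the subspace topology.
\<close>

definition zero_set :: "'b set \<Rightarrow> ('b \<Rightarrow> 'a::zero) set \<Rightarrow> 'b set" where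
  "zero_set W S = {w \<in> W. \<forall>f\<in>S. f w = 0}"

definition zariski ::
    "('a::field \<Rightarrow> 'b::ab_group_add \<Rightarrow> 'b) \<Rightarrow> 'b set \<Rightarrow> 'b topology" where
  "zariski scale W = topology (\<lambda>U. \<exists>S. S \<subseteq> poly_funs scale \<and> U = W - zero_set W S)"

lemma istopology_zariski:
  "istopology (\<lambda>U. \<exists>S. S \<subseteq> poly_funs scale \<and> U = W - zero_set W S)"
  unfolding istopology_def
proof (intro conjI allI impI)
  fix A B
  assume "\<exists>S. S \<subseteq> poly_funs scale \<and> A = W - zero_set W S"
  then obtain S where S: "S \<subseteq> poly_funs scale" "A = W - zero_set W S" by (elim exE conjE)
  assume "\<exists>S. S \<subseteq> poly_funs scale \<and> B = W - zero_set W S"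
  then obtain T where T: "T \<subseteq> poly_funs scale" "B = W - zero_set W T" by (elim exE conjE)
  define P where "P = (\<lambda>(f, g) w. f w * g w) ` (S \<times> T)"
  have "P \<subseteq> poly_funs scale"
    using S(1) T(1) unfolding P_def by (auto intro!: poly_funs.mult)
  moreover have "A \<inter> B = W - zero_set W P"
  proof -
    have *: "(\<forall>h\<in>P. h w = 0) \<longleftrightarrow> (\<forall>f\<in>S. f w = 0) \<or> (\<forall>g\<in>T. g w = 0)" for w
      unfolding P_def by (simp add: ball_simps split_beta)
    show ?thesis
      unfolding S(2) T(2) zero_set_def by (rule Set.set_eqI) (auto simp only: * Int_iff Diff_iff mem_Collect_eq)
  qed
  ultimately show "\<exists>S. S \<subseteq> poly_funs scale \<and> A \<inter> B = W - zero_set W S"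
    by (intro exI conjI)
next
  fix K
  assume K: "\<forall>U\<in>K. \<exists>S. S \<subseteq> poly_funs scale \<and> U = W - zero_set W S"
  obtain Z where Z: "\<forall>U\<in>K. Z U \<subseteq> poly_funs scale \<and> U = W - zero_set W (Z U)"
    using bchoice[OF K] by (elim exE)
  have "w \<in> \<Union>K \<longleftrightarrow> w \<in> W - zero_set W (\<Union>(Z ` K))" for w
  proof -
    have "w \<in> U \<longleftrightarrow> w \<in> W \<and> (\<exists>f\<in>Z U. f w \<noteq> 0)" if "U \<in> K" for U
    proof -
      have "U = W - zero_set W (Z U)" using that by (rule bspec[OF Z, THEN conjunct2])
      then have "w \<in> U \<longleftrightarrow> w \<in> W - zero_set W (Z U)" by (rule arg_cong)
      also have "\<dots> \<longleftrightarrow> w \<in> W \<and> (\<exists>f\<in>Z U. f w \<noteq> 0)"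
        unfolding zero_set_def by fast
      finally show ?thesis .
    qed
    then have "w \<in> \<Union>K \<longleftrightarrow> (\<exists>U\<in>K. w \<in> W \<and> (\<exists>f\<in>Z U. f w \<noteq> 0))"
      unfolding Union_iff by (rule bex_cong[OF refl])
    then show ?thesis unfolding zero_set_def by auto
  qed
  then have "\<Union>K = W - zero_set W (\<Union>(Z ` K))" by (rule Set.set_eqI)
  moreover have "\<Union>(Z ` K) \<subseteq> poly_funs scale"
    by (rule UN_least) (rule bspec[OF Z, THEN conjunct1])
  ultimately show "\<exists>S. S \<subseteq> poly_funs scale \<and> \<Union>K = W - zero_set W S"
    by (intro exI conjI)
qed

lemma openin_zariski:
  "openin (zariski scale W) U \<longleftrightarrow> (\<exists>S. S \<subseteq> poly_funs scale \<and> U = W - zero_set W S)"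
  unfolding zariski_def topology_inverse'[OF istopology_zariski] ..

lemma topspace_zariski [simp]:
  fixes scale :: "'a::field \<Rightarrow> 'b::ab_group_add \<Rightarrow> 'b"
  shows "topspace (zariski scale W) = W"
proof
  have "openin (zariski scale W) (topspace (zariski scale W))" by simp
  then obtain S :: "('b \<Rightarrow> 'a) set" where "topspace (zariski scale W) = W - zero_set W S"
    unfolding openin_zariski by (elim exE conjE)
  then show "topspace (zariski scale W) \<subseteq> W" by simp
  have "{\<lambda>_. 1} \<subseteq> poly_funs scale" by (simp add: poly_funs.const)
  moreover have "W = W - zero_set W {\<lambda>_. 1 :: 'a}" by (simp add: zero_set_def)
  ultimately have "openin (zariski scale W) W"
    unfolding openin_zariski by (intro exI conjI)
  then show "W \<subseteq> topspace (zariski scale W)" by (rule openin_subset)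
qed

lemma closedin_zariski:
  fixes scale :: "'a::field \<Rightarrow> 'b::ab_group_add \<Rightarrow> 'b"
  shows "closedin (zariski scale W) C \<longleftrightarrow> (\<exists>S. S \<subseteq> poly_funs scale \<and> C = zero_set W S)"
proof -
  have "C \<subseteq> W \<and> W - C = W - Z \<longleftrightarrow> C = Z" if "Z \<subseteq> W" for Z
    using that by blast
  moreover have "zero_set W S \<subseteq> W" for S :: "('b \<Rightarrow> 'a) set"
    by (simp add: zero_set_def)
  ultimately have "C \<subseteq> W \<and> W - C = W - zero_set W S \<longleftrightarrow> C = zero_set W S"
    for S :: "('b \<Rightarrow> 'a) set"
    by simp
  then show ?thesis
    unfolding closedin_def openin_zariski topspace_zariski by (metis (no_types, lifting))
qed

definition irreducible_space :: "'b topology \<Rightarrow> bool" where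
  "irreducible_space X \<longleftrightarrow> topspace X \<noteq> {} \<and>
     (\<forall>A B. closedin X A \<and> closedin X B \<and> topspace X = A \<union> B \<longrightarrow>
        A = topspace X \<or> B = topspace X)"

text \<open>
  Supremum of the lengths of chains of irreducible closed subsets; it is
  \<open>-\<infinity>\<close> for the empty space.
\<close>

definition krull_dim :: "'b topology \<Rightarrow> ereal" where
  "krull_dim X =
     (SUP k \<in> {k. \<exists>C :: nat \<Rightarrow> 'b set.
          (\<forall>i\<le>k. closedin X (C i) \<and> irreducible_space (subtopology X (C i))) \<and>
          (\<forall>i<k. C i \<subset> C (Suc i))}. ereal (real k))"

definition End_top :: "('a::field \<Rightarrow> 'b::ab_group_add \<Rightarrow> 'b) \<Rightarrow> ('b \<Rightarrow> 'b) topology" where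
  "End_top scale = zariski (fun_scale scale) (End scale)"

text \<open>
  The Zariski topology of the vector space \<open>V \<times> End V\<close>, which is finer than the product of the
  Zariski topologies.
\<close>

definition VEnd_top ::
    "('a::field \<Rightarrow> 'b::ab_group_add \<Rightarrow> 'b) \<Rightarrow> ('b \<times> ('b \<Rightarrow> 'b)) topology" where
  "VEnd_top scale = zariski (prod_scale scale (fun_scale scale)) (UNIV \<times> End scale)"

text \<open>
  Algebraic groups occur here as Zariski-closed subgroups of \<open>GL V\<close>, where \<open>GL V\<close> is
  the principal open subset \<open>det \<noteq> 0\<close> of \<open>End V\<close>.
\<close>

definition connected_alg_subgroup ::
    "('a::field \<Rightarrow> 'b::ab_group_add \<Rightarrow> 'b) \<Rightarrow> ('b \<Rightarrow> 'b) set \<Rightarrow> bool" where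
  "connected_alg_subgroup scale H \<longleftrightarrow>
     subgroup H (GL scale) \<and>
     closedin (subtopology (End_top scale) (carrier (GL scale))) H \<and>
     connected_space (subtopology (End_top scale) H)"

end

theory Submission
  imports Defs "HOL-Analysis.Abstract_Limits"
begin

text \<open>
  Dimensions of orbits come from an explicit chart.  Let \<open>L\<close> be a linear complement of
  \<open>E\<^bsup>(v,x)\<^esup>\<close> in \<open>End V\<close>.  The map \<open>l \<mapsto> (1 + l) \<cdot> (v, x)\<close> is regular where \<open>1 + l\<close> is invertible, and
  near \<open>(v, x)\<close> every point \<open>(u, y)\<close> of the orbit has a unique preimage \<open>l\<close> in \<open>L\<close>, the solution of the
  linear system \<open>(1 + l) v = u\<close>, \<open>y (1 + l) = (1 + l) x\<close>, which depends regularly on \<open>(u, y)\<close>.  So the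
  orbit is locally homeomorphic to a nonempty open subset of \<open>L\<close>.  The orbit of \<open>x\<close> alone is the case
  \<open>v = 0\<close>, and the stabilizers are open in the affine spaces \<open>1 + E\<^bsup>(v,x)\<^esup>\<close>.  It remains to compute
  \<open>dim E\<^bsup>(v,x)\<^esup> = dim E\<^sup>x - dim E\<^sup>x v\<close> from a normal basis.
\<close>

section \<open>Irreducibility and Krull dimension\<close>

text \<open>Krull dimension, being defined by chains of irreducible closed sets, is preserved by
  homeomorphisms and is local. Comparing the orbit with an open subset of \<open>L\<close> therefore
  avoids tangent spaces and any question of separability of the orbit map in positive
  characteristic. The linear system for \<open>l\<close> is overdetermined. A regular left inverse
  yields uniqueness and regularity of a solution, not its existence. Existence uses that
  \<open>(u, y)\<close> lies on the orbit: if \<open>(u, y) = h . (v, x)\<close>, then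
  \<open>h\<close> composed with the elements of \<open>End_ann scale v x\<close> solves the
  homogeneous system. These maps form a space of unchanged dimension that, near the base point,
  still meets \<open>L\<close> only in 0, so it is again a complement of \<open>L\<close>. Splitting
  \<open>1 - h\<close> along it replaces \<open>h\<close> by \<open>h (1 + beta) = 1 + l\<close>
  with \<open>beta\<close> in the annihilator and \<open>l\<close> in \<open>L\<close>. Openness of
  \<open>GL V\<close>, regularity of conjugation and regularity of the chart all come from the one
  fact \<open>regular_left_inverse\<close>, so no determinant is ever expanded. The field enters the
  topology by being infinite: a nonzero polynomial on a line has a nonroot.\<close>

lemma irreducible_space_iff_open:
  "irreducible_space X \<longleftrightarrow> topspace X \<noteq> {} \<and>
     (\<forall>U V. openin X U \<and> openin X V \<and> U \<noteq> {} \<and> V \<noteq> {} \<longrightarrow> U \<inter> V \<noteq> {})"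
  (is "_ \<longleftrightarrow> _ \<and> ?R")
proof -
  have "(\<forall>A B. closedin X A \<and> closedin X B \<and> topspace X = A \<union> B \<longrightarrow>
        A = topspace X \<or> B = topspace X) \<longleftrightarrow> ?R" (is "?L \<longleftrightarrow> _")
  proof
    assume L: ?L
    show ?R
    proof (intro allI impI notI)
      fix U V assume *: "openin X U \<and> openin X V \<and> U \<noteq> {} \<and> V \<noteq> {}" "U \<inter> V = {}"
      then have "closedin X (topspace X - U)" "closedin X (topspace X - V)"
        "topspace X = (topspace X - U) \<union> (topspace X - V)" by auto
      then have "topspace X - U = topspace X \<or> topspace X - V = topspace X" using L by blast
      then show False using * by (auto dest!: openin_subset)
    qed
  next
    assume R: ?R
    show ?L
    proof (intro allI impI)
      fix A B assume *: "closedin X A \<and> closedin X B \<and> topspace X = A \<union> B"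
      then have "openin X (topspace X - A)" "openin X (topspace X - B)"
        "(topspace X - A) \<inter> (topspace X - B) = {}"
        by (blast intro: openin_diff openin_topspace)+
      then have "topspace X - A = {} \<or> topspace X - B = {}" using R by blast
      then show "A = topspace X \<or> B = topspace X" using * by auto
    qed
  qed
  then show ?thesis unfolding irreducible_space_def by simp
qed

lemma irreducible_subtopology_iff:
  assumes "S \<subseteq> topspace X"
  shows "irreducible_space (subtopology X S) \<longleftrightarrow> S \<noteq> {} \<and>
     (\<forall>U V. openin X U \<and> openin X V \<and> S \<inter> U \<noteq> {} \<and> S \<inter> V \<noteq> {} \<longrightarrow> S \<inter> U \<inter> V \<noteq> {})"
proof -
  have top: "topspace (subtopology X S) = S" using assms by auto
  have "(\<forall>U V. openin (subtopology X S) U \<and> openin (subtopology X S) V \<and> U \<noteq> {} \<and> V \<noteq> {} \<longrightarrow> U \<inter> V \<noteq> {})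
    \<longleftrightarrow> (\<forall>U V. openin X U \<and> openin X V \<and> S \<inter> U \<noteq> {} \<and> S \<inter> V \<noteq> {} \<longrightarrow> S \<inter> U \<inter> V \<noteq> {})"
    (is "?L \<longleftrightarrow> ?R")
  proof
    assume L: ?L
    show ?R
    proof (intro allI impI)
      fix U V assume *: "openin X U \<and> openin X V \<and> S \<inter> U \<noteq> {} \<and> S \<inter> V \<noteq> {}"
      then have "openin (subtopology X S) (S \<inter> U)" "openin (subtopology X S) (S \<inter> V)"
        by (auto simp: openin_subtopology)
      then have "(S \<inter> U) \<inter> (S \<inter> V) \<noteq> {}" using L * by blast
      then show "S \<inter> U \<inter> V \<noteq> {}" by blast
    qed
  next
    assume R: ?R
    show ?L
    proof (intro allI impI)
      fix U V assume *: "openin (subtopology X S) U \<and> openin (subtopology X S) V \<and> U \<noteq> {} \<and> V \<noteq> {}"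
      then obtain U' V' where UV: "openin X U'" "U = U' \<inter> S" "openin X V'" "V = V' \<inter> S"
        unfolding openin_subtopology by auto
      then have "S \<inter> U' \<inter> V' \<noteq> {}" using R * by blast
      then show "U \<inter> V \<noteq> {}" using UV by blast
    qed
  qed
  then show ?thesis unfolding irreducible_space_iff_open top by simp
qed

lemma irreducible_imp_connected_space:
  assumes "irreducible_space X" shows "connected_space X"
  using assms unfolding irreducible_space_iff_open connected_space_def by blast

lemma irreducible_continuous_image:
  assumes "irreducible_space X" "continuous_map X Y f" "f ` topspace X = topspace Y"
  shows "irreducible_space Y"
  unfolding irreducible_space_iff_open
proof (intro conjI allI impI)
  show "topspace Y \<noteq> {}" using assms unfolding irreducible_space_iff_open by auto
  fix U V assume *: "openin Y U \<and> openin Y V \<and> U \<noteq> {} \<and> V \<noteq> {}"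
  let ?P = "\<lambda>U. {x \<in> topspace X. f x \<in> U}"
  have "openin X (?P U)" "openin X (?P V)"
    using * assms(2) by (auto intro: openin_continuous_map_preimage)
  moreover have "U \<subseteq> f ` topspace X" "V \<subseteq> f ` topspace X"
    using * assms(3) by (auto dest: openin_subset)
  then have "?P U \<noteq> {}" "?P V \<noteq> {}" using * by fast+
  ultimately have "?P U \<inter> ?P V \<noteq> {}" using assms(1) unfolding irreducible_space_iff_open by blast
  then show "U \<inter> V \<noteq> {}" by blast
qed

lemma irreducible_closure_of:
  assumes "S \<subseteq> topspace X" "irreducible_space (subtopology X S)"
  shows "irreducible_space (subtopology X (X closure_of S))"
proof -
  have I: "(X closure_of S) \<inter> U \<noteq> {} \<longleftrightarrow> S \<inter> U \<noteq> {}" if "openin X U" for U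
    using openin_Int_closure_of_eq_empty[OF that] by blast
  have S: "S \<noteq> {}" "\<And>U V. openin X U \<Longrightarrow> openin X V \<Longrightarrow> S \<inter> U \<noteq> {} \<Longrightarrow> S \<inter> V \<noteq> {} \<Longrightarrow> S \<inter> U \<inter> V \<noteq> {}"
    using assms irreducible_subtopology_iff[OF assms(1)] by auto
  show ?thesis
    unfolding irreducible_subtopology_iff[OF closure_of_subset_topspace]
  proof (intro conjI allI impI)
    show "X closure_of S \<noteq> {}" using S(1) closure_of_subset[OF assms(1)] by blast
    fix U V assume *: "openin X U \<and> openin X V \<and> X closure_of S \<inter> U \<noteq> {} \<and> X closure_of S \<inter> V \<noteq> {}"
    then have "S \<inter> U \<noteq> {}" "S \<inter> V \<noteq> {}" by (metis I)+
    then have "S \<inter> U \<inter> V \<noteq> {}" using * S(2)[of U V] by blast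
    then show "X closure_of S \<inter> U \<inter> V \<noteq> {}" using closure_of_subset[OF assms(1)] by blast
  qed
qed

text \<open>In an irreducible set any two nonempty relatively open subsets meet, so each of them is
  irreducible and dense. Density is what recovers a chain member from its trace on
  \<open>W\<close>.\<close>

lemma irreducible_Int_open:
  assumes "C \<subseteq> topspace X" "irreducible_space (subtopology X C)" "openin X W" "C \<inter> W \<noteq> {}"
  shows "irreducible_space (subtopology X (C \<inter> W))" "C \<subseteq> X closure_of (C \<inter> W)"
proof -
  have C: "\<And>U V. openin X U \<Longrightarrow> openin X V \<Longrightarrow> C \<inter> U \<noteq> {} \<Longrightarrow> C \<inter> V \<noteq> {} \<Longrightarrow> C \<inter> U \<inter> V \<noteq> {}"
    using assms irreducible_subtopology_iff[OF assms(1)] by auto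
  have sub: "C \<inter> W \<subseteq> topspace X" using assms(1) by blast
  show "irreducible_space (subtopology X (C \<inter> W))"
    unfolding irreducible_subtopology_iff[OF sub]
  proof (intro conjI allI impI)
    show "C \<inter> W \<noteq> {}" by fact
    fix U V assume *: "openin X U \<and> openin X V \<and> C \<inter> W \<inter> U \<noteq> {} \<and> C \<inter> W \<inter> V \<noteq> {}"
    then have "C \<inter> (W \<inter> U) \<inter> (W \<inter> V) \<noteq> {}" using assms(3) by (intro C) auto
    then show "C \<inter> W \<inter> U \<inter> V \<noteq> {}" by blast
  qed
  show "C \<subseteq> X closure_of (C \<inter> W)"
  proof
    fix p assume p: "p \<in> C"
    show "p \<in> X closure_of (C \<inter> W)"
      unfolding in_closure_of
    proof (intro conjI allI impI)
      show "p \<in> topspace X" using p assms(1) by blast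
      fix T assume "p \<in> T \<and> openin X T"
      then have "C \<inter> T \<inter> W \<noteq> {}" using p assms(3,4) by (intro C) auto
      then show "\<exists>y. y \<in> C \<inter> W \<and> y \<in> T" by blast
    qed
  qed
qed

definition irr_chain :: "'b topology \<Rightarrow> nat \<Rightarrow> (nat \<Rightarrow> 'b set) \<Rightarrow> bool" where
  "irr_chain X k C \<longleftrightarrow>
     (\<forall>i\<le>k. closedin X (C i) \<and> irreducible_space (subtopology X (C i))) \<and>
     (\<forall>i<k. C i \<subset> C (Suc i))"

lemma le_krull_dim: "irr_chain X k C \<Longrightarrow> ereal (real k) \<le> krull_dim X"
  unfolding krull_dim_def irr_chain_def by (rule SUP_upper) auto

lemma krull_dim_le: "(\<And>k C. irr_chain X k C \<Longrightarrow> ereal (real k) \<le> r) \<Longrightarrow> krull_dim X \<le> r"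
  unfolding krull_dim_def irr_chain_def by (rule SUP_least) auto

lemma irr_chainD:
  assumes "irr_chain X k C" "i \<le> k"
  shows "closedin X (C i)" "irreducible_space (subtopology X (C i))" "C i \<subseteq> topspace X" "C i \<noteq> {}"
proof -
  show c: "closedin X (C i)" and i: "irreducible_space (subtopology X (C i))"
    using assms unfolding irr_chain_def by auto
  show s: "C i \<subseteq> topspace X" using c by (rule closedin_subset)
  show "C i \<noteq> {}" using i unfolding irreducible_subtopology_iff[OF s] by simp
qed

lemma irr_chain_mono:
  assumes "irr_chain X k C" "i \<le> j" "j \<le> k"
  shows "C i \<subseteq> C j"
  using assms(2,3)
proof (induction j rule: dec_induct)
  case (step j)
  then have "C j \<subset> C (Suc j)" using assms(1) unfolding irr_chain_def by auto
  then show ?case using step by auto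
qed simp

text \<open>Taking closures in \<open>X\<close> turns a chain of \<open>S\<close> into a chain of
  \<open>X\<close>; it stays strict because intersecting a closure with \<open>S\<close> gives the
  original member back.\<close>

lemma krull_dim_subtopology_le: "krull_dim (subtopology X S) \<le> krull_dim X"
proof (rule krull_dim_le)
  fix k C assume C: "irr_chain (subtopology X S) k C"
  define D where "D i = X closure_of C i" for i
  have sub: "C i \<subseteq> topspace X" "C i \<subseteq> S" if "i \<le> k" for i
    using irr_chainD(3)[OF C that] by auto
  have eq: "D i \<inter> S = C i" if "i \<le> k" for i
  proof -
    have "subtopology X S closure_of (C i) = C i"
      using irr_chainD(1)[OF C that] by (simp add: closure_of_eq)
    then show ?thesis using sub[OF that] unfolding D_def closure_of_subtopology
      by (simp add: Int_absorb1 Int_absorb2 Int_commute)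
  qed
  have irr: "irreducible_space (subtopology X (C i))" if "i \<le> k" for i
    using irr_chainD(2)[OF C that] sub[OF that]
    by (simp add: subtopology_subtopology Int_absorb1)
  have "irr_chain X k D"
    unfolding irr_chain_def
  proof (intro conjI allI impI)
    fix i assume i: "i \<le> k"
    show "closedin X (D i)" unfolding D_def by simp
    show "irreducible_space (subtopology X (D i))"
      unfolding D_def using sub[OF i] irr[OF i] by (intro irreducible_closure_of)
  next
    fix i assume i: "i < k"
    have "C i \<subset> C (Suc i)" using C i unfolding irr_chain_def by auto
    moreover have "D i \<subseteq> D (Suc i)" unfolding D_def by (rule closure_of_mono) (use calculation in auto)
    moreover have "D i \<noteq> D (Suc i)" using eq[of i] eq[of "Suc i"] i calculation by auto
    ultimately show "D i \<subset> D (Suc i)" by blast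
  qed
  then show "ereal (real k) \<le> krull_dim X" by (rule le_krull_dim)
qed

text \<open>A neighbourhood \<open>W\<close> of a point of the smallest member meets every member of
  the chain. The traces on \<open>W\<close> are dense in the members, so the chain does not collapse
  when restricted to \<open>W\<close>.\<close>

lemma krull_dim_le_locally:
  assumes "\<And>p. p \<in> topspace X \<Longrightarrow> \<exists>W. openin X W \<and> p \<in> W \<and> krull_dim (subtopology X W) \<le> r"
  shows "krull_dim X \<le> r"
proof (rule krull_dim_le)
  fix k C assume C: "irr_chain X k C"
  obtain p where p: "p \<in> C 0" using irr_chainD(4)[OF C, of 0] by auto
  then have "p \<in> topspace X" using irr_chainD(3)[OF C, of 0] by auto
  then obtain W where W: "openin X W" "p \<in> W" "krull_dim (subtopology X W) \<le> r" using assms by blast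
  have ne: "C i \<inter> W \<noteq> {}" if "i \<le> k" for i using irr_chain_mono[OF C, of 0 i] that p W(2) by auto
  have "irr_chain (subtopology X W) k (\<lambda>i. C i \<inter> W)"
    unfolding irr_chain_def
  proof (intro conjI allI impI)
    fix i assume i: "i \<le> k"
    show "closedin (subtopology X W) (C i \<inter> W)"
      using irr_chainD(1)[OF C i] by (auto simp: closedin_subtopology)
    show "irreducible_space (subtopology (subtopology X W) (C i \<inter> W))"
      using irreducible_Int_open(1)[OF irr_chainD(3,2)[OF C i] W(1) ne[OF i]]
      by (simp add: subtopology_subtopology Int_absorb1)
  next
    fix i assume i: "i < k"
    have s: "C i \<subset> C (Suc i)" using C i unfolding irr_chain_def by auto
    have "C (Suc i) \<subseteq> C i" if "C i \<inter> W = C (Suc i) \<inter> W"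
    proof -
      have "C (Suc i) \<subseteq> X closure_of (C i \<inter> W)"
        using irreducible_Int_open(2)[OF irr_chainD(3,2)[OF C, of "Suc i"] W(1) ne] i that by simp
      also have "\<dots> \<subseteq> C i" using irr_chainD(1)[OF C, of i] i by (intro closure_of_minimal) auto
      finally show ?thesis .
    qed
    then show "C i \<inter> W \<subset> C (Suc i) \<inter> W" using s by blast
  qed
  then have "ereal (real k) \<le> krull_dim (subtopology X W)" by (rule le_krull_dim)
  then show "ereal (real k) \<le> r" using W(3) by simp
qed

lemma krull_dim_homeomorphic_le:
  assumes "X homeomorphic_space Y"
  shows "krull_dim X \<le> krull_dim Y"
proof (rule krull_dim_le)
  fix k C assume C: "irr_chain X k C"
  obtain f where f: "homeomorphic_map X Y f"
    using assms by (auto simp: homeomorphic_space)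
  have inj: "inj_on f (topspace X)" using f by (simp add: homeomorphic_eq_everything_map)
  have "irr_chain Y k (\<lambda>i. f ` C i)"
    unfolding irr_chain_def
  proof (intro conjI allI impI)
    fix i assume i: "i \<le> k"
    show "closedin Y (f ` C i)"
      using irr_chainD(1,3)[OF C i] homeomorphic_map_closedness[OF f] by blast
    have "homeomorphic_map (subtopology X (C i)) (subtopology Y (f ` C i)) f"
      using irr_chainD(3)[OF C i] closedin_subset[OF \<open>closedin Y (f ` C i)\<close>]
        homeomorphic_imp_surjective_map[OF f] inj
      by (intro homeomorphic_map_subtopologies[OF f]) (auto dest: inj_onD)
    then show "irreducible_space (subtopology Y (f ` C i))"
      by (intro irreducible_continuous_image[OF irr_chainD(2)[OF C i]]
          homeomorphic_imp_continuous_map homeomorphic_imp_surjective_map)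
  next
    fix i assume i: "i < k"
    have s: "C i \<subset> C (Suc i)" using C i unfolding irr_chain_def by auto
    have "inj_on f (C (Suc i))"
      using inj irr_chainD(3)[OF C, of "Suc i"] i by (auto intro: inj_on_subset)
    with s show "f ` C i \<subset> f ` C (Suc i)" 
      using inj_on_image_eq_iff[of f "C (Suc i)" "C i" "C (Suc i)"] by blast
  qed
  then show "ereal (real k) \<le> krull_dim Y" by (rule le_krull_dim)
qed

lemma krull_dim_homeomorphic: "X homeomorphic_space Y \<Longrightarrow> krull_dim X = krull_dim Y"
  using krull_dim_homeomorphic_le homeomorphic_space_sym by (metis order_antisym)

section \<open>The Zariski topology\<close>

text \<open>Since \<open>zariski s W\<close> makes sense for every subset \<open>W\<close>, orbits,
  stabilizers and chart domains can all be treated as spaces of this form, without nested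
  subtopologies.\<close>

lemma subtopology_zariski:
  fixes s :: "'a::field \<Rightarrow> 'b::ab_group_add \<Rightarrow> 'b"
  shows "subtopology (zariski s W) A = zariski s (W \<inter> A)"
proof -
  have eq: "(W - zero_set W S) \<inter> A = (W \<inter> A) - zero_set (W \<inter> A) S" for S :: "('b \<Rightarrow> 'a) set"
    unfolding zero_set_def by blast
  show ?thesis
    unfolding topology_eq openin_subtopology openin_zariski by (metis (no_types) eq)
qed

text \<open>The principal open sets \<open>q u \<noteq> 0\<close> form a basis; from here on
  openness is handled through a single polynomial function near each point.\<close>

lemma openin_zariskiD:
  assumes "openin (zariski s A) U" "w \<in> U"
  obtains q where "q \<in> poly_funs s" "q w \<noteq> 0" "\<And>u. u \<in> A \<Longrightarrow> q u \<noteq> 0 \<Longrightarrow> u \<in> U"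
proof -
  obtain S where S: "S \<subseteq> poly_funs s" "U = A - zero_set A S"
    using assms(1) unfolding openin_zariski by blast
  then obtain q where "q \<in> S" "q w \<noteq> 0" using assms(2) unfolding zero_set_def by auto
  then show thesis using S by (intro that[of q]) (auto simp: zero_set_def)
qed

lemma openin_zariskiI:
  assumes "U \<subseteq> A"
    and "\<And>w. w \<in> U \<Longrightarrow> \<exists>q\<in>poly_funs s. q w \<noteq> 0 \<and> (\<forall>u\<in>A. q u \<noteq> 0 \<longrightarrow> u \<in> U)"
  shows "openin (zariski s A) U"
  unfolding openin_zariski
proof (intro exI conjI)
  let ?S = "{q \<in> poly_funs s. \<forall>u\<in>A. q u \<noteq> 0 \<longrightarrow> u \<in> U}"
  show "?S \<subseteq> poly_funs s" by blast
  show "U = A - zero_set A ?S" using assms unfolding zero_set_def by blast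
qed

lemma openin_zariski_nonzero:
  "q \<in> poly_funs s \<Longrightarrow> openin (zariski s A) {u \<in> A. q u \<noteq> 0}"
  by (rule openin_zariskiI) auto

lemma poly_funs_sum:
  assumes "\<And>i. i \<in> I \<Longrightarrow> f i \<in> poly_funs s"
  shows "(\<lambda>w. \<Sum>i\<in>I. f i w) \<in> poly_funs s"
  using assms
  by (induction I rule: infinite_finite_induct) (auto intro: poly_funs.const poly_funs.add)

lemma poly_funs_power: "f \<in> poly_funs s \<Longrightarrow> (\<lambda>w. f w ^ k) \<in> poly_funs s"
  by (induction k) (auto intro: poly_funs.const poly_funs.mult)

lemma poly_funs_cmult: "f \<in> poly_funs s \<Longrightarrow> (\<lambda>w. c * f w) \<in> poly_funs s"
  by (intro poly_funs.mult poly_funs.const)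

lemma poly_funs_diff: "f \<in> poly_funs s \<Longrightarrow> g \<in> poly_funs s \<Longrightarrow> (\<lambda>w. f w - g w) \<in> poly_funs s"
  using poly_funs.add[OF _ poly_funs_cmult[of g s "-1"], of f] by simp

lemma poly_funs_on_line:
  fixes s :: "'a::field \<Rightarrow> 'b::ab_group_add \<Rightarrow> 'b"
  assumes "f \<in> poly_funs s"
  shows "\<exists>p. \<forall>t. f (a + s t c) = poly p t"
  using assms
proof (induction rule: poly_funs.induct)
  case (const k)
  show ?case by (intro exI[of _ "[:k:]"]) simp
next
  case (lin l)
  then interpret l: Vector_Spaces.linear s "(*)" l .
  show ?case by (intro exI[of _ "[:l a, l c:]"]) (simp add: l.add l.scale)
next
  case (add f g)
  then obtain p q where "\<forall>t. f (a + s t c) = poly p t" "\<forall>t. g (a + s t c) = poly q t" by blast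
  then show ?case by (intro exI[of _ "p + q"]) simp
next
  case (mult f g)
  then obtain p q where "\<forall>t. f (a + s t c) = poly p t" "\<forall>t. g (a + s t c) = poly q t" by blast
  then show ?case by (intro exI[of _ "p * q"]) simp
qed

lemma poly_nonzero_outside_finite:
  fixes p :: "'a::field poly"
  assumes "infinite (UNIV :: 'a set)" "p \<noteq> 0" "finite Z"
  shows "\<exists>t. t \<notin> Z \<and> poly p t \<noteq> 0"
proof -
  have "finite ({t. poly p t = 0} \<union> Z)" using assms poly_roots_finite by auto
  then obtain t where "t \<notin> {t. poly p t = 0} \<union> Z" using assms(1) ex_new_if_finite by blast
  then show ?thesis by auto
qed

text \<open>Join a point of \<open>P\<close> to a point of \<open>Q\<close> by a line. The two
  functions witnessing openness restrict to nonzero polynomials in one variable, and their product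
  has a nonroot. Hypothesis \<open>aff\<close> says that \<open>A\<close> is an affine
  subspace.\<close>

lemma irreducible_open_affine:
  fixes s :: "'a::field \<Rightarrow> 'b::ab_group_add \<Rightarrow> 'b"
  assumes s: "vector_space s" and inf: "infinite (UNIV :: 'a set)"
    and aff: "\<And>a b t. a \<in> A \<Longrightarrow> b \<in> A \<Longrightarrow> a + s t (b - a) \<in> A"
    and U: "openin (zariski s A) U" "U \<noteq> {}"
  shows "irreducible_space (zariski s U)"
  unfolding irreducible_space_iff_open
proof (intro conjI allI impI)
  interpret vector_space s by fact
  show "topspace (zariski s U) \<noteq> {}" using U by simp
  fix P Q assume *: "openin (zariski s U) P \<and> openin (zariski s U) Q \<and> P \<noteq> {} \<and> Q \<noteq> {}"
  have "zariski s U = subtopology (zariski s A) U"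
    using openin_subset[OF U(1)] by (simp add: subtopology_zariski Int_absorb1)
  then have PQ: "openin (zariski s A) P" "openin (zariski s A) Q"
    using * U(1) by (simp_all add: openin_open_subtopology)
  obtain a b where ab: "a \<in> P" "b \<in> Q" using * by blast
  obtain f where f: "f \<in> poly_funs s" "f a \<noteq> 0" "\<And>u. u \<in> A \<Longrightarrow> f u \<noteq> 0 \<Longrightarrow> u \<in> P"
    using openin_zariskiD[OF PQ(1) ab(1)] by blast
  obtain g where g: "g \<in> poly_funs s" "g b \<noteq> 0" "\<And>u. u \<in> A \<Longrightarrow> g u \<noteq> 0 \<Longrightarrow> u \<in> Q"
    using openin_zariskiD[OF PQ(2) ab(2)] by blast
  have A: "a \<in> A" "b \<in> A" using PQ ab openin_subset by fastforce+
  obtain p where p: "\<And>t. f (a + s t (b - a)) = poly p t" using poly_funs_on_line[OF f(1)] by blast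
  obtain q where q: "\<And>t. g (a + s t (b - a)) = poly q t" using poly_funs_on_line[OF g(1)] by blast
  have "p \<noteq> 0" "q \<noteq> 0" using p[of 0] q[of 1] f(2) g(2) by auto
  then obtain t where "poly (p * q) t \<noteq> 0"
    using poly_nonzero_outside_finite[OF inf, of "p * q" "{}"] by auto
  then have "a + s t (b - a) \<in> P \<inter> Q" using f(3) g(3) p q aff[OF A] by auto
  then show "P \<inter> Q \<noteq> {}" by blast
qed

text \<open>This is the statement that the coordinate ring of an irreducible set is a domain, in the
  form that allows cancelling a factor.\<close>

lemma irreducible_zero_product:
  assumes "irreducible_space (zariski s C)" "f \<in> poly_funs s" "g \<in> poly_funs s"
    and "\<And>w. w \<in> C \<Longrightarrow> f w * g w = 0"
  shows "(\<forall>w\<in>C. f w = 0) \<or> (\<forall>w\<in>C. g w = 0)"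
proof (rule ccontr)
  assume "\<not> ?thesis"
  then have "{u \<in> C. f u \<noteq> 0} \<noteq> {}" "{u \<in> C. g u \<noteq> 0} \<noteq> {}" by blast+
  then have "{u \<in> C. f u \<noteq> 0} \<inter> {u \<in> C. g u \<noteq> 0} \<noteq> {}"
    using assms(1) openin_zariski_nonzero[OF assms(2), of C] openin_zariski_nonzero[OF assms(3), of C]
    unfolding irreducible_space_iff_open by blast
  then show False using assms(4) by auto
qed

section \<open>Dimension of open subsets of affine spaces\<close>

lemma (in vector_space) independent_family_iff:
  assumes "finite I"
  shows "inj_on b I \<and> independent (b ` I) \<longleftrightarrow>
    (\<forall>c. (\<Sum>i\<in>I. scale (c i) (b i)) = 0 \<longrightarrow> (\<forall>i\<in>I. c i = 0))"
proof safe
  fix c i assume inj: "inj_on b I" and ind: "independent (b ` I)"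
    and c: "(\<Sum>i\<in>I. scale (c i) (b i)) = 0" and i: "i \<in> I"
  have "(\<Sum>v\<in>b ` I. scale (c (the_inv_into I b v)) v) = 0"
    using inj c by (simp add: sum.reindex the_inv_into_f_f cong: sum.cong)
  then have "c (the_inv_into I b (b i)) = 0"
    using independentD[OF ind, of "b ` I" "\<lambda>v. c (the_inv_into I b v)" "b i"] assms i by simp
  then show "c i = 0" using inj i by (simp add: the_inv_into_f_f)
next
  assume R: "\<forall>c. (\<Sum>i\<in>I. scale (c i) (b i)) = 0 \<longrightarrow> (\<forall>i\<in>I. c i = 0)"
  show inj: "inj_on b I"
  proof (rule inj_onI, rule ccontr)
    fix i j assume ij: "i \<in> I" "j \<in> I" "b i = b j" "i \<noteq> j"
    let ?c = "\<lambda>k. (if k = i then 1 else 0) - (if k = j then 1 else 0)"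
    have "(\<Sum>k\<in>I. scale (?c k) (b k)) = 0"
      using assms ij by (simp add: scale_left_diff_distrib sum_subtractf if_distrib[where f="\<lambda>c. scale c _"] cong: if_cong)
    then show False using R[rule_format, of ?c i] ij by simp
  qed
  assume "dependent (b ` I)"
  then obtain u where u: "(\<Sum>v\<in>b ` I. scale (u v) v) = 0" "\<exists>v\<in>b ` I. u v \<noteq> 0"
    using assms by (auto simp: dependent_finite)
  then show False using R[rule_format, of "\<lambda>i. u (b i)"] inj by (auto simp: sum.reindex)
qed

lemma (in vector_space) span_image_family:
  assumes "finite I"
  shows "span (b ` I) = {\<Sum>i\<in>I. scale (c i) (b i) | c. True}"
proof
  show "span (b ` I) \<subseteq> {\<Sum>i\<in>I. scale (c i) (b i) | c. True}" (is "_ \<subseteq> ?R")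
  proof (rule span_minimal)
    show "b ` I \<subseteq> ?R"
    proof (rule image_subsetI)
      fix i assume "i \<in> I"
      then have "(\<Sum>k\<in>I. scale (if k = i then 1 else 0) (b k)) = b i"
        using assms by (simp add: if_distrib[where f="\<lambda>c. scale c _"] cong: if_cong)
      from this[symmetric] show "b i \<in> ?R" by (intro CollectI exI conjI) auto
    qed
    show "subspace ?R"
    proof (rule subspaceI)
      show "0 \<in> ?R" by (intro CollectI exI[of _ "\<lambda>_. 0"]) simp
      fix x y assume "x \<in> ?R" "y \<in> ?R"
      then obtain c d where "x = (\<Sum>i\<in>I. scale (c i) (b i))" "y = (\<Sum>i\<in>I. scale (d i) (b i))" by blast
      then show "x + y \<in> ?R"
        by (intro CollectI exI[of _ "\<lambda>i. c i + d i"]) (simp add: scale_left_distrib sum.distrib)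
    next
      fix k x assume "x \<in> ?R"
      then obtain c where "x = (\<Sum>i\<in>I. scale (c i) (b i))" by blast
      then show "scale k x \<in> ?R"
        by (intro CollectI exI[of _ "\<lambda>i. k * c i"]) (simp add: scale_sum_right)
    qed
  qed
  show "?R \<subseteq> span (b ` I)" 
    by (blast intro: span_sum span_scale span_base)
qed

section \<open>Linear independence of functions restricted to a set\<close>

definition indep_on :: "'w set \<Rightarrow> 'i set \<Rightarrow> ('i \<Rightarrow> 'w \<Rightarrow> 'a::field) \<Rightarrow> bool" where
  "indep_on C I b \<longleftrightarrow> (\<forall>c. (\<forall>w\<in>C. (\<Sum>i\<in>I. c i * b i w) = 0) \<longrightarrow> (\<forall>i\<in>I. c i = 0))"

lemma indep_onD:
  assumes "indep_on C I b" "\<And>w. w \<in> C \<Longrightarrow> (\<Sum>i\<in>I. c i * b i w) = 0"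
  shows "\<forall>i\<in>I. c i = 0"
  using assms unfolding indep_on_def by blast

lemma indep_on_inj:
  fixes b :: "'i \<Rightarrow> 'w \<Rightarrow> 'a::field"
  assumes "indep_on C I b" "finite I"
  shows "inj_on b I"
proof (rule inj_onI, rule ccontr)
  fix i j assume ij: "i \<in> I" "j \<in> I" "b i = b j" "i \<noteq> j"
  let ?c = "\<lambda>k. (if k = i then 1 else 0) - (if k = j then 1 else 0) :: 'a"
  have "(\<Sum>k\<in>I. ?c k * b k w) = 0" for w
    using assms ij by (simp add: left_diff_distrib sum_subtractf if_distrib[where f="\<lambda>c. c * _"] cong: if_cong)
  then have "\<forall>k\<in>I. ?c k = 0" by (intro indep_onD[OF assms(1), of ?c])
  then show False using ij by auto
qed

text \<open>In a relation among the products \<open>b i * f^j\<close> on \<open>C\<close>, consider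
  the lowest power of \<open>f\<close> that could have nonzero coefficients. That power cancels
  because \<open>C\<close> is irreducible and \<open>f\<close> is not identically 0 on it; on
  \<open>C'\<close> the remaining positive powers of \<open>f\<close> vanish, which leaves a
  relation among the \<open>b i\<close>.\<close>

lemma indep_on_step:
  assumes fin: "finite I" and sub: "C' \<subseteq> C" and irr: "irreducible_space (zariski s C)"
    and f: "f \<in> poly_funs s" "\<And>w. w \<in> C' \<Longrightarrow> f w = 0" "w0 \<in> C" "f w0 \<noteq> 0"
    and b: "\<And>i. i \<in> I \<Longrightarrow> b i \<in> poly_funs s" and ind: "indep_on C' I b"
  shows "indep_on C (I \<times> {..d::nat}) (\<lambda>(i, j) w. b i w * f w ^ j)"
  unfolding indep_on_def
proof (intro allI impI)
  fix c assume c: "\<forall>w\<in>C. (\<Sum>ij\<in>I \<times> {..d}. c ij * (case ij of (i, j) \<Rightarrow> \<lambda>w. b i w * f w ^ j) w) = 0"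
  have c': "(\<Sum>i\<in>I. \<Sum>j\<le>d. c (i, j) * (b i w * f w ^ j)) = 0" if "w \<in> C" for w
    using c[rule_format, OF that] by (simp add: sum.cartesian_product case_prod_beta)
  have "\<forall>i\<in>I. c (i, j) = 0" if "j \<le> d" for j
    using that
  proof (induction j rule: less_induct)
    case (less j)
    \<comment> \<open>The relation divided by \<open>f^j\<close>; the coefficients below
      \<open>j\<close> are already known to be 0.\<close>
    define h where "h w = (\<Sum>i\<in>I. \<Sum>k\<in>{j..d}. c (i, k) * (b i w * f w ^ (k - j)))" for w
    have h: "h \<in> poly_funs s" unfolding h_def
      by (intro poly_funs_sum poly_funs_cmult poly_funs.mult poly_funs_power b f(1))
    have "f w ^ j * h w = 0" if w: "w \<in> C" for w
    proof -
      have "0 = (\<Sum>i\<in>I. \<Sum>k\<le>d. c (i, k) * (b i w * f w ^ k))" using c'[OF w] by simp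
      also have "\<dots> = (\<Sum>i\<in>I. \<Sum>k\<in>{j..d}. c (i, k) * (b i w * f w ^ k))"
      proof (rule sum.cong[OF refl], rule sum.mono_neutral_right)
        fix i assume i: "i \<in> I"
        show "\<forall>k\<in>{..d} - {j..d}. c (i, k) * (b i w * f w ^ k) = 0"
          using less i by auto
      qed auto
      also have "\<dots> = f w ^ j * h w"
        unfolding h_def sum_distrib_left
        by (intro sum.cong refl) (auto simp: power_add[symmetric])
      finally show ?thesis by simp
    qed
    then have "(\<forall>w\<in>C. f w ^ j = 0) \<or> (\<forall>w\<in>C. h w = 0)"
      by (intro irreducible_zero_product[OF irr] poly_funs_power f(1) h) auto
    moreover have "f w0 ^ j \<noteq> 0" using f(4) by simp
    ultimately have hC: "h w = 0" if "w \<in> C" for w using f(3) that by blast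
    have "(\<Sum>i\<in>I. c (i, j) * b i w) = 0" if w: "w \<in> C'" for w
    proof -
      have "(\<Sum>i\<in>I. c (i, j) * b i w) = h w"
        unfolding h_def
      proof (rule sum.cong[OF refl])
        fix i assume "i \<in> I"
        have "(\<Sum>k\<in>{j..d}. c (i, k) * (b i w * f w ^ (k - j))) = (\<Sum>k\<in>{j}. c (i, k) * (b i w * f w ^ (k - j)))"
          using less.prems f(2)[OF w] by (intro sum.mono_neutral_right) auto
        then show "c (i, j) * b i w = (\<Sum>k\<in>{j..d}. c (i, k) * (b i w * f w ^ (k - j)))" by simp
      qed
      then show ?thesis using hC w sub by auto
    qed
    then show ?case by (rule indep_onD[OF ind])
  qed
  then show "\<forall>ij\<in>I \<times> {..d}. c ij = 0" by auto
qed

lemma indep_on_card_le: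
  fixes b :: "'i \<Rightarrow> 'w \<Rightarrow> 'a::field"
  assumes fin: "finite I" "finite M" and ind: "indep_on C I b"
    and comb: "\<And>i. i \<in> I \<Longrightarrow> \<exists>c. \<forall>w\<in>C. b i w = (\<Sum>m\<in>M. c m * g m w)"
  shows "card I \<le> card M"
proof -
  interpret F: vector_space "fun_scale (*) :: 'a \<Rightarrow> ('w \<Rightarrow> 'a) \<Rightarrow> _"
    by (rule vector_space_fun_scale) (unfold_locales, simp_all add: algebra_simps)
  \<comment> \<open>Extending by 0 off \<open>C\<close> turns relations that hold on
    \<open>C\<close> into relations in the vector space of all functions, where the exchange bound
    applies.\<close>
  define r :: "('w \<Rightarrow> 'a) \<Rightarrow> 'w \<Rightarrow> 'a" where "r f = (\<lambda>w. if w \<in> C then f w else 0)" for f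
  have sum_r: "(\<Sum>i\<in>J. fun_scale (*) (c i) (r (h i))) = r (\<lambda>w. \<Sum>i\<in>J. c i * h i w)"
    for c :: "'j \<Rightarrow> 'a" and h and J
    by (rule ext, induction J rule: infinite_finite_induct) (auto simp: r_def fun_scale_def zero_fun_def plus_fun_def)
  have "inj_on (\<lambda>i. r (b i)) I \<and> F.independent ((\<lambda>i. r (b i)) ` I)"
    unfolding F.independent_family_iff[OF fin(1)] sum_r
  proof (intro allI impI)
    fix c assume z: "r (\<lambda>w. \<Sum>i\<in>I. c i * b i w) = 0"
    have "(\<Sum>i\<in>I. c i * b i w) = 0" if "w \<in> C" for w
      using fun_cong[OF z, of w] that by (simp add: r_def zero_fun_def)
    then show "\<forall>i\<in>I. c i = 0" by (rule indep_onD[OF ind])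
  qed
  moreover have "(\<lambda>i. r (b i)) ` I \<subseteq> F.span ((\<lambda>m. r (g m)) ` M)"
  proof (rule image_subsetI)
    fix i assume "i \<in> I"
    then obtain c where "\<forall>w\<in>C. b i w = (\<Sum>m\<in>M. c m * g m w)" using comb by blast
    then have "r (b i) = r (\<lambda>w. \<Sum>m\<in>M. c m * g m w)" by (auto simp: r_def)
    then show "r (b i) \<in> F.span ((\<lambda>m. r (g m)) ` M)"
      unfolding F.span_image_family[OF fin(2)] sum_r by blast
  qed
  ultimately have "card ((\<lambda>i. r (b i)) ` I) \<le> card ((\<lambda>m. r (g m)) ` M)"
    using F.independent_span_bound[of "(\<lambda>m. r (g m)) ` M"] fin by auto
  also have "\<dots> \<le> card M" using fin by (rule_tac card_image_le)
  finally show ?thesis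
    using \<open>inj_on (\<lambda>i. r (b i)) I \<and> _\<close> by (simp add: card_image)
qed

locale zariski_space = vector_space scale
  for scale :: "'a::field \<Rightarrow> 'b::ab_group_add \<Rightarrow> 'b" +
  assumes infinite_field: "infinite (UNIV :: 'a set)"
begin

lemma separating_functional:
  assumes "v \<notin> span S"
  obtains l where "Vector_Spaces.linear scale (*) l" "\<And>u. u \<in> span S \<Longrightarrow> l u = 0" "l v = 1"
proof -
  interpret P: vector_space_pair scale "(*) :: 'a \<Rightarrow> _"
    by unfold_locales (simp_all add: algebra_simps)
  obtain B where B: "B \<subseteq> S" "independent B" "S \<subseteq> span B"
    using maximal_independent_subset by blast
  have spB: "span B = span S" using B by (meson span_mono span_minimal subspace_span subset_antisym)
  have "independent (insert v B)" using B(2) assms spB by (intro independent_insertI) auto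
  then obtain l where l: "Vector_Spaces.linear scale (*) l" "\<forall>u\<in>insert v B. l u = (if u = v then 1 else 0)"
    using P.linear_independent_extend[of "insert v B" "\<lambda>u. if u = v then 1 else 0"] by blast
  have "v \<notin> B" using assms spB span_base by blast
  show thesis
  proof (rule that[OF l(1)])
    fix u assume "u \<in> span S"
    then have "u \<in> span B" using spB by simp
    moreover have "l b = 0" if "b \<in> B" for b using that l(2) \<open>v \<notin> B\<close> by auto
    ultimately show "l u = 0" using P.linear_eq_0_on_span[OF l(1)] by blast
  qed (use l in auto)
qed

section \<open>Monomials in affine coordinates and degree bounds\<close>

definition affine_monomial :: "'b set \<Rightarrow> 'b \<Rightarrow> ('b \<Rightarrow> nat) \<Rightarrow> 'b \<Rightarrow> 'a" where
  "affine_monomial B w0 a w = (\<Prod>b\<in>B. representation B (w - w0) b ^ a b)"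

text \<open>The bound is on each exponent separately, not on the total degree, so that the number of
  available monomials is exactly \<open>(D + 1) ^ card B\<close>. The base point \<open>w0\<close>
  makes the count apply to affine subspaces such as \<open>1 + E\<close>.\<close>

definition deg_le :: "'b set \<Rightarrow> 'b \<Rightarrow> 'b set \<Rightarrow> nat \<Rightarrow> ('b \<Rightarrow> 'a) \<Rightarrow> bool" where
  "deg_le B w0 X D f \<longleftrightarrow>
     (\<exists>c. \<forall>w\<in>X. f w = (\<Sum>a\<in>B \<rightarrow>\<^sub>E {..D}. c a * affine_monomial B w0 a w))"

lemma deg_le_cong: "(\<And>w. w \<in> X \<Longrightarrow> f w = g w) \<Longrightarrow> deg_le B w0 X D f \<longleftrightarrow> deg_le B w0 X D g"
  unfolding deg_le_def by simp

lemma deg_le_add: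
  assumes "deg_le B w0 X D f" "deg_le B w0 X D g"
  shows "deg_le B w0 X D (\<lambda>w. f w + g w)"
proof -
  obtain c d where "\<forall>w\<in>X. f w = (\<Sum>a\<in>B \<rightarrow>\<^sub>E {..D}. c a * affine_monomial B w0 a w)"
    "\<forall>w\<in>X. g w = (\<Sum>a\<in>B \<rightarrow>\<^sub>E {..D}. d a * affine_monomial B w0 a w)"
    using assms unfolding deg_le_def by blast
  then show ?thesis unfolding deg_le_def
    by (intro exI[of _ "\<lambda>a. c a + d a"]) (simp add: distrib_right sum.distrib)
qed

lemma deg_le_cmult:
  assumes "deg_le B w0 X D f"
  shows "deg_le B w0 X D (\<lambda>w. k * f w)"
proof -
  obtain c where "\<forall>w\<in>X. f w = (\<Sum>a\<in>B \<rightarrow>\<^sub>E {..D}. c a * affine_monomial B w0 a w)"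
    using assms unfolding deg_le_def by blast
  then show ?thesis unfolding deg_le_def
    by (intro exI[of _ "\<lambda>a. k * c a"]) (simp add: sum_distrib_left mult.assoc)
qed

lemma deg_le_sum:
  assumes "\<And>i. i \<in> I \<Longrightarrow> deg_le B w0 X D (f i)"
  shows "deg_le B w0 X D (\<lambda>w. \<Sum>i\<in>I. f i w)"
proof -
  have "deg_le B w0 X D (\<lambda>w. 0)" unfolding deg_le_def by (intro exI[of _ "\<lambda>_. 0"]) simp
  then show ?thesis using assms
    by (induction I rule: infinite_finite_induct) (simp_all add: deg_le_add)
qed

lemma deg_le_monomial:
  assumes "finite B" "\<And>b. b \<in> B \<Longrightarrow> a b \<le> D"
  shows "deg_le B w0 X D (affine_monomial B w0 a)"
proof -
  \<comment> \<open>Exponent vectors in the index set are undefined outside \<open>B\<close>;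
    restricting puts \<open>a\<close> into that set and leaves the monomial unchanged.\<close>
  have r: "restrict a B \<in> B \<rightarrow>\<^sub>E {..D}" using assms(2) by auto
  have m: "affine_monomial B w0 (restrict a B) w = affine_monomial B w0 a w" for w
    unfolding affine_monomial_def by (rule prod.cong) auto
  have fin: "finite (B \<rightarrow>\<^sub>E {..D})" using assms(1) by (intro finite_PiE) auto
  have "(\<Sum>a'\<in>B \<rightarrow>\<^sub>E {..D}. (if a' = restrict a B then 1 else 0) * affine_monomial B w0 a' w)
      = affine_monomial B w0 a w" for w
    using r fin by (simp add: if_distrib[where f="\<lambda>c. c * _"] m cong: if_cong)
  then show ?thesis unfolding deg_le_def
    by (intro exI[of _ "\<lambda>a'. if a' = restrict a B then 1 else 0"]) simp
qed

lemma deg_le_mono: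
  assumes "finite B" "deg_le B w0 X D f" "D \<le> E"
  shows "deg_le B w0 X E f"
proof -
  obtain c where c: "\<forall>w\<in>X. f w = (\<Sum>a\<in>B \<rightarrow>\<^sub>E {..D}. c a * affine_monomial B w0 a w)"
    using assms unfolding deg_le_def by blast
  have "deg_le B w0 X E (\<lambda>w. \<Sum>a\<in>B \<rightarrow>\<^sub>E {..D}. c a * affine_monomial B w0 a w)"
    using assms(3) by (intro deg_le_sum deg_le_cmult deg_le_monomial assms(1)) (fastforce simp: PiE_iff)
  then show ?thesis using c deg_le_cong by (metis (no_types, lifting))
qed

lemma deg_le_mult:
  assumes "finite B" "deg_le B w0 X D f" "deg_le B w0 X E g"
  shows "deg_le B w0 X (D + E) (\<lambda>w. f w * g w)"
proof -
  obtain c d where c: "\<forall>w\<in>X. f w = (\<Sum>a\<in>B \<rightarrow>\<^sub>E {..D}. c a * affine_monomial B w0 a w)"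
    and d: "\<forall>w\<in>X. g w = (\<Sum>a\<in>B \<rightarrow>\<^sub>E {..E}. d a * affine_monomial B w0 a w)"
    using assms unfolding deg_le_def by blast
  have m: "affine_monomial B w0 a w * affine_monomial B w0 a' w = affine_monomial B w0 (\<lambda>b. a b + a' b) w" for a a' w
    unfolding affine_monomial_def by (simp add: power_add prod.distrib)
  have "deg_le B w0 X (D + E) (\<lambda>w. \<Sum>a\<in>B \<rightarrow>\<^sub>E {..D}. \<Sum>a'\<in>B \<rightarrow>\<^sub>E {..E}.
      (c a * d a') * affine_monomial B w0 (\<lambda>b. a b + a' b) w)"
    by (intro deg_le_sum deg_le_cmult deg_le_monomial assms(1) add_mono) (auto simp: PiE_iff)
  moreover have "(\<Sum>a\<in>B \<rightarrow>\<^sub>E {..D}. \<Sum>a'\<in>B \<rightarrow>\<^sub>E {..E}.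
      (c a * d a') * affine_monomial B w0 (\<lambda>b. a b + a' b) w) = f w * g w" if "w \<in> X" for w
    using c d that by (simp add: sum_product m[symmetric] algebra_simps)
  ultimately show ?thesis using deg_le_cong[of X] by (metis (no_types, lifting))
qed

lemma deg_le_const: "finite B \<Longrightarrow> deg_le B w0 X 0 (\<lambda>_. k)"
  using deg_le_cmult[OF deg_le_monomial[of B "\<lambda>_. 0" 0], of w0 X k]
  by (simp add: affine_monomial_def)

lemma deg_le_power:
  assumes "finite B" "deg_le B w0 X D f"
  shows "deg_le B w0 X (j * D) (\<lambda>w. f w ^ j)"
proof (induction j)
  case 0
  then show ?case using deg_le_const[OF assms(1), of w0 X 1] by simp
next
  case (Suc j)
  then show ?case using deg_le_mult[OF assms(1) assms(2) Suc] by simp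
qed

lemma poly_funs_deg_le:
  assumes B: "finite B" "independent B" and X: "\<And>w. w \<in> X \<Longrightarrow> w - w0 \<in> span B"
    and f: "f \<in> poly_funs scale"
  shows "\<exists>D. deg_le B w0 X D f"
  using f
proof (induction rule: poly_funs.induct)
  case (const c)
  then show ?case using deg_le_const[OF B(1)] by blast
next
  case (lin l)
  then interpret l: Vector_Spaces.linear scale "(*)" l .
  \<comment> \<open>The monomial with exponent 1 at \<open>b\<close> and 0 elsewhere is the
    coordinate of \<open>w - w0\<close> at \<open>b\<close>, so this is the coordinate expansion of
    \<open>l\<close> around \<open>w0\<close>.\<close>
  have "deg_le B w0 X 1 (\<lambda>w. l w0 + (\<Sum>b\<in>B. l b * affine_monomial B w0 (\<lambda>b'. if b' = b then 1 else 0) w))"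
    by (intro deg_le_add deg_le_mono[OF B(1) deg_le_const[OF B(1)]] deg_le_sum deg_le_cmult
        deg_le_monomial[OF B(1)]) auto
  moreover have "l w0 + (\<Sum>b\<in>B. l b * affine_monomial B w0 (\<lambda>b'. if b' = b then 1 else 0) w) = l w"
    if "w \<in> X" for w
  proof -
    have "affine_monomial B w0 (\<lambda>b'. if b' = b then 1 else 0) w = representation B (w - w0) b" if "b \<in> B" for b
      unfolding affine_monomial_def using B(1) that
      by (simp add: if_distrib[where f="\<lambda>n. _ ^ n"] cong: if_cong)
    then have "(\<Sum>b\<in>B. l b * affine_monomial B w0 (\<lambda>b'. if b' = b then 1 else 0) w)
        = (\<Sum>b\<in>B. l (scale (representation B (w - w0) b) b))"
      by (simp add: l.scale mult.commute)
    also have "\<dots> = l (w - w0)"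
      unfolding l.sum[symmetric] by (subst sum_representation_eq) (use B X that in auto)
    finally show ?thesis by (simp add: l.diff)
  qed
  ultimately show ?case using deg_le_cong[of X] by (metis (no_types, lifting))
next
  case (add f g)
  then obtain D E where "deg_le B w0 X D f" "deg_le B w0 X E g" by blast
  then have "deg_le B w0 X (D + E) f" "deg_le B w0 X (D + E) g"
    using deg_le_mono[OF B(1)] by auto
  then show ?case using deg_le_add by blast
next
  case (mult f g)
  then show ?case using deg_le_mult[OF B(1)] by blast
qed

text \<open>
  Choose \<open>f\<^sub>i\<close> vanishing on the \<open>i\<close>-th member of a chain of irreducible closed sets but not on the
  next one.  The monomials in the \<open>f\<^sub>i\<close> are linearly independent, so for exponents up to \<open>d\<close>
  there are too many of them, unless the chain is short.
\<close>

lemma krull_dim_affine_le: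
  assumes B: "finite B" "independent B" and X: "\<And>w. w \<in> X \<Longrightarrow> w - w0 \<in> span B"
  shows "krull_dim (zariski scale X) \<le> ereal (real (card B))"
proof (rule krull_dim_le)
  fix k C assume C: "irr_chain (zariski scale X) k C"
  have CX: "C i \<subseteq> X" if "i \<le> k" for i using irr_chainD(3)[OF C that] by simp
  have irr: "irreducible_space (zariski scale (C i))" if "i \<le> k" for i
    using irr_chainD(2)[OF C that] CX[OF that] by (simp add: subtopology_zariski Int_absorb1)
  have "\<exists>f\<in>poly_funs scale. (\<forall>w\<in>C i. f w = 0) \<and> (\<exists>w\<in>C (Suc i). f w \<noteq> 0)" if i: "i < k" for i
  proof -
    obtain S where S: "S \<subseteq> poly_funs scale" "C i = zero_set X S"
      using irr_chainD(1)[OF C, of i] i unfolding closedin_zariski by auto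
    have "C i \<subset> C (Suc i)" using C i unfolding irr_chain_def by auto
    then obtain w where w: "w \<in> C (Suc i)" "w \<notin> C i" by blast
    then have "w \<in> X" using CX[of "Suc i"] i by auto
    then obtain f where "f \<in> S" "f w \<noteq> 0" using w S(2) unfolding zero_set_def by blast
    then show ?thesis using S w unfolding zero_set_def by blast
  qed
  then obtain f where f: "\<And>i. i < k \<Longrightarrow> f i \<in> poly_funs scale"
    "\<And>i w. i < k \<Longrightarrow> w \<in> C i \<Longrightarrow> f i w = 0" "\<And>i. i < k \<Longrightarrow> \<exists>w\<in>C (Suc i). f i w \<noteq> 0"
    by metis
  obtain Df where Df: "\<And>i. i < k \<Longrightarrow> deg_le B w0 X (Df i) (f i)"
    using poly_funs_deg_le[OF B X f(1)] by metis
  \<comment> \<open>A single degree bound valid for all \<open>f i\<close>; only its independence of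
    \<open>d\<close> matters.\<close>
  define E where "E = (\<Sum>i<k. Df i)"
  have E: "deg_le B w0 X E (f i)" if "i < k" for i
    unfolding E_def using that by (intro deg_le_mono[OF B(1) Df[OF that]] member_le_sum) auto
  \<comment> \<open>\<open>F\<close> consists of the products of powers of \<open>f 0\<close>, ...,
    \<open>f (i - 1)\<close> with exponents at most \<open>d\<close>; passing from \<open>i\<close>
    to \<open>i + 1\<close> is \<open>indep_on_step\<close>.\<close>
  have claim: "\<exists>F. finite F \<and> F \<subseteq> poly_funs scale \<and> card F = (d + 1) ^ i \<and>
      indep_on (C i) F (\<lambda>f. f) \<and> (\<forall>f\<in>F. deg_le B w0 X (i * (d * E)) f)" if "i \<le> k" for i d
    using that
  proof (induction i)
    case 0
    obtain w where "w \<in> C 0" using irr_chainD(4)[OF C, of 0] by auto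
    then have "indep_on (C 0) {\<lambda>_. 1 :: 'a} (\<lambda>f. f)" unfolding indep_on_def by auto
    then show ?case using deg_le_const[OF B(1), of w0 X 1]
      by (intro exI[of _ "{\<lambda>_. 1}"]) (auto intro: poly_funs.const)
  next
    case (Suc i)
    then obtain F where F: "finite F" "F \<subseteq> poly_funs scale" "card F = (d + 1) ^ i"
      "indep_on (C i) F (\<lambda>f. f)" "\<And>g. g \<in> F \<Longrightarrow> deg_le B w0 X (i * (d * E)) g"
      by (metis Suc_leD)
    have i: "i < k" using Suc by simp
    define \<phi> where "\<phi> = (\<lambda>(g, j::nat) w. g w * f i w ^ j)"
    obtain w where w: "w \<in> C (Suc i)" "f i w \<noteq> 0" using f(3)[OF i] by blast
    have ind: "indep_on (C (Suc i)) (F \<times> {..d}) \<phi>"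
      unfolding \<phi>_def
      by (rule indep_on_step[where C' = "C i" and s = scale])
         (use F f(1,2)[OF i] w irr[of "Suc i"] i irr_chain_mono[OF C, of i "Suc i"] in auto)
    have inj: "inj_on \<phi> (F \<times> {..d})" using indep_on_inj[OF ind] F(1) by simp
    show ?case
    proof (intro exI[of _ "\<phi> ` (F \<times> {..d})"] conjI ballI)
      show "finite (\<phi> ` (F \<times> {..d}))" using F(1) by simp
      show "\<phi> ` (F \<times> {..d}) \<subseteq> poly_funs scale"
        unfolding \<phi>_def using F(2) f(1)[OF i] by (auto intro!: poly_funs.mult poly_funs_power)
      show "card (\<phi> ` (F \<times> {..d})) = (d + 1) ^ Suc i"
        using inj F(3) by (simp add: card_image card_cartesian_product)
      show "indep_on (C (Suc i)) (\<phi> ` (F \<times> {..d})) (\<lambda>f. f)"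
        unfolding indep_on_def
      proof (intro allI impI)
        fix c assume "\<forall>w\<in>C (Suc i). (\<Sum>f\<in>\<phi> ` (F \<times> {..d}). c f * f w) = 0"
        then have "(\<Sum>p\<in>F \<times> {..d}. c (\<phi> p) * \<phi> p w) = 0" if "w \<in> C (Suc i)" for w
          using that inj by (simp add: sum.reindex)
        then show "\<forall>f\<in>\<phi> ` (F \<times> {..d}). c f = 0"
          using indep_onD[OF ind, of "\<lambda>p. c (\<phi> p)"] by blast
      qed
      fix h assume "h \<in> \<phi> ` (F \<times> {..d})"
      then obtain g j where h: "g \<in> F" "j \<le> d" "h = (\<lambda>w. g w * f i w ^ j)" unfolding \<phi>_def by auto
      have "deg_le B w0 X (i * (d * E) + j * E) h"
        unfolding h(3) by (intro deg_le_mult[OF B(1)] deg_le_power[OF B(1)] F(5) E i h)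
      then show "deg_le B w0 X (Suc i * (d * E)) h"
        by (rule deg_le_mono[OF B(1)]) (use h(2) in simp)
    qed
  qed
  have le: "(d + 1) ^ k \<le> (k * (d * E) + 1) ^ card B" for d
  proof -
    obtain F where F: "finite F" "card F = (d + 1) ^ k"
      "indep_on (C k) F (\<lambda>f. f)" "\<And>g. g \<in> F \<Longrightarrow> deg_le B w0 X (k * (d * E)) g"
      using claim[of k d] by blast
    have "card F \<le> card (B \<rightarrow>\<^sub>E {..k * (d * E)})"
    proof (rule indep_on_card_le[OF F(1) _ F(3)])
      show "finite (B \<rightarrow>\<^sub>E {..k * (d * E)})" using B(1) by (intro finite_PiE) auto
      show "\<exists>c. \<forall>w\<in>C k. g w = (\<Sum>a\<in>B \<rightarrow>\<^sub>E {..k * (d * E)}. c a * affine_monomial B w0 a w)"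
        if "g \<in> F" for g
        using F(4)[OF that] CX[of k] unfolding deg_le_def by blast
    qed
    then show ?thesis using F(2) B(1) by (simp add: card_PiE)
  qed
  have "k \<le> card B"
  proof (rule ccontr)
    assume "\<not> k \<le> card B"
    then have k: "Suc (card B) \<le> k" by simp
    \<comment> \<open>Since \<open>k * (d * E) + 1\<close> is at most \<open>K * (d + 1)\<close>,
      the count gives \<open>(d + 1) ^ Suc (card B)\<close> at most
      \<open>K ^ card B * (d + 1) ^ card B\<close>; the choice \<open>d = K ^ card B\<close> makes
      this absurd.\<close>
    define K where "K = k * E + 1"
    define d where "d = K ^ card B"
    have "(d + 1) ^ Suc (card B) \<le> (d + 1) ^ k" using k by (intro power_increasing) auto
    also have "\<dots> \<le> (k * (d * E) + 1) ^ card B" by (rule le)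
    also have "\<dots> \<le> (K * (d + 1)) ^ card B"
      unfolding K_def by (intro power_mono) (simp_all add: algebra_simps)
    also have "\<dots> = d * (d + 1) ^ card B" unfolding power_mult_distrib d_def ..
    finally show False by simp
  qed
  then show "ereal (real k) \<le> ereal (real (card B))" by simp
qed

section \<open>Affine subspaces as closed sets, and the lower bound for the dimension\<close>

lemma closedin_affine: "closedin (zariski scale A) {w \<in> A. w - p \<in> span S}"
  unfolding closedin_zariski
proof (intro exI conjI)
  let ?S = "{f \<in> poly_funs scale. \<forall>w. w - p \<in> span S \<longrightarrow> f w = 0}"
  show "?S \<subseteq> poly_funs scale" by blast
  show "{w \<in> A. w - p \<in> span S} = zero_set A ?S"
  proof
    show "{w \<in> A. w - p \<in> span S} \<subseteq> zero_set A ?S" unfolding zero_set_def by blast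
    show "zero_set A ?S \<subseteq> {w \<in> A. w - p \<in> span S}"
    proof
      fix w assume w: "w \<in> zero_set A ?S"
      have "w - p \<in> span S"
      proof (rule ccontr)
        assume "w - p \<notin> span S"
        then obtain l where l: "Vector_Spaces.linear scale (*) l"
          "\<And>u. u \<in> span S \<Longrightarrow> l u = 0" "l (w - p) = 1"
          using separating_functional by metis
        interpret l: Vector_Spaces.linear scale "(*)" l by fact
        have "(\<lambda>u. l u - l p) \<in> poly_funs scale"
          by (intro poly_funs_diff poly_funs.lin[OF l(1)] poly_funs.const)
        moreover have "l u - l p = 0" if "u - p \<in> span S" for u using l(2)[OF that] by (simp add: l.diff)
        ultimately have "(\<lambda>u. l u - l p) \<in> ?S" by blast
        moreover have "\<forall>f\<in>?S. f w = 0" using w unfolding zero_set_def mem_Collect_eq by (rule conjunct2)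
        ultimately have "l w - l p = 0" by (rule bspec[rotated])
        then show False using l(3) by (simp add: l.diff)
      qed
      then show "w \<in> {w \<in> A. w - p \<in> span S}" using w unfolding zero_set_def by blast
    qed
  qed
qed

text \<open>A complete flag of affine subspaces through a point \<open>p\<close> of
  \<open>U\<close>, cut down to \<open>U\<close>, is a chain of the required length.\<close>

lemma krull_dim_affine_ge:
  assumes B: "finite B" "independent B"
    and U: "openin (zariski scale {w. w - w0 \<in> span B}) U" "U \<noteq> {}"
  shows "ereal (real (card B)) \<le> krull_dim (zariski scale U)"
proof -
  let ?A = "{w. w - w0 \<in> span B}"
  obtain p where p: "p \<in> U" using U by blast
  have UA: "U \<subseteq> ?A" using openin_subset[OF U(1)] by simp
  obtain bs where bs: "distinct bs" "set bs = B" using finite_distinct_list[OF B(1)] by blast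
  define L where "L i = span (set (take i bs))" for i
  define C where "C i = {w \<in> U. w - p \<in> L i}" for i
  have L: "subspace (L i)" "L i \<subseteq> span B" for i
    unfolding L_def bs(2)[symmetric] by (auto intro!: span_mono set_take_subset simp del: span_eq_iff)
  have Lmono: "L i \<subseteq> L (Suc i)" for i
    unfolding L_def by (intro span_mono set_take_subset_set_take) simp
  have "irr_chain (zariski scale U) (card B) C"
    unfolding irr_chain_def
  proof (intro conjI allI impI)
    fix i assume i: "i \<le> card B"
    show "closedin (zariski scale U) (C i)" unfolding C_def L_def by (rule closedin_affine)
    have "irreducible_space (zariski scale (C i))"
    proof (rule irreducible_open_affine[OF vector_space_axioms infinite_field, where A = "{w. w - p \<in> L i}"])
      fix a b t assume ab: "a \<in> {w. w - p \<in> L i}" "b \<in> {w. w - p \<in> L i}"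
      have "a + scale t (b - a) - p = (a - p) + scale t ((b - p) - (a - p))" by simp
      also have "\<dots> \<in> L i"
        by (rule subspace_add[OF L(1) _ subspace_scale[OF L(1) subspace_diff[OF L(1)]]]) (use ab in auto)
      finally show "a + scale t (b - a) \<in> {w. w - p \<in> L i}" by simp
    next
      have sub: "{w. w - p \<in> L i} \<subseteq> ?A"
      proof safe
        fix w assume "w - p \<in> L i"
        moreover have "p - w0 \<in> span B" using p UA by auto
        ultimately have "(w - p) + (p - w0) \<in> span B" using L(2)[of i] by (intro span_add) auto
        then show "w - w0 \<in> span B" by simp
      qed
      have "C i = U \<inter> {w. w - p \<in> L i}" unfolding C_def by blast
      then show "openin (zariski scale {w. w - p \<in> L i}) (C i)"
        using openin_subtopology_Int[OF U(1), of "{w. w - p \<in> L i}"] sub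
        by (simp add: subtopology_zariski Int_absorb1)
      show "C i \<noteq> {}" using p L(1)[of i] unfolding C_def by (auto simp: subspace_0)
    qed
    then show "irreducible_space (subtopology (zariski scale U) (C i))"
      unfolding C_def by (simp add: subtopology_zariski Int_absorb1)
  next
    fix i assume "i < card B"
    then have i: "i < length bs" using bs distinct_card by fastforce
    define b where "b = bs ! i"
    have tk: "set (take (Suc i) bs) = insert b (set (take i bs))"
      using i by (simp add: take_Suc_conv_app_nth b_def)
    have bL: "b \<in> L (Suc i)" unfolding L_def tk by (simp add: span_base)
    have nb: "b \<notin> L i"
    proof
      assume "b \<in> L i"
      moreover have "b \<notin> set (take i bs)"
      proof
        assume "b \<in> set (take i bs)"
        then obtain j where "j < i" "bs ! j = b" using i by (auto simp: in_set_conv_nth)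
        then show False using bs(1) i unfolding b_def by (simp add: nth_eq_iff_index_eq)
      qed
      then have "set (take i bs) \<subseteq> B - {b}" using bs(2) set_take_subset[of i bs] by blast
      ultimately have "b \<in> span (B - {b})" unfolding L_def using span_mono by blast
      moreover have "b \<in> B" unfolding b_def bs(2)[symmetric] using i by simp
      ultimately show False using B(2) unfolding dependent_def by blast
    qed
    \<comment> \<open>Strictness needs a point of \<open>U\<close> on the larger subspace only.
      Moving from \<open>p\<close> in direction \<open>b\<close>, all but finitely many parameters
      stay in \<open>U\<close>, so a nonzero one exists.\<close>
    obtain q where q: "q \<in> poly_funs scale" "q p \<noteq> 0" "\<And>u. u \<in> ?A \<Longrightarrow> q u \<noteq> 0 \<Longrightarrow> u \<in> U"
      using openin_zariskiD[OF U(1) p] by blast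
    obtain r where r: "\<And>t. q (p + scale t b) = poly r t" using poly_funs_on_line[OF q(1)] by blast
    have "r \<noteq> 0" using r[of 0] q(2) by auto
    then obtain t where t: "t \<noteq> 0" "poly r t \<noteq> 0"
      using poly_nonzero_outside_finite[OF infinite_field, of r "{0}"] by auto
    let ?w = "p + scale t b"
    have "?w - w0 = (p - w0) + scale t b" by simp
    also have "\<dots> \<in> span B" using p UA bL L(2)[of "Suc i"] by (intro span_add span_scale) auto
    finally have "?w \<in> U" using q(3) r t(2) by simp
    moreover have "scale t b \<in> L (Suc i)" using bL L(1) by (simp add: subspace_scale)
    moreover have "scale t b \<notin> L i"
    proof
      assume "scale t b \<in> L i"
      then have "scale (inverse t) (scale t b) \<in> L i" by (rule subspace_scale[OF L(1)])
      then show False using nb t(1) by simp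
    qed
    ultimately have "?w \<in> C (Suc i)" "?w \<notin> C i" unfolding C_def by auto
    then show "C i \<subset> C (Suc i)" using Lmono[of i] unfolding C_def by blast
  qed
  then show ?thesis by (rule le_krull_dim)
qed

lemma krull_dim_open_affine:
  assumes "finite B" "independent B"
    and "openin (zariski scale {w. w - w0 \<in> span B}) U" "U \<noteq> {}"
  shows "krull_dim (zariski scale U) = ereal (real (card B))"
proof (rule antisym)
  show "krull_dim (zariski scale U) \<le> ereal (real (card B))"
    using openin_subset[OF assms(3)] by (intro krull_dim_affine_le[OF assms(1,2)]) auto
qed (rule krull_dim_affine_ge[OF assms])

end

section \<open>Regular functions\<close>

text \<open>The neighbourhood filter lets finitely many open conditions be combined without naming
  the open sets. The filter is trivial at points outside \<open>A\<close>, hence the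
  hypothesis.\<close>

lemma eventually_nhdsin_zariski:
  assumes "w0 \<in> A"
  shows "eventually P (nhdsin (zariski s A) w0) \<longleftrightarrow>
    (\<exists>q\<in>poly_funs s. q w0 \<noteq> 0 \<and> (\<forall>w\<in>A. q w \<noteq> 0 \<longrightarrow> P w))" (is "?L \<longleftrightarrow> ?R")
proof
  assume ?L
  then obtain U where U: "openin (zariski s A) U" "w0 \<in> U" "\<forall>w\<in>U. P w"
    using assms unfolding eventually_nhdsin by auto
  obtain q where "q \<in> poly_funs s" "q w0 \<noteq> 0" "\<And>u. u \<in> A \<Longrightarrow> q u \<noteq> 0 \<Longrightarrow> u \<in> U"
    using openin_zariskiD[OF U(1,2)] by blast
  then show ?R using U(3) by blast
next
  assume ?R
  then obtain q where q: "q \<in> poly_funs s" "q w0 \<noteq> 0" "\<forall>w\<in>A. q w \<noteq> 0 \<longrightarrow> P w" by blast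
  show ?L unfolding eventually_nhdsin
    using openin_zariski_nonzero[OF q(1), of A] q assms
    by (intro disjI2 exI[of _ "{u \<in> A. q u \<noteq> 0}"]) auto
qed

text \<open>Membership in the local ring at \<open>w0\<close>: \<open>h\<close> is a function on the
  whole type, but only its values on \<open>A\<close> near \<open>w0\<close> count.\<close>

definition regular_at ::
    "('a::field \<Rightarrow> 'w::ab_group_add \<Rightarrow> 'w) \<Rightarrow> 'w set \<Rightarrow> 'w \<Rightarrow> ('w \<Rightarrow> 'a) \<Rightarrow> bool" where
  "regular_at s A w0 h \<longleftrightarrow> w0 \<in> A \<and>
     (\<exists>p\<in>poly_funs s. \<exists>q\<in>poly_funs s. q w0 \<noteq> 0 \<and> (\<forall>w\<in>A. q w \<noteq> 0 \<longrightarrow> h w = p w / q w))"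

lemma regular_atI:
  "w0 \<in> A \<Longrightarrow> p \<in> poly_funs s \<Longrightarrow> q \<in> poly_funs s \<Longrightarrow> q w0 \<noteq> 0 \<Longrightarrow>
    (\<And>w. w \<in> A \<Longrightarrow> q w \<noteq> 0 \<Longrightarrow> h w = p w / q w) \<Longrightarrow> regular_at s A w0 h"
  unfolding regular_at_def by blast

lemma regular_at_mem: "regular_at s A w0 h \<Longrightarrow> w0 \<in> A"
  unfolding regular_at_def by blast

lemma regular_at_poly: "w0 \<in> A \<Longrightarrow> f \<in> poly_funs s \<Longrightarrow> regular_at s A w0 f"
  by (rule regular_atI[where q = "\<lambda>_. 1"]) (auto intro: poly_funs.const)

lemma regular_at_const: "w0 \<in> A \<Longrightarrow> regular_at s A w0 (\<lambda>_. c)"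
  by (intro regular_at_poly poly_funs.const)

lemma regular_at_subset:
  assumes "regular_at s A w0 h" "A' \<subseteq> A" "w0 \<in> A'"
  shows "regular_at s A' w0 h"
  using assms unfolding regular_at_def by blast

lemma regular_at_cong_ev:
  assumes "regular_at s A w0 h" "eventually (\<lambda>w. h' w = h w) (nhdsin (zariski s A) w0)"
  shows "regular_at s A w0 h'"
proof -
  obtain p q where pq: "w0 \<in> A" "p \<in> poly_funs s" "q \<in> poly_funs s" "q w0 \<noteq> 0"
    "\<forall>w\<in>A. q w \<noteq> 0 \<longrightarrow> h w = p w / q w"
    using assms(1) unfolding regular_at_def by blast
  obtain r where r: "r \<in> poly_funs s" "r w0 \<noteq> 0" "\<forall>w\<in>A. r w \<noteq> 0 \<longrightarrow> h' w = h w"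
    using assms(2) unfolding eventually_nhdsin_zariski[OF pq(1)] by blast
  show ?thesis
    by (rule regular_atI[where p = "\<lambda>w. p w * r w" and q = "\<lambda>w. q w * r w"])
       (use pq r in \<open>auto intro: poly_funs.mult\<close>)
qed

lemma regular_at_add:
  assumes "regular_at s A w0 f" "regular_at s A w0 g"
  shows "regular_at s A w0 (\<lambda>w. f w + g w)"
proof -
  obtain p q where pq: "w0 \<in> A" "p \<in> poly_funs s" "q \<in> poly_funs s" "q w0 \<noteq> 0"
    "\<forall>w\<in>A. q w \<noteq> 0 \<longrightarrow> f w = p w / q w"
    using assms(1) unfolding regular_at_def by blast
  obtain p' q' where pq': "w0 \<in> A" "p' \<in> poly_funs s" "q' \<in> poly_funs s" "q' w0 \<noteq> 0"
    "\<forall>w\<in>A. q' w \<noteq> 0 \<longrightarrow> g w = p' w / q' w"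
    using assms(2) unfolding regular_at_def by blast
  show ?thesis
    by (rule regular_atI[where p = "\<lambda>w. p w * q' w + p' w * q w" and q = "\<lambda>w. q w * q' w"])
       (use pq pq' in \<open>auto intro: poly_funs.mult poly_funs.add simp: field_simps\<close>)
qed

lemma regular_at_mult:
  assumes "regular_at s A w0 f" "regular_at s A w0 g"
  shows "regular_at s A w0 (\<lambda>w. f w * g w)"
proof -
  obtain p q where pq: "w0 \<in> A" "p \<in> poly_funs s" "q \<in> poly_funs s" "q w0 \<noteq> 0"
    "\<forall>w\<in>A. q w \<noteq> 0 \<longrightarrow> f w = p w / q w"
    using assms(1) unfolding regular_at_def by blast
  obtain p' q' where pq': "w0 \<in> A" "p' \<in> poly_funs s" "q' \<in> poly_funs s" "q' w0 \<noteq> 0"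
    "\<forall>w\<in>A. q' w \<noteq> 0 \<longrightarrow> g w = p' w / q' w"
    using assms(2) unfolding regular_at_def by blast
  show ?thesis
    by (rule regular_atI[where p = "\<lambda>w. p w * p' w" and q = "\<lambda>w. q w * q' w"])
       (use pq pq' in \<open>auto intro: poly_funs.mult\<close>)
qed

lemma regular_at_diff:
  assumes "regular_at s A w0 f" "regular_at s A w0 g"
  shows "regular_at s A w0 (\<lambda>w. f w - g w)"
  using regular_at_add[OF assms(1) regular_at_mult[OF regular_at_const[of w0 A s "-1"] assms(2)]]
    regular_at_mem[OF assms(1)] by simp

lemma regular_at_divide:
  assumes "regular_at s A w0 f" "regular_at s A w0 g" "g w0 \<noteq> 0"
  shows "regular_at s A w0 (\<lambda>w. f w / g w)"
proof -
  obtain p q where pq: "w0 \<in> A" "p \<in> poly_funs s" "q \<in> poly_funs s" "q w0 \<noteq> 0"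
    "\<forall>w\<in>A. q w \<noteq> 0 \<longrightarrow> f w = p w / q w"
    using assms(1) unfolding regular_at_def by blast
  obtain p' q' where pq': "w0 \<in> A" "p' \<in> poly_funs s" "q' \<in> poly_funs s" "q' w0 \<noteq> 0"
    "\<forall>w\<in>A. q' w \<noteq> 0 \<longrightarrow> g w = p' w / q' w"
    using assms(2) unfolding regular_at_def by blast
  have "p' w0 \<noteq> 0" using pq'(4,5) pq(1) assms(3) by auto
  \<comment> \<open>The factor \<open>q'\<close> occurs in numerator and denominator, where it
    cancels; it confines the region of validity to points at which \<open>g\<close> is known to
    equal \<open>p' / q'\<close>.\<close>
  then show ?thesis
    by (intro regular_atI[where p = "\<lambda>w. p w * q' w * q' w" and q = "\<lambda>w. q w * p' w * q' w"])
       (use pq pq' in \<open>auto intro!: poly_funs.mult\<close>)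
qed

lemma regular_at_sum:
  assumes "w0 \<in> A" "\<And>i. i \<in> I \<Longrightarrow> regular_at s A w0 (f i)"
  shows "regular_at s A w0 (\<lambda>w. \<Sum>i\<in>I. f i w)"
  using assms(2)
  by (induction I rule: infinite_finite_induct)
     (auto intro: regular_at_const[OF assms(1)] regular_at_add)

lemma regular_at_eventually_nonzero:
  assumes "regular_at s A w0 h" "h w0 \<noteq> 0"
  shows "eventually (\<lambda>w. h w \<noteq> 0) (nhdsin (zariski s A) w0)"
proof -
  obtain p q where pq: "w0 \<in> A" "p \<in> poly_funs s" "q \<in> poly_funs s" "q w0 \<noteq> 0"
    "\<forall>w\<in>A. q w \<noteq> 0 \<longrightarrow> h w = p w / q w"
    using assms(1) unfolding regular_at_def by blast
  have "p w0 \<noteq> 0" using pq assms(2) by auto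
  then show ?thesis
    unfolding eventually_nhdsin_zariski[OF pq(1)]
    by (intro bexI[of _ "\<lambda>w. p w * q w"]) (use pq in \<open>auto intro: poly_funs.mult\<close>)
qed

text \<open>The same fraction serves at all nearby points. This allows a chart found from regularity
  at one point to be shrunk to an open set on which it is regular.\<close>

lemma regular_at_eventually:
  assumes "regular_at s A w0 h"
  shows "eventually (\<lambda>w. regular_at s A w h) (nhdsin (zariski s A) w0)"
proof -
  obtain p q where pq: "w0 \<in> A" "p \<in> poly_funs s" "q \<in> poly_funs s" "q w0 \<noteq> 0"
    "\<forall>w\<in>A. q w \<noteq> 0 \<longrightarrow> h w = p w / q w"
    using assms(1) unfolding regular_at_def by blast
  show ?thesis
    unfolding eventually_nhdsin_zariski[OF pq(1)]
    by (intro bexI[of _ q] conjI ballI impI regular_atI[of _ A p s q]) (use pq in auto)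
qed

text \<open>Testing against all linear forms avoids choosing coordinates of the target, which here
  is often the space of all functions from \<open>V\<close> to \<open>V\<close>.\<close>

definition vregular_at ::
    "('a::field \<Rightarrow> 'w::ab_group_add \<Rightarrow> 'w) \<Rightarrow> ('a \<Rightarrow> 'f::ab_group_add \<Rightarrow> 'f) \<Rightarrow> 'w set \<Rightarrow> 'w \<Rightarrow> ('w \<Rightarrow> 'f) \<Rightarrow> bool"
  where "vregular_at s t A w0 u \<longleftrightarrow>
    w0 \<in> A \<and> (\<forall>l. Vector_Spaces.linear t (*) l \<longrightarrow> regular_at s A w0 (\<lambda>w. l (u w)))"

lemma vregular_atI:
  "w0 \<in> A \<Longrightarrow> (\<And>l. Vector_Spaces.linear t (*) l \<Longrightarrow> regular_at s A w0 (\<lambda>w. l (u w))) \<Longrightarrow>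
    vregular_at s t A w0 u"
  unfolding vregular_at_def by blast

lemma vregular_atD:
  "vregular_at s t A w0 u \<Longrightarrow> Vector_Spaces.linear t (*) l \<Longrightarrow> regular_at s A w0 (\<lambda>w. l (u w))"
  unfolding vregular_at_def by blast

lemma vregular_at_mem: "vregular_at s t A w0 u \<Longrightarrow> w0 \<in> A"
  unfolding vregular_at_def by blast

section \<open>Calculus of vector-valued regular maps\<close>

lemma linear_addD: "Vector_Spaces.linear s t l \<Longrightarrow> l (x + y) = l x + l y"
  and linear_diffD: "Vector_Spaces.linear s t l \<Longrightarrow> l (x - y) = l x - l y"
  and linear_scaleD: "Vector_Spaces.linear s t l \<Longrightarrow> l (s c x) = t c (l x)"
  and linear_zeroD: "Vector_Spaces.linear s t l \<Longrightarrow> l 0 = 0"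
  and linear_sumD: "Vector_Spaces.linear s t l \<Longrightarrow> l (sum f I) = (\<Sum>i\<in>I. l (f i))"
  unfolding module_hom_iff_linear[symmetric]
  by (rule module_hom.add module_hom.diff module_hom.scale module_hom.zero module_hom.sum; assumption)+

lemma vregular_at_const: "w0 \<in> A \<Longrightarrow> vregular_at s t A w0 (\<lambda>_. c)"
  by (intro vregular_atI regular_at_const)

lemma vregular_at_add:
  "vregular_at s t A w0 u \<Longrightarrow> vregular_at s t A w0 v \<Longrightarrow> vregular_at s t A w0 (\<lambda>w. u w + v w)"
  by (intro vregular_atI)
     (auto simp: linear_addD intro: regular_at_add vregular_atD vregular_at_mem)

lemma vregular_at_diff:
  "vregular_at s t A w0 u \<Longrightarrow> vregular_at s t A w0 v \<Longrightarrow> vregular_at s t A w0 (\<lambda>w. u w - v w)"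
  by (intro vregular_atI)
     (auto simp: linear_diffD intro: regular_at_diff vregular_atD vregular_at_mem)

lemma vregular_at_scale:
  "regular_at s A w0 h \<Longrightarrow> vregular_at s t A w0 u \<Longrightarrow> vregular_at s t A w0 (\<lambda>w. t (h w) (u w))"
  by (intro vregular_atI)
     (auto simp: linear_scaleD intro: regular_at_mult vregular_atD vregular_at_mem)

lemma vregular_at_sum:
  "w0 \<in> A \<Longrightarrow> (\<And>i. i \<in> I \<Longrightarrow> vregular_at s t A w0 (u i)) \<Longrightarrow>
    vregular_at s t A w0 (\<lambda>w. \<Sum>i\<in>I. u i w)"
  by (rule vregular_atI, assumption, simp only: linear_sumD)
     (rule regular_at_sum, assumption, rule vregular_atD)

lemma linear_compose:
  assumes "Vector_Spaces.linear s t f" "Vector_Spaces.linear t r g"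
  shows "Vector_Spaces.linear s r (\<lambda>w. g (f w))"
  using Vector_Spaces.linear_compose[OF assms] by (simp add: comp_def)

lemma vregular_at_linear:
  "w0 \<in> A \<Longrightarrow> Vector_Spaces.linear s t f \<Longrightarrow> vregular_at s t A w0 f"
  by (rule vregular_atI, assumption, rule regular_at_poly, assumption, rule poly_funs.lin, rule linear_compose)

lemma vregular_at_compose_linear:
  "vregular_at s t A w0 u \<Longrightarrow> Vector_Spaces.linear t r f \<Longrightarrow> vregular_at s r A w0 (\<lambda>w. f (u w))"
  unfolding vregular_at_def using linear_compose by blast

lemma regular_at_compose_poly:
  assumes "f \<in> poly_funs t" "vregular_at s t A w0 u"
  shows "regular_at s A w0 (\<lambda>w. f (u w))"
  using assms(1)
  by (induction rule: poly_funs.induct)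
     (use assms(2) in \<open>auto intro: regular_at_const regular_at_add regular_at_mult vregular_atD vregular_at_mem\<close>)

lemma vregular_at_cong_ev:
  assumes "vregular_at s t A w0 u" "eventually (\<lambda>w. u' w = u w) (nhdsin (zariski s A) w0)"
  shows "vregular_at s t A w0 u'"
proof (rule vregular_atI)
  fix l assume "Vector_Spaces.linear t (*) l"
  then have "regular_at s A w0 (\<lambda>w. l (u w))" by (rule vregular_atD[OF assms(1)])
  then show "regular_at s A w0 (\<lambda>w. l (u' w))"
    by (rule regular_at_cong_ev) (use assms(2) in \<open>auto elim: eventually_mono\<close>)
qed (rule vregular_at_mem[OF assms(1)])

lemma vregular_at_subset:
  "vregular_at s t A w0 u \<Longrightarrow> A' \<subseteq> A \<Longrightarrow> w0 \<in> A' \<Longrightarrow> vregular_at s t A' w0 u"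
  unfolding vregular_at_def using regular_at_subset by blast

lemma openin_zariski_eventually:
  assumes "U \<subseteq> A" "\<And>w. w \<in> U \<Longrightarrow> eventually (\<lambda>u. u \<in> U) (nhdsin (zariski s A) w)"
  shows "openin (zariski s A) U"
proof (rule openin_zariskiI[OF assms(1)])
  fix w assume "w \<in> U"
  then have "w \<in> A" using assms(1) by blast
  from assms(2)[OF \<open>w \<in> U\<close>] show "\<exists>q\<in>poly_funs s. q w \<noteq> 0 \<and> (\<forall>u\<in>A. q u \<noteq> 0 \<longrightarrow> u \<in> U)"
    unfolding eventually_nhdsin_zariski[OF \<open>w \<in> A\<close>] .
qed

text \<open>The preimage of a principal open set is the nonvanishing locus of a regular function,
  which is open.\<close>

lemma continuous_map_zariski:
  assumes "\<And>w. w \<in> A \<Longrightarrow> vregular_at s t A w \<phi>" "\<phi> ` A \<subseteq> B"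
  shows "continuous_map (zariski s A) (zariski t B) \<phi>"
  unfolding continuous_map_def
proof (intro conjI allI impI)
  show "\<phi> \<in> topspace (zariski s A) \<rightarrow> topspace (zariski t B)" using assms(2) by auto
  fix U assume U: "openin (zariski t B) U"
  show "openin (zariski s A) {w \<in> topspace (zariski s A). \<phi> w \<in> U}"
  proof (rule openin_zariski_eventually)
    fix w assume w: "w \<in> {w \<in> topspace (zariski s A). \<phi> w \<in> U}"
    then have wA: "w \<in> A" by simp
    obtain q where q: "q \<in> poly_funs t" "q (\<phi> w) \<noteq> 0" "\<And>u. u \<in> B \<Longrightarrow> q u \<noteq> 0 \<Longrightarrow> u \<in> U"
      using openin_zariskiD[OF U] w by blast
    have "eventually (\<lambda>w. q (\<phi> w) \<noteq> 0) (nhdsin (zariski s A) w)"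
      by (rule regular_at_eventually_nonzero[OF regular_at_compose_poly[OF q(1) assms(1)[OF wA]] q(2)])
    then obtain r where r: "r \<in> poly_funs s" "r w \<noteq> 0" "\<forall>u\<in>A. r u \<noteq> 0 \<longrightarrow> q (\<phi> u) \<noteq> 0"
      unfolding eventually_nhdsin_zariski[OF wA] by blast
    show "eventually (\<lambda>u. u \<in> {w \<in> topspace (zariski s A). \<phi> w \<in> U}) (nhdsin (zariski s A) w)"
      unfolding eventually_nhdsin_zariski[OF wA] using r q(3) assms(2) by (intro bexI[of _ r]) auto
  qed auto
qed

text \<open>
  Cramer's rule in coordinate-free form: an injective linear system whose coefficients are
  regular has a regular left inverse near the given point.
\<close>

lemma regular_left_inverse:
  fixes s :: "'a::field \<Rightarrow> 'w::ab_group_add \<Rightarrow> 'w" and t :: "'a \<Rightarrow> 'f::ab_group_add \<Rightarrow> 'f"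
  assumes t: "vector_space t" and w0: "w0 \<in> A" and fin: "finite I"
    and a: "\<And>i. i \<in> I \<Longrightarrow> vregular_at s t A w0 (a i)"
    and ind: "\<And>c. (\<Sum>i\<in>I. t (c i) (a i w0)) = 0 \<Longrightarrow> \<forall>i\<in>I. c i = 0"
  shows "\<exists>R. (\<forall>i\<in>I. \<forall>w. Vector_Spaces.linear t (*) (R i w)) \<and>
    (\<forall>i\<in>I. \<forall>u. vregular_at s t A w0 u \<longrightarrow> regular_at s A w0 (\<lambda>w. R i w (u w))) \<and>
    eventually (\<lambda>w. \<forall>i\<in>I. \<forall>j\<in>I. R i w (a j w) = (if i = j then 1 else 0)) (nhdsin (zariski s A) w0)"
  using fin a ind
proof (induction I)
  case empty
  then show ?case by simp
next
  case (insert k I)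
  interpret t: vector_space t by fact
  interpret P: vector_space_pair t "(*) :: 'a \<Rightarrow> _"
    by unfold_locales (simp_all add: algebra_simps)
  have ind: "\<forall>i\<in>I. c i = 0" if "(\<Sum>i\<in>I. t (c i) (a i w0)) = 0" for c
  proof -
    have "(\<Sum>i\<in>insert k I. t ((c(k := 0)) i) (a i w0)) = (\<Sum>i\<in>I. t (c i) (a i w0))"
      using insert.hyps by (simp, intro sum.cong) auto
    then have "\<forall>i\<in>insert k I. (c(k := 0)) i = 0" using that insert.prems(2) by metis
    then have "(c(k := 0)) i = 0" if "i \<in> I" for i using that by blast
    then show ?thesis using insert.hyps by (metis fun_upd_other)
  qed
  let ?P = "\<lambda>R. (\<forall>i\<in>I. \<forall>w. Vector_Spaces.linear t (*) (R i w)) \<and>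
    (\<forall>i\<in>I. \<forall>u. vregular_at s t A w0 u \<longrightarrow> regular_at s A w0 (\<lambda>w. R i w (u w))) \<and>
    eventually (\<lambda>w. \<forall>i\<in>I. \<forall>j\<in>I. R i w (a j w) = (if i = j then 1 else 0)) (nhdsin (zariski s A) w0)"
  have "\<exists>R. ?P R" by (rule insert.IH[OF insert.prems(1)[OF insertI2] ind])
  then obtain R where PR: "?P R" by (elim exE)
  have R: "\<And>i w. i \<in> I \<Longrightarrow> Vector_Spaces.linear t (*) (R i w)"
    "\<And>i u. i \<in> I \<Longrightarrow> vregular_at s t A w0 u \<Longrightarrow> regular_at s A w0 (\<lambda>w. R i w (u w))"
    "eventually (\<lambda>w. \<forall>i\<in>I. \<forall>j\<in>I. R i w (a j w) = (if i = j then 1 else 0)) (nhdsin (zariski s A) w0)"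
    using PR by simp_all
  \<comment> \<open>The part of \<open>u\<close> left after removing its components along the
    vectors already treated, as in Gaussian elimination; it kills \<open>a j w\<close> for
    \<open>j\<close> in \<open>I\<close> near \<open>w0\<close>.\<close>
  define rest where "rest w u = u - (\<Sum>i\<in>I. t (R i w u) (a i w))" for w u
  have rest_reg: "vregular_at s t A w0 (\<lambda>w. rest w (u w))" if "vregular_at s t A w0 u" for u
    unfolding rest_def using that insert.prems(1)
    by (intro vregular_at_diff vregular_at_sum[OF w0] vregular_at_scale R(2)) auto
  have rest_lin: "Vector_Spaces.linear t t (rest w)" for w
    unfolding Vector_Spaces.linear_iff
  proof (intro conjI allI t.vector_space_axioms)
    fix x y
    have "(\<Sum>i\<in>I. t (R i w (x + y)) (a i w)) = (\<Sum>i\<in>I. t (R i w x) (a i w) + t (R i w y) (a i w))"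
      by (intro sum.cong refl) (simp add: linear_addD[OF R(1)] t.scale_left_distrib)
    then show "rest w (x + y) = rest w x + rest w y" by (simp add: rest_def sum.distrib)
  next
    fix c x
    have "(\<Sum>i\<in>I. t (R i w (t c x)) (a i w)) = (\<Sum>i\<in>I. t c (t (R i w x) (a i w)))"
      by (intro sum.cong refl) (simp add: linear_scaleD[OF R(1)])
    then show "rest w (t c x) = t c (rest w x)"
      by (simp add: rest_def t.scale_sum_right t.scale_right_diff_distrib)
  qed
  have rest_zero: "eventually (\<lambda>w. \<forall>j\<in>I. rest w (a j w) = 0) (nhdsin (zariski s A) w0)"
    using R(3)
  proof (rule eventually_mono)
    fix w assume w: "\<forall>i\<in>I. \<forall>j\<in>I. R i w (a j w) = (if i = j then 1 else 0)"
    show "\<forall>j\<in>I. rest w (a j w) = 0"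
    proof
      fix j assume j: "j \<in> I"
      have "(\<Sum>i\<in>I. t (R i w (a j w)) (a i w)) = (\<Sum>i\<in>I. if i = j then a i w else 0)"
        using w j by (intro sum.cong) auto
      then show "rest w (a j w) = 0" using j insert.hyps by (simp add: rest_def)
    qed
  qed
  have "rest w0 (a k w0) \<noteq> 0"
  proof
    assume z: "rest w0 (a k w0) = 0"
    let ?c = "\<lambda>i. if i = k then 1 else - R i w0 (a k w0)"
    have "(\<Sum>i\<in>I. t (?c i) (a i w0)) = (\<Sum>i\<in>I. - t (R i w0 (a k w0)) (a i w0))"
      using insert.hyps by (intro sum.cong) auto
    then have "(\<Sum>i\<in>insert k I. t (?c i) (a i w0)) = 0"
      using z insert.hyps by (simp add: rest_def sum_negf)
    from insert.prems(2)[OF this] show False by simp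
  qed
  \<comment> \<open>The pivot: by independence at \<open>w0\<close> the new vector has a nonzero
    remainder there, and \<open>l\<close> keeps detecting it nearby.\<close>
  then obtain l where l: "Vector_Spaces.linear t (*) l" "l (rest w0 (a k w0)) \<noteq> 0"
    using P.linear_independent_extend[of "{rest w0 (a k w0)}" "\<lambda>_. 1"] by auto
  define T where "T w u = l (rest w u) / l (rest w (a k w))" for w u
  have T_reg: "regular_at s A w0 (\<lambda>w. T w (u w))" if "vregular_at s t A w0 u" for u
    unfolding T_def using l(2) insert.prems(1)
    by (intro regular_at_divide vregular_atD[OF rest_reg l(1)] that) auto
  \<comment> \<open>Linearity holds for every \<open>w\<close>, also where the pivot vanishes,
    because division by 0 yields 0.\<close>
  have T_lin: "Vector_Spaces.linear t (*) (T w)" for w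
    using linear_compose[OF rest_lin[of w] l(1)] unfolding T_def Vector_Spaces.linear_iff
    by (auto simp: add_divide_distrib)
  have T_k: "eventually (\<lambda>w. T w (a k w) = 1) (nhdsin (zariski s A) w0)"
  proof -
    have "regular_at s A w0 (\<lambda>w. l (rest w (a k w)))"
      by (rule vregular_atD[OF rest_reg[OF insert.prems(1)] l(1)]) simp
    from regular_at_eventually_nonzero[OF this l(2)] show ?thesis
      unfolding T_def by (auto elim: eventually_mono)
  qed
  have T_I: "eventually (\<lambda>w. \<forall>j\<in>I. T w (a j w) = 0) (nhdsin (zariski s A) w0)"
    using rest_zero unfolding T_def by (auto elim!: eventually_mono simp: linear_zeroD[OF l(1)])
  \<comment> \<open>The correction makes the old forms vanish on \<open>a k w\<close>; it leaves
    their values on the other vectors alone, since \<open>T w\<close> vanishes there.\<close>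
  define R' where "R' i w u = (if i = k then T w u else R i w u - R i w (a k w) * T w u)" for i w u
  show ?case
  proof (intro exI[of _ R'] conjI ballI allI impI)
    fix i w assume "i \<in> insert k I"
    then show "Vector_Spaces.linear t (*) (R' i w)"
      unfolding R'_def using T_lin[of w] R(1)[of i w]
      by (cases "i = k") (auto intro: P.linear_compose_sub P.linear_compose_scale_right)
  next
    fix i u assume "i \<in> insert k I" "vregular_at s t A w0 u"
    then show "regular_at s A w0 (\<lambda>w. R' i w (u w))"
      unfolding R'_def using insert.prems(1)
      by (cases "i = k") (auto intro!: T_reg regular_at_diff regular_at_mult R(2))
  next
    show "eventually (\<lambda>w. \<forall>i\<in>insert k I. \<forall>j\<in>insert k I. R' i w (a j w) = (if i = j then 1 else 0))
       (nhdsin (zariski s A) w0)"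
      using R(3) T_k T_I
      by eventually_elim (use insert.hyps in \<open>auto simp: R'_def\<close>)
  qed
qed

section \<open>Endomorphisms and stabilizers\<close>

locale fin_zariski = zariski_space scale + finite_dimensional_vector_space scale Basis
  for scale :: "'a::field \<Rightarrow> 'b::ab_group_add \<Rightarrow> 'b" and Basis :: "'b set"

text \<open>The space of all functions need not be finite-dimensional, so
  \<open>zariski_space\<close> makes no such assumption; finiteness enters through finite bases of
  \<open>End scale\<close> and of its subspaces.\<close>

sublocale fin_zariski \<subseteq> F: zariski_space "fun_scale scale :: 'a \<Rightarrow> ('b \<Rightarrow> 'b) \<Rightarrow> 'b \<Rightarrow> 'b"
  using vector_space_fun_scale[OF vector_space_axioms] infinite_field
  by (simp add: zariski_space_def zariski_space_axioms_def)

sublocale fin_zariski \<subseteq> P: zariski_space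
    "prod_scale scale (fun_scale scale) :: 'a \<Rightarrow> 'b \<times> ('b \<Rightarrow> 'b) \<Rightarrow> 'b \<times> ('b \<Rightarrow> 'b)"
  using vector_space_prod_scale[OF vector_space_axioms F.vector_space_axioms] infinite_field
  by (simp add: zariski_space_def zariski_space_axioms_def)

context fin_zariski
begin

abbreviation fs :: "'a \<Rightarrow> ('b \<Rightarrow> 'b) \<Rightarrow> 'b \<Rightarrow> 'b" where "fs \<equiv> fun_scale scale"
abbreviation ps :: "'a \<Rightarrow> 'b \<times> ('b \<Rightarrow> 'b) \<Rightarrow> 'b \<times> ('b \<Rightarrow> 'b)" where
  "ps \<equiv> prod_scale scale (fun_scale scale)"

section \<open>The endomorphism space as a finite-dimensional subspace\<close>

lemma fs_apply [simp]: "fs c f u = scale c (f u)"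
  by (simp add: fun_scale_def)

lemma ps_Pair [simp]: "ps c (u, y) = (scale c u, fs c y)"
  by (simp add: prod_scale_def)

lemma sum_fun_apply: "sum f I u = (\<Sum>i\<in>I. f i u)" for f :: "'i \<Rightarrow> 'b \<Rightarrow> 'b"
  by (induction I rule: infinite_finite_induct) auto

lemma End_iff: "f \<in> End scale \<longleftrightarrow> Vector_Spaces.linear scale scale f"
  by (simp add: End_def)

lemma End_add: "f \<in> End scale \<Longrightarrow> f (u + w) = f u + f w"
  and End_diff: "f \<in> End scale \<Longrightarrow> f (u - w) = f u - f w"
  and End_scale: "f \<in> End scale \<Longrightarrow> f (scale c u) = scale c (f u)"
  and End_zero: "f \<in> End scale \<Longrightarrow> f 0 = 0"
  and End_sum: "f \<in> End scale \<Longrightarrow> f (sum g I) = (\<Sum>i\<in>I. f (g i))"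
  unfolding End_iff
  by (rule linear_addD linear_diffD linear_scaleD linear_zeroD linear_sumD; assumption)+

lemma EndI:
  "(\<And>u w. f (u + w) = f u + f w) \<Longrightarrow> (\<And>c u. f (scale c u) = scale c (f u)) \<Longrightarrow> f \<in> End scale"
  unfolding End_iff Vector_Spaces.linear_iff using vector_space_axioms by simp

lemma id_End: "id \<in> End scale"
  by (rule EndI) auto

lemma comp_End: "f \<in> End scale \<Longrightarrow> g \<in> End scale \<Longrightarrow> f \<circ> g \<in> End scale"
  by (rule EndI) (simp_all add: End_add End_scale)

lemma subspace_End: "F.subspace (End scale)"
  by (rule F.subspaceI; rule EndI)
     (simp_all add: End_add End_scale scale_right_distrib mult.commute)

lemma add_End: "f \<in> End scale \<Longrightarrow> g \<in> End scale \<Longrightarrow> f + g \<in> End scale"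
  and diff_End: "f \<in> End scale \<Longrightarrow> g \<in> End scale \<Longrightarrow> f - g \<in> End scale"
  using F.subspace_add F.subspace_diff subspace_End by blast+

lemma End_eq_on_Basis:
  assumes "f \<in> End scale" "g \<in> End scale" "\<And>b. b \<in> Basis \<Longrightarrow> f b = g b"
  shows "f = g"
proof
  interpret vector_space_pair scale scale ..
  fix u
  show "f u = g u"
    by (rule linear_eq_on[of f g u Basis]) (use assms span_Basis in \<open>auto simp: End_iff\<close>)
qed

lemma End_basis:
  obtains E where "finite E" "F.independent E" "F.span E = End scale" "card E = dim UNIV ^ 2"
proof -
  interpret vector_space_pair scale scale ..
  \<comment> \<open>Matrix units: \<open>e (i, j)\<close> sends the basis vector \<open>i\<close> to
    \<open>j\<close> and kills the other basis vectors.\<close>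
  define e where "e = (\<lambda>(i, j). construct Basis (\<lambda>b. if b = i then j else 0))"
  have e_End: "e ij \<in> End scale" for ij
    unfolding e_def End_iff by (cases ij) (simp add: linear_construct independent_Basis)
  have e_Basis: "e (i, j) b = (if b = i then j else 0)" if "b \<in> Basis" for i j b
    unfolding e_def using that by (simp add: construct_basis independent_Basis)
  let ?I = "Basis \<times> Basis"
  have fin: "finite ?I" using finite_Basis by simp
  have ev: "(\<Sum>ij\<in>?I. fs (c ij) (e ij)) b = (\<Sum>j\<in>Basis. scale (c (b, j)) j)" if "b \<in> Basis" for c b
  proof -
    have "(\<Sum>ij\<in>?I. fs (c ij) (e ij)) b = (\<Sum>i\<in>Basis. \<Sum>j\<in>Basis. scale (c (i, j)) (if b = i then j else 0))"
      unfolding sum_fun_apply sum.cartesian_product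
      using that by (intro sum.cong) (auto simp: e_Basis)
    also have "\<dots> = (\<Sum>i\<in>Basis. if i = b then (\<Sum>j\<in>Basis. scale (c (b, j)) j) else 0)"
      by (intro sum.cong) auto
    also have "\<dots> = (\<Sum>j\<in>Basis. scale (c (b, j)) j)" using that finite_Basis by simp
    finally show ?thesis .
  qed
  have ind: "inj_on e ?I \<and> F.independent (e ` ?I)"
    unfolding F.independent_family_iff[OF fin]
  proof (intro allI impI ballI)
    fix c ij assume z: "(\<Sum>ij\<in>?I. fs (c ij) (e ij)) = 0" and ij: "ij \<in> ?I"
    obtain i j where [simp]: "ij = (i, j)" by (cases ij)
    have "(\<Sum>j\<in>Basis. scale (c (i, j)) j) = 0" using ev[of i c] z ij by simp
    then show "c ij = 0"
      using independentD[OF independent_Basis finite_Basis, of "\<lambda>j. c (i, j)" j] ij by simp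
  qed
  moreover have "F.span (e ` ?I) = End scale"
  proof
    show "F.span (e ` ?I) \<subseteq> End scale" by (rule F.span_minimal[OF _ subspace_End]) (use e_End in blast)
    show "End scale \<subseteq> F.span (e ` ?I)"
    proof
      fix f assume f: "f \<in> End scale"
      define c where "c = (\<lambda>(i, j). representation Basis (f i) j)"
      have in_span: "(\<Sum>ij\<in>?I. fs (c ij) (e ij)) \<in> F.span (e ` ?I)"
        by (intro F.span_sum F.span_scale F.span_base) auto
      have "f = (\<Sum>ij\<in>?I. fs (c ij) (e ij))"
      proof (rule End_eq_on_Basis[OF f])
        show "(\<Sum>ij\<in>?I. fs (c ij) (e ij)) \<in> End scale"
          by (rule F.subspace_sum[OF subspace_End]) (use e_End F.subspace_scale[OF subspace_End] in blast)
        fix b assume b: "b \<in> Basis"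
        have "(\<Sum>j\<in>Basis. scale (c (b, j)) j) = f b"
          unfolding c_def using span_Basis
          by simp (rule sum_representation_eq[OF independent_Basis], auto simp: finite_Basis)
        then show "f b = (\<Sum>ij\<in>?I. fs (c ij) (e ij)) b" using ev[OF b] by simp
      qed
      then show "f \<in> F.span (e ` ?I)" using in_span by simp
    qed
  qed
  moreover have "card (e ` ?I) = dim UNIV ^ 2"
    using ind by (simp add: card_image card_cartesian_product power2_eq_square)
  ultimately show thesis using that[of "e ` ?I"] fin by blast
qed

text \<open>A basis \<open>B\<close> of \<open>W\<close> is extended to a basis of
  \<open>End V\<close>; the added vectors \<open>L\<close> span the complement that will carry the
  chart, and their number is the codimension of \<open>W\<close>.\<close>

lemma End_complement:
  assumes W: "F.subspace W" "W \<subseteq> End scale"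
  obtains B L where "finite B" "finite L" "B \<inter> L = {}" "F.independent (B \<union> L)"
    "F.span B = W" "F.span (B \<union> L) = End scale" "card B = F.dim W"
    "card B + card L = dim UNIV ^ 2"
proof -
  obtain E where E: "finite E" "F.independent E" "F.span E = End scale" "card E = dim UNIV ^ 2"
    by (rule End_basis)
  obtain B where B: "B \<subseteq> W" "F.independent B" "W \<subseteq> F.span B"
    using F.maximal_independent_subset by blast
  obtain C where C: "B \<subseteq> C" "C \<subseteq> End scale" "F.independent C" "End scale \<subseteq> F.span C"
    using F.maximal_independent_subset_extend[of B "End scale"] B W by blast
  have finC: "finite C" using F.independent_span_bound[OF E(1) C(3)] C(2) E(3) by blast
  have spC: "F.span C = End scale" using C by (intro equalityI F.span_minimal subspace_End) auto
  have spE: "F.span (End scale) = End scale" using subspace_End by simp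
  have "F.dim (End scale) = card C" by (rule F.dim_eq_card) (simp_all only: spC spE C(3) simp_thms)
  moreover have "F.dim (End scale) = card E" by (rule F.dim_eq_card) (simp_all only: E(2,3) spE simp_thms)
  moreover have spB: "F.span B = W" using B W by (intro equalityI F.span_minimal) auto
  moreover have "F.dim W = card B"
    by (rule F.dim_eq_card) (use B(2) spB F.span_eq_iff[of W] W(1) in \<open>simp_all only: simp_thms\<close>)
  moreover have "card C = card B + card (C - B)"
    using finC C(1) by (simp add: card_Diff_subset card_mono finite_subset)
  ultimately show thesis
    using that[of B "C - B"] finC C E(4) spC finite_subset[OF C(1) finC] by (auto simp: Un_absorb1)
qed

section \<open>Invertible endomorphisms\<close>

lemma GL_iff: "g \<in> carrier (GL scale) \<longleftrightarrow> g \<in> End scale \<and> bij g"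
  by (simp add: GL_def)

lemma GL_inv: "g \<in> carrier (GL scale) \<Longrightarrow> inv_into UNIV g \<in> carrier (GL scale)"
  unfolding GL_iff End_iff using inj_linear_imp_inv_linear bij_imp_bij_inv bij_is_inj by blast

lemma GL_comp: "g \<in> carrier (GL scale) \<Longrightarrow> h \<in> carrier (GL scale) \<Longrightarrow> g \<circ> h \<in> carrier (GL scale)"
  unfolding GL_iff using comp_End bij_comp by blast

lemma id_GL: "id \<in> carrier (GL scale)"
  unfolding GL_iff using id_End by simp

lemma End_inj_GL:
  assumes "g \<in> End scale" "\<And>u. g u = 0 \<Longrightarrow> u = 0"
  shows "g \<in> carrier (GL scale)"
proof -
  have "inj g"
  proof (rule injI)
    fix u w assume "g u = g w"
    then have "g (u - w) = 0" using assms(1) by (simp add: End_diff)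
    then show "u = w" using assms(2) by fastforce
  qed
  then show ?thesis using linear_inj_imp_surj[of g] assms(1) unfolding GL_iff End_iff bij_def by blast
qed

lemma linear_eval: "Vector_Spaces.linear fs scale (\<lambda>f. f u)"
  unfolding Vector_Spaces.linear_iff using vector_space_axioms F.vector_space_axioms by simp

text \<open>Invertibility means independence of the images of the basis vectors. These images depend
  linearly on the map, and \<open>regular_left_inverse\<close> shows that they stay independent
  nearby; injectivity then suffices in finite dimension.\<close>

lemma openin_GL: "openin (zariski fs (End scale)) (carrier (GL scale))"
proof (rule openin_zariski_eventually)
  show "carrier (GL scale) \<subseteq> End scale" by (auto simp: GL_iff)
  fix g0 assume g0: "g0 \<in> carrier (GL scale)"
  then have g0E: "g0 \<in> End scale" by (simp add: GL_iff)
  obtain R where R: "\<forall>i\<in>Basis. \<forall>w. Vector_Spaces.linear scale (*) (R i w)"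
    "\<forall>\<^sub>F w in nhdsin (zariski fs (End scale)) g0. \<forall>i\<in>Basis. \<forall>j\<in>Basis. R i w (w j) = (if i = j then 1 else 0)"
  proof -
    have *: "\<forall>i\<in>Basis. c i = 0" if "(\<Sum>i\<in>Basis. scale (c i) (g0 i)) = 0" for c
    proof -
      have "g0 (\<Sum>i\<in>Basis. scale (c i) i) = g0 0"
        using that g0E by (simp add: End_sum End_scale End_zero)
      then have "(\<Sum>i\<in>Basis. scale (c i) i) = 0" using g0 by (simp add: GL_iff bij_def inj_eq)
      then show ?thesis using independentD[OF independent_Basis finite_Basis] by blast
    qed
    show thesis
      using regular_left_inverse[OF vector_space_axioms g0E finite_Basis, of fs "\<lambda>i g. g i"]
        vregular_at_linear[OF g0E linear_eval] * that by blast
  qed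
  from R(2) show "\<forall>\<^sub>F u in nhdsin (zariski fs (End scale)) g0. u \<in> carrier (GL scale)"
    unfolding eventually_nhdsin_zariski[OF g0E]
  proof (elim bexE conjE, intro bexI conjI ballI impI)
    fix q g
    assume q: "\<forall>w\<in>End scale. q w \<noteq> 0 \<longrightarrow> (\<forall>i\<in>Basis. \<forall>j\<in>Basis. R i w (w j) = (if i = j then 1 else 0))"
      and g: "g \<in> End scale" "q g \<noteq> 0"
    show "g \<in> carrier (GL scale)"
    proof (rule End_inj_GL[OF g(1)])
      fix u assume u: "g u = 0"
      have rep: "(\<Sum>b\<in>Basis. scale (representation Basis u b) b) = u"
        by (rule sum_representation_eq[OF independent_Basis]) (use span_Basis finite_Basis in auto)
      have "representation Basis u i = 0" if i: "i \<in> Basis" for i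
      proof -
        have lin: "Vector_Spaces.linear scale (*) (R i g)" using R(1) i by blast
        \<comment> \<open>The form \<open>R i g\<close> reads off the \<open>i\<close>-th coordinate
          of \<open>u\<close> from \<open>g u\<close>.\<close>
        have "0 = R i g (g u)" using u by (simp add: linear_zeroD[OF lin])
        also have "\<dots> = (\<Sum>b\<in>Basis. representation Basis u b * R i g (g b))"
          by (subst rep[symmetric])
             (simp add: End_sum[OF g(1)] End_scale[OF g(1)] linear_sumD[OF lin] linear_scaleD[OF lin])
        also have "\<dots> = (\<Sum>b\<in>Basis. if b = i then representation Basis u b else 0)"
          using q g i by (intro sum.cong) auto
        also have "\<dots> = representation Basis u i" using i finite_Basis by simp
        finally show ?thesis by simp
      qed
      then show "u = 0" using rep by simp
    qed
  qed
qed

lemma End_top_eq: "subtopology (End_top scale) X = zariski fs (End scale \<inter> X)"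
  unfolding End_top_def by (rule subtopology_zariski)

section \<open>Annihilators and stabilizers\<close>

lemma subspace_End_ann:
  assumes "x \<in> End scale"
  shows "F.subspace (End_ann scale v x)"
  unfolding End_ann_def End_cent_def
  by (rule F.subspaceI)
     (use F.subspace_0[OF subspace_End] F.subspace_add[OF subspace_End] F.subspace_scale[OF subspace_End] assms
      in \<open>auto simp: fun_eq_iff End_add End_scale End_zero\<close>)

lemma End_ann_subset: "End_ann scale v x \<subseteq> End scale"
  unfolding End_ann_def End_cent_def by blast

lemma End_cent_eq_ann: "End_cent scale x = End_ann scale 0 x"
  unfolding End_ann_def End_cent_def by (auto simp: End_zero)

lemma GL_cent_eq_stab: "GL_cent scale x = GL_stab scale 0 x"
  unfolding GL_stab_def GL_cent_def End_cent_def by (auto simp: End_zero)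

text \<open>The identity commutes with \<open>x\<close> and fixes \<open>v\<close>, so subtracting
  it turns the stabilizer conditions into linear ones.\<close>

lemma GL_stab_eq:
  assumes "x \<in> End scale"
  shows "GL_stab scale v x = {g \<in> carrier (GL scale). g - id \<in> End_ann scale v x}"
proof -
  have *: "x \<circ> g = g \<circ> x \<longleftrightarrow> x \<circ> (g - id) = (g - id) \<circ> x" for g :: "'b \<Rightarrow> 'b"
    using assms by (simp add: fun_eq_iff End_diff)
  have d: "g - id \<in> End scale" if "g \<in> carrier (GL scale)" for g
    using that diff_End id_End unfolding GL_iff by blast
  show ?thesis
  proof (rule Set.set_eqI)
    fix g
    show "g \<in> GL_stab scale v x \<longleftrightarrow> g \<in> {g \<in> carrier (GL scale). g - id \<in> End_ann scale v x}"
      unfolding GL_stab_def GL_cent_def End_ann_def End_cent_def mem_Collect_eq Int_iff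
      using d[of g] *[of g] by (auto simp: GL_iff)
  qed
qed

lemma subgroup_GL_stab:
  assumes "x \<in> End scale"
  shows "subgroup (GL_stab scale v x) (GL scale)"
proof -
  have one: "\<one>\<^bsub>GL scale\<^esub> = id" and mult: "g \<otimes>\<^bsub>GL scale\<^esub> h = g \<circ> h" for g h
    by (simp_all add: GL_def)
  have mem: "g \<in> GL_stab scale v x \<longleftrightarrow> g \<in> carrier (GL scale) \<and> x \<circ> g = g \<circ> x \<and> g v = v" for g
    unfolding GL_stab_def GL_cent_def End_cent_def by (auto simp: GL_iff)
  show ?thesis
  proof
    show "GL_stab scale v x \<subseteq> carrier (GL scale)" using mem by blast
    show "g \<otimes>\<^bsub>GL scale\<^esub> h \<in> GL_stab scale v x" if "g \<in> GL_stab scale v x" "h \<in> GL_stab scale v x" for g h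
      using that unfolding mem mult by (auto simp: GL_comp) (metis comp_assoc)
    show "\<one>\<^bsub>GL scale\<^esub> \<in> GL_stab scale v x" unfolding mem one using id_GL by simp
  next
    fix g assume g: "g \<in> GL_stab scale v x"
    then have g': "g \<in> carrier (GL scale)" "bij g" by (auto simp: mem GL_iff)
    have inv: "inv\<^bsub>GL scale\<^esub> g = inv_into UNIV g"
      unfolding m_inv_def one mult
    proof (rule the_equality)
      show "inv_into UNIV g \<in> carrier (GL scale) \<and> g \<circ> inv_into UNIV g = id \<and> inv_into UNIV g \<circ> g = id"
        using g' GL_inv by (simp add: bij_is_inj bij_is_surj surj_iff[symmetric])
      show "h = inv_into UNIV g" if "h \<in> carrier (GL scale) \<and> g \<circ> h = id \<and> h \<circ> g = id" for h
        using that by (metis inv_unique_comp)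
    qed
    have "x \<circ> inv_into UNIV g = inv_into UNIV g \<circ> x"
    proof
      fix u
      have "g ((x \<circ> inv_into UNIV g) u) = x (g (inv_into UNIV g u))" using g unfolding mem by (metis comp_apply)
      also have "\<dots> = x u" using g'(2) by (simp add: bij_is_surj surj_f_inv_f)
      also have "\<dots> = g ((inv_into UNIV g \<circ> x) u)" using g'(2) by (simp add: bij_is_surj surj_f_inv_f)
      finally show "(x \<circ> inv_into UNIV g) u = (inv_into UNIV g \<circ> x) u" using g'(2) by (simp add: bij_def inj_eq)
    qed
    moreover have "inv_into UNIV g v = v" using g g'(2) unfolding mem by (metis bij_is_inj inv_f_f)
    ultimately show "inv\<^bsub>GL scale\<^esub> g \<in> GL_stab scale v x" unfolding inv mem using GL_inv g' by blast
  qed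
qed

text \<open>A nonempty open subset of an affine space is irreducible, hence connected, and has the
  dimension of that space; the identity shows that the stabilizer is nonempty.\<close>

lemma GL_stab_connected_dim:
  assumes x: "x \<in> End scale"
  shows "connected_alg_subgroup scale (GL_stab scale v x)"
    and "krull_dim (subtopology (End_top scale) (GL_stab scale v x)) = ereal (real (F.dim (End_ann scale v x)))"
proof -
  obtain B L where B: "finite B" "F.independent (B \<union> L)" "F.span B = End_ann scale v x"
    "card B = F.dim (End_ann scale v x)"
    using End_complement[OF subspace_End_ann[OF x] End_ann_subset] by metis
  let ?A = "{g. g - id \<in> F.span B}"
  have A: "?A \<subseteq> End scale"
  proof safe
    fix g assume "g - id \<in> F.span B"
    then have "(g - id) + id \<in> End scale" using B(3) End_ann_subset id_End add_End by blast
    then show "g \<in> End scale" by simp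
  qed
  have stab: "GL_stab scale v x = carrier (GL scale) \<inter> ?A" using GL_stab_eq[OF x] B(3) by auto
  have "openin (subtopology (zariski fs (End scale)) ?A) (carrier (GL scale) \<inter> ?A)"
    by (rule openin_subtopology_Int[OF openin_GL])
  then have op: "openin (zariski fs ?A) (GL_stab scale v x)"
    unfolding subtopology_zariski stab using A by (simp add: Int_absorb1)
  have "id \<in> GL_stab scale v x" using id_GL F.span_zero by (simp add: stab)
  then have ne: "GL_stab scale v x \<noteq> {}" by blast
  have top: "subtopology (End_top scale) (GL_stab scale v x) = zariski fs (GL_stab scale v x)"
    unfolding End_top_eq using A stab by (simp add: Int_absorb1 inf.coboundedI2)
  have "irreducible_space (zariski fs (GL_stab scale v x))"
  proof (rule irreducible_open_affine[OF F.vector_space_axioms infinite_field _ op ne])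
    fix a b t assume "a \<in> ?A" "b \<in> ?A"
    then have "(a - id) + fs t ((b - id) - (a - id)) \<in> F.span B"
      by (intro F.span_add[OF _ F.span_scale[OF F.span_diff]]) (simp_all only: mem_Collect_eq)
    then show "a + fs t (b - a) \<in> ?A" by (simp add: algebra_simps)
  qed
  then have "connected_space (subtopology (End_top scale) (GL_stab scale v x))"
    unfolding top by (rule irreducible_imp_connected_space)
  moreover have "closedin (subtopology (End_top scale) (carrier (GL scale))) (GL_stab scale v x)"
  proof -
    have "End scale \<inter> carrier (GL scale) = carrier (GL scale)" by (auto simp: GL_iff)
    moreover have "GL_stab scale v x = {g \<in> carrier (GL scale). g - id \<in> F.span B}" using stab by blast
    ultimately show ?thesis unfolding End_top_eq using F.closedin_affine by simp
  qed
  ultimately show "connected_alg_subgroup scale (GL_stab scale v x)"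
    unfolding connected_alg_subgroup_def using subgroup_GL_stab[OF x] by blast
  show "krull_dim (subtopology (End_top scale) (GL_stab scale v x)) = ereal (real (F.dim (End_ann scale v x)))"
    unfolding top B(4)[symmetric]
    using F.independent_mono[OF B(2)] by (intro F.krull_dim_open_affine[OF B(1) _ op ne]) blast
qed

end

section \<open>Orbits\<close>

context fin_zariski
begin

lemma GL_inv_left: "g \<in> carrier (GL scale) \<Longrightarrow> inv_into UNIV g \<circ> g = id"
  unfolding GL_iff using bij_is_inj inv_o_cancel by blast

lemma GL_inv_right: "g \<in> carrier (GL scale) \<Longrightarrow> g \<circ> inv_into UNIV g = id"
  unfolding GL_iff using bij_is_surj surj_iff by blast

definition orbit :: "'b \<Rightarrow> ('b \<Rightarrow> 'b) \<Rightarrow> ('b \<times> ('b \<Rightarrow> 'b)) set" where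
  "orbit v x = {(g v, g \<circ> x \<circ> inv_into UNIV g) | g. g \<in> carrier (GL scale)}"

lemma orbitI:
  assumes "g \<in> carrier (GL scale)" "y \<circ> g = g \<circ> x"
  shows "(g v, y) \<in> orbit v x"
proof -
  have "y = y \<circ> (g \<circ> inv_into UNIV g)"
    by (simp add: GL_inv_right[OF assms(1)])
  also have "\<dots> = g \<circ> x \<circ> inv_into UNIV g" by (simp only: comp_assoc[symmetric] assms(2))
  finally show ?thesis using assms(1) unfolding orbit_def by blast
qed

lemma orbitE:
  assumes "(u, y) \<in> orbit v x" "x \<in> End scale"
  obtains g where "g \<in> carrier (GL scale)" "g v = u" "y \<circ> g = g \<circ> x" "y \<in> End scale"
proof -
  obtain g where g: "g \<in> carrier (GL scale)" "u = g v" "y = g \<circ> x \<circ> inv_into UNIV g"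
    using assms(1) unfolding orbit_def by blast
  have "inv_into UNIV g \<circ> g = id" by (rule GL_inv_left[OF g(1)])
  then have "y \<circ> g = g \<circ> x" unfolding g(3) by (simp add: comp_assoc)
  moreover have "y \<in> End scale" unfolding g(3) using g(1) GL_inv[OF g(1)] assms(2)
    by (intro comp_End) (auto simp: GL_iff)
  ultimately show thesis using that g by blast
qed

lemma linear_fsI:
  assumes "\<And>f g. T (f + g) = T f + T g" "\<And>c f. T (fs c f) = fs c (T f)"
  shows "Vector_Spaces.linear fs fs T"
  unfolding Vector_Spaces.linear_iff using assms F.vector_space_axioms by blast

lemma linear_fs_psI:
  assumes "\<And>f g. T (f + g) = T f + T g" "\<And>c f. T (fs c f) = ps c (T f)"
  shows "Vector_Spaces.linear fs ps T"
  unfolding Vector_Spaces.linear_iff using assms F.vector_space_axioms P.vector_space_axioms by blast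

lemma linear_psI:
  assumes "\<And>f g. T (f + g) = T f + T g" "\<And>c f. T (ps c f) = ps c (T f)"
  shows "Vector_Spaces.linear ps ps T"
  unfolding Vector_Spaces.linear_iff using assms P.vector_space_axioms by blast

text \<open>Rewriting \<open>(1 + l) v = u\<close>, \<open>y (1 + l) = (1 + l) x\<close> as an
  equation for \<open>l\<close> gives this linear map on the left and \<open>(u - v, x - y)\<close>
  on the right. At \<open>y = x\<close> its kernel in \<open>End V\<close> is the
  annihilator.\<close>

definition act_diff :: "'b \<Rightarrow> ('b \<Rightarrow> 'b) \<Rightarrow> ('b \<Rightarrow> 'b) \<Rightarrow> ('b \<Rightarrow> 'b) \<Rightarrow> 'b \<times> ('b \<Rightarrow> 'b)" where
  "act_diff v x y l = (l v, (y \<circ> l) - (l \<circ> x))"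

lemma linear_act_diff: "y \<in> End scale \<Longrightarrow> Vector_Spaces.linear fs ps (act_diff v x y)"
  by (rule linear_fs_psI) (auto simp: act_diff_def fun_eq_iff End_add End_scale scale_right_diff_distrib)

lemma act_diff_zero_iff:
  assumes "l \<in> End scale"
  shows "act_diff v x x l = 0 \<longleftrightarrow> l \<in> End_ann scale v x"
  using assms unfolding act_diff_def End_ann_def End_cent_def
  by (auto simp: zero_prod_def fun_eq_iff)

text \<open>The conjugate is the unique solution \<open>z\<close> of the linear system
  \<open>z (1 + l) = (1 + l) x\<close>, whose coefficients are regular in \<open>l\<close>. Solving
  that system replaces a formula for the inverse.\<close>

lemma vregular_comp_inv:
  assumes x: "x \<in> End scale" and L: "L \<subseteq> {l \<in> End scale. id + l \<in> carrier (GL scale)}" and l0: "l0 \<in> L"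
  shows "vregular_at fs fs L l0 (\<lambda>l. (id + l) \<circ> x \<circ> inv_into UNIV (id + l))"
proof -
  let ?Y = "\<lambda>l. (id + l) \<circ> x \<circ> inv_into UNIV (id + l)"
  obtain E where E: "finite E" "F.independent E" "F.span E = End scale" by (rule End_basis)
  have EE: "i \<in> End scale" if "i \<in> E" for i using that F.span_base E(3) by blast
  have rep: "f \<in> End scale \<longleftrightarrow> (\<exists>c. f = (\<Sum>i\<in>E. fs (c i) i))" for f
    using F.span_image_family[OF E(1), of "\<lambda>i. i"] E(3) by auto
  have comb: "(\<Sum>i\<in>E. fs (c i) (i \<circ> g)) = (\<Sum>i\<in>E. fs (c i) i) \<circ> g" for c g
    by (simp add: fun_eq_iff sum_fun_apply)
  \<comment> \<open>The unknowns are the coordinates of the conjugate in the basis \<open>E\<close>;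
    \<open>a i l\<close> is the column belonging to the unknown at \<open>i\<close>.\<close>
  define a where "a i l = i \<circ> (id + l)" for i l :: "'b \<Rightarrow> 'b"
  have a_reg: "vregular_at fs fs L l0 (a i)" if i: "i \<in> E" for i
  proof -
    have "vregular_at fs fs L l0 (\<lambda>l. i + (i \<circ> l))"
      by (intro vregular_at_add vregular_at_const vregular_at_linear linear_fsI l0)
         (use EE[OF i] in \<open>auto simp: fun_eq_iff End_add End_scale\<close>)
    also have "(\<lambda>l. i + (i \<circ> l)) = a i" unfolding a_def using EE[OF i] by (auto simp: fun_eq_iff End_add)
    finally show ?thesis .
  qed
  have b_reg: "vregular_at fs fs L l0 (\<lambda>l. (id + l) \<circ> x)"
  proof -
    have "vregular_at fs fs L l0 (\<lambda>l. x + (l \<circ> x))"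
      by (intro vregular_at_add vregular_at_const vregular_at_linear linear_fsI l0) (auto simp: fun_eq_iff)
    also have "(\<lambda>l. x + (l \<circ> x)) = (\<lambda>l. (id + l) \<circ> x)" by (auto simp: fun_eq_iff)
    finally show ?thesis .
  qed
  have ind: "\<forall>i\<in>E. c i = 0" if z: "(\<Sum>i\<in>E. fs (c i) (a i l0)) = 0" for c
  proof -
    have "id + l0 \<in> carrier (GL scale)" using l0 L by blast
    then have "bij (id + l0)" unfolding GL_iff by (rule conjunct2)
    then have "surj (id + l0)" by (rule bij_is_surj)
    have "(\<Sum>i\<in>E. fs (c i) i) u = 0" for u
    proof -
      obtain u' where "u = (id + l0) u'" using surjD[OF \<open>surj (id + l0)\<close>] by blast
      then show ?thesis using fun_cong[OF z[unfolded a_def comb], of u'] by simp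
    qed
    then have "(\<Sum>i\<in>E. fs (c i) i) = 0" by (simp add: fun_eq_iff)
    then show ?thesis using F.independentD[OF E(2,1)] by blast
  qed
  let ?P = "\<lambda>R. (\<forall>i\<in>E. \<forall>w. Vector_Spaces.linear fs (*) (R i w)) \<and>
    (\<forall>i\<in>E. \<forall>u. vregular_at fs fs L l0 u \<longrightarrow> regular_at fs L l0 (\<lambda>w. R i w (u w))) \<and>
    eventually (\<lambda>w. \<forall>i\<in>E. \<forall>j\<in>E. R i w (a j w) = (if i = j then 1 else 0)) (nhdsin (zariski fs L) l0)"
  have "\<exists>R. ?P R" by (rule regular_left_inverse[OF F.vector_space_axioms l0 E(1) a_reg ind])
  then obtain R where "?P R" by (elim exE)
  then have R: "\<And>i w. i \<in> E \<Longrightarrow> Vector_Spaces.linear fs (*) (R i w)"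
    "\<And>i. i \<in> E \<Longrightarrow> regular_at fs L l0 (\<lambda>l. R i l ((id + l) \<circ> x))"
    "eventually (\<lambda>w. \<forall>i\<in>E. \<forall>j\<in>E. R i w (a j w) = (if i = j then 1 else 0)) (nhdsin (zariski fs L) l0)"
    using b_reg by simp_all
  have "vregular_at fs fs L l0 (\<lambda>l. \<Sum>i\<in>E. fs (R i l ((id + l) \<circ> x)) i)"
    by (intro vregular_at_sum vregular_at_scale vregular_at_const R(2) l0)
  then show ?thesis
  proof (rule vregular_at_cong_ev)
    show "eventually (\<lambda>l. ?Y l = (\<Sum>i\<in>E. fs (R i l ((id + l) \<circ> x)) i)) (nhdsin (zariski fs L) l0)"
      using R(3) unfolding eventually_nhdsin_zariski[OF l0]
    proof (elim bexE conjE, intro bexI conjI ballI impI)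
      fix q l assume q: "\<forall>w\<in>L. q w \<noteq> 0 \<longrightarrow> (\<forall>i\<in>E. \<forall>j\<in>E. R i w (a j w) = (if i = j then 1 else 0))"
        and l: "l \<in> L" "q l \<noteq> 0"
      have g: "id + l \<in> carrier (GL scale)" using L l by blast
      have "?Y l \<in> End scale" using g GL_inv[OF g] x by (intro comp_End) (auto simp: GL_iff)
      then obtain c where c: "?Y l = (\<Sum>i\<in>E. fs (c i) i)" using rep by blast
      have "inv_into UNIV (id + l) \<circ> (id + l) = id" by (rule GL_inv_left[OF g])
      then have "(id + l) \<circ> x = ?Y l \<circ> (id + l)" by (simp only: comp_assoc comp_id)
      also have "\<dots> = (\<Sum>i\<in>E. fs (c i) (a i l))" unfolding c a_def comb ..
      finally have b: "(id + l) \<circ> x = (\<Sum>i\<in>E. fs (c i) (a i l))" .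
      have "R i l ((id + l) \<circ> x) = c i" if i: "i \<in> E" for i
      proof -
        have "R i l ((id + l) \<circ> x) = (\<Sum>j\<in>E. c j * R i l (a j l))"
          unfolding b by (simp add: linear_sumD[OF R(1)[OF i]] linear_scaleD[OF R(1)[OF i]])
        also have "\<dots> = (\<Sum>j\<in>E. if j = i then c j else 0)" using q l i by (intro sum.cong) auto
        finally show ?thesis using i E(1) by simp
      qed
      then show "?Y l = (\<Sum>i\<in>E. fs (R i l ((id + l) \<circ> x)) i)" unfolding c by simp
    qed
  qed
qed

lemma orbit_chart:
  assumes x: "x \<in> End scale"
  obtains O' U L where "openin (zariski ps (orbit v x)) O'" "(v, x) \<in> O'"
    "finite L" "F.independent L" "card L + F.dim (End_ann scale v x) = dim UNIV ^ 2"
    "openin (zariski fs (F.span L)) U" "U \<noteq> {}"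
    "zariski ps O' homeomorphic_space zariski fs U"
proof -
  obtain B L where BL: "finite B" "finite L" "B \<inter> L = {}" "F.independent (B \<union> L)"
    "F.span B = End_ann scale v x" "F.span (B \<union> L) = End scale" "card B = F.dim (End_ann scale v x)"
    "card B + card L = dim UNIV ^ 2"
    by (rule End_complement[OF subspace_End_ann[OF x] End_ann_subset])
  have indL: "F.independent L" using F.independent_mono[OF BL(4)] by blast
  have LE: "F.span L \<subseteq> End scale" using F.span_mono[of L "B \<union> L"] BL(6) by blast
  have iE: "i \<in> End scale" if "i \<in> L" for i using that F.span_base LE by blast
  have BE: "i \<in> End_ann scale v x" if "i \<in> B" for i using that F.span_base BL(5) by blast
  have spanL: "f \<in> F.span L \<longleftrightarrow> (\<exists>c. f = (\<Sum>i\<in>L. fs (c i) i))" for f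
    using F.span_image_family[OF BL(2), of "\<lambda>i. i"] by auto
  let ?O = "orbit v x"
  define A where "A = act_diff v x"
  \<comment> \<open>Columns \<open>a\<close> and right-hand side \<open>b\<close> of the system at
    \<open>w = (u, y)\<close>; both depend on \<open>w\<close> by an affine map.\<close>
  define a where "a i w = A (snd w) i" for i and w :: "'b \<times> ('b \<Rightarrow> 'b)"
  define b where "b w = (fst w - v, x - snd w)" for w :: "'b \<times> ('b \<Rightarrow> 'b)"
  have w0: "(v, x) \<in> ?O" using orbitI[OF id_GL, of x x v] by simp
  have yE: "snd w \<in> End scale" if "w \<in> ?O" for w using that x by (cases w) (auto elim: orbitE)
  have A_lin: "Vector_Spaces.linear fs ps (A y)" if "y \<in> End scale" for y
    unfolding A_def by (rule linear_act_diff[OF that])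
  have a_reg: "vregular_at ps ps ?O (v, x) (a i)" for i
  proof -
    have "vregular_at ps ps ?O (v, x) (\<lambda>w. (0, snd w \<circ> i) + (i v, - (i \<circ> x)))"
      by (intro vregular_at_add vregular_at_const vregular_at_linear linear_psI w0) (auto simp: fun_eq_iff prod_scale_def)
    also have "(\<lambda>w. (0, snd w \<circ> i) + (i v, - (i \<circ> x))) = a i" by (simp add: a_def A_def act_diff_def fun_eq_iff)
    finally show ?thesis .
  qed
  have b_reg: "vregular_at ps ps ?O (v, x) b"
  proof -
    have "vregular_at ps ps ?O (v, x) (\<lambda>w. (fst w, - snd w) + (- v, x))"
      by (intro vregular_at_add vregular_at_const vregular_at_linear linear_psI w0) (auto simp: fun_eq_iff prod_scale_def)
    also have "(\<lambda>w. (fst w, - snd w) + (- v, x)) = b" by (simp add: b_def fun_eq_iff)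
    finally show ?thesis .
  qed
  \<comment> \<open>A relation gives an element of the span of \<open>L\<close> in the kernel of
    \<open>A x\<close>, that is, in the span of \<open>B\<close>; independence of
    \<open>B \<union> L\<close> makes it 0.\<close>
  have ind: "\<forall>i\<in>L. c i = 0" if z: "(\<Sum>i\<in>L. ps (c i) (a i (v, x))) = 0" for c
  proof -
    let ?l = "\<Sum>i\<in>L. fs (c i) i"
    have "A x ?l = 0"
      using z by (simp add: a_def linear_sumD[OF A_lin[OF x]] linear_scaleD[OF A_lin[OF x]])
    moreover have l: "?l \<in> F.span L" using spanL by blast
    ultimately have "?l \<in> F.span B" using LE act_diff_zero_iff unfolding A_def BL(5) by blast
    then obtain d where d: "?l = (\<Sum>i\<in>B. fs (d i) i)"
      using F.span_image_family[OF BL(1), of "\<lambda>i. i"] by auto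
    let ?c = "\<lambda>i. if i \<in> L then c i else - d i"
    have "(\<Sum>i\<in>B \<union> L. fs (?c i) i) = (\<Sum>i\<in>B. fs (?c i) i) + (\<Sum>i\<in>L. fs (?c i) i)"
      by (rule sum.union_disjoint[OF BL(1,2,3)])
    also have "(\<Sum>i\<in>B. fs (?c i) i) = - (\<Sum>i\<in>B. fs (d i) i)"
      unfolding sum_negf[symmetric] using BL(3) by (intro sum.cong) auto
    also have "(\<Sum>i\<in>L. fs (?c i) i) = ?l" by (intro sum.cong) auto
    finally have "(\<Sum>i\<in>B \<union> L. fs (?c i) i) = 0" using d by (simp del: fs_apply add: zero_fun_def)
    then have "?c i = 0" if "i \<in> B \<union> L" for i
      using F.independentD[OF BL(4), of "B \<union> L" ?c i] BL(1,2) that by blast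
    then show ?thesis by (metis UnI2)
  qed
  let ?P = "\<lambda>R. (\<forall>i\<in>L. \<forall>w. Vector_Spaces.linear ps (*) (R i w)) \<and>
    (\<forall>i\<in>L. \<forall>u. vregular_at ps ps ?O (v, x) u \<longrightarrow> regular_at ps ?O (v, x) (\<lambda>w. R i w (u w))) \<and>
    eventually (\<lambda>w. \<forall>i\<in>L. \<forall>j\<in>L. R i w (a j w) = (if i = j then 1 else 0)) (nhdsin (zariski ps ?O) (v, x))"
  have "\<exists>R. ?P R" by (rule regular_left_inverse[OF P.vector_space_axioms w0 BL(2) a_reg ind])
  then obtain R where "?P R" by (elim exE)
  then have R: "\<And>i w. i \<in> L \<Longrightarrow> Vector_Spaces.linear ps (*) (R i w)"
    "\<And>i. i \<in> L \<Longrightarrow> regular_at ps ?O (v, x) (\<lambda>w. R i w (b w))"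
    "eventually (\<lambda>w. \<forall>i\<in>L. \<forall>j\<in>L. R i w (a j w) = (if i = j then 1 else 0)) (nhdsin (zariski ps ?O) (v, x))"
    using b_reg by (simp_all del: split_paired_All)
  define good where "good w \<longleftrightarrow> (\<forall>i\<in>L. \<forall>j\<in>L. R i w (a j w) = (if i = j then 1 else 0))" for w
  define \<sigma> where "\<sigma> w = (\<Sum>i\<in>L. fs (R i w (b w)) i)" for w
  have R_A: "R i w (A (snd w) (\<Sum>j\<in>L. fs (c j) j)) = c i" if "w \<in> ?O" "good w" "i \<in> L" for w i c
  proof -
    note lin = A_lin[OF yE[OF that(1)]]
    have "R i w (A (snd w) (\<Sum>j\<in>L. fs (c j) j)) = (\<Sum>j\<in>L. c j * R i w (a j w))"
      by (simp add: linear_sumD[OF lin] linear_scaleD[OF lin] linear_sumD[OF R(1)[OF that(3)]]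
          linear_scaleD[OF R(1)[OF that(3)]] a_def)
    also have "\<dots> = (\<Sum>j\<in>L. if j = i then c j else 0)"
      using that unfolding good_def by (intro sum.cong) auto
    finally show ?thesis using that(3) BL(2) by simp
  qed
  have \<sigma>_unique: "l = \<sigma> w" if w: "w \<in> ?O" "good w" and l: "l \<in> F.span L" "A (snd w) l = b w" for w l
  proof -
    obtain c where c: "l = (\<Sum>i\<in>L. fs (c i) i)" using l(1) spanL by blast
    show ?thesis unfolding \<sigma>_def using R_A[OF w, of _ c] l(2) c by simp
  qed
  \<comment> \<open>The system has more equations than unknowns in general; that \<open>w\<close>
    lies on the orbit is what makes it solvable.\<close>
  have exists_l: "\<exists>l\<in>F.span L. A (snd w) l = b w" if w: "w \<in> ?O" "good w" for w
  proof -
    obtain u y where wuy: "w = (u, y)" by (cases w)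
    obtain h where h: "h \<in> carrier (GL scale)" "h v = u" "y \<circ> h = h \<circ> x" "y \<in> End scale"
      using w(1) x unfolding wuy by (auto elim: orbitE)
    have hE: "h \<in> End scale" using h(1) by (simp add: GL_iff)
    note lin = A_lin[OF h(4)]
    have Ah: "A y (h \<circ> \<epsilon>) = 0" if "\<epsilon> \<in> End_ann scale v x" for \<epsilon>
    proof -
      have "\<epsilon> v = 0" "x \<circ> \<epsilon> = \<epsilon> \<circ> x" using that unfolding End_ann_def End_cent_def by auto
      then have "y \<circ> (h \<circ> \<epsilon>) = h \<circ> \<epsilon> \<circ> x" by (metis comp_assoc h(3))
      then show ?thesis using \<open>\<epsilon> v = 0\<close> hE
        by (simp add: A_def act_diff_def End_zero zero_prod_def)
    qed
    \<comment> \<open>Replacing \<open>B\<close> by its translates under \<open>h\<close> adapts the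
      basis of \<open>End V\<close> to the kernel of \<open>A y\<close>; \<open>good w\<close>
      separates these translates from the span of \<open>L\<close>.\<close>
    define t where "t i = (if i \<in> L then i else h \<circ> i)" for i
    have tsum: "(\<Sum>i\<in>B \<union> L. fs (c i) (t i)) = (h \<circ> (\<Sum>i\<in>B. fs (c i) i)) + (\<Sum>i\<in>L. fs (c i) i)" for c
    proof -
      have "(\<Sum>i\<in>B \<union> L. fs (c i) (t i)) = (\<Sum>i\<in>B. fs (c i) (t i)) + (\<Sum>i\<in>L. fs (c i) (t i))"
        by (rule sum.union_disjoint[OF BL(1,2,3)])
      also have "(\<Sum>i\<in>L. fs (c i) (t i)) = (\<Sum>i\<in>L. fs (c i) i)" unfolding t_def by (intro sum.cong) auto
      also have "(\<Sum>i\<in>B. fs (c i) (t i)) = (\<Sum>i\<in>B. fs (c i) (h \<circ> i))"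
        unfolding t_def using BL(3) by (intro sum.cong) auto
      also have "\<dots> = h \<circ> (\<Sum>i\<in>B. fs (c i) i)"
        by (simp add: fun_eq_iff sum_fun_apply End_sum[OF hE] End_scale[OF hE])
      finally show ?thesis .
    qed
    have annB: "(\<Sum>i\<in>B. fs (c i) i) \<in> End_ann scale v x" for c
      unfolding BL(5)[symmetric] by (intro F.span_sum F.span_scale F.span_base)
    have fin: "finite (B \<union> L)" using BL by simp
    have "inj_on t (B \<union> L) \<and> F.independent (t ` (B \<union> L))"
      unfolding F.independent_family_iff[OF fin] tsum
    proof (intro allI impI)
      fix c assume z: "(h \<circ> (\<Sum>i\<in>B. fs (c i) i)) + (\<Sum>i\<in>L. fs (c i) i) = 0"
      have "A y (\<Sum>i\<in>L. fs (c i) i) = A y ((h \<circ> (\<Sum>i\<in>B. fs (c i) i)) + (\<Sum>i\<in>L. fs (c i) i))"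
        by (simp add: linear_addD[OF lin] Ah[OF annB])
      then have "A (snd w) (\<Sum>i\<in>L. fs (c i) i) = 0" unfolding z wuy by (simp add: linear_zeroD[OF lin])
      then have cL: "c i = 0" if "i \<in> L" for i
        using R_A[OF w that, of c] by (simp add: linear_zeroD[OF R(1)[OF that]])
      then have "(\<Sum>i\<in>L. fs (c i) i) = 0" by (intro sum.neutral) (simp add: fun_eq_iff)
      then have hz: "h \<circ> (\<Sum>i\<in>B. fs (c i) i) = 0" using z by simp
      have "(\<Sum>i\<in>B. fs (c i) i) u = 0" for u
      proof -
        have eq: "h ((\<Sum>i\<in>B. fs (c i) i) u) = h 0" using fun_cong[OF hz, of u] End_zero[OF hE] by simp
        have "bij h" using h(1) unfolding GL_iff by (rule conjunct2)
        from injD[OF bij_is_inj[OF this] eq] show ?thesis .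
      qed
      then have "(\<Sum>i\<in>B. fs (c i) i) = 0" by (simp add: fun_eq_iff)
      then have "c i = 0" if "i \<in> B" for i
        using F.independentD[OF F.independent_mono[OF BL(4)], of B B c i] BL(1) that by blast
      then show "\<forall>i\<in>B \<union> L. c i = 0" using cL by blast
    qed
    then have t: "inj_on t (B \<union> L)" "F.independent (t ` (B \<union> L))" by blast+
    have tE: "t ` (B \<union> L) \<subseteq> End scale"
      unfolding t_def using iE comp_End[OF hE] BE End_ann_subset by fastforce
    \<comment> \<open>The translated family is independent and has as many members as the basis
      \<open>B \<union> L\<close>, so it spans.\<close>
    have "End scale \<subseteq> F.span (t ` (B \<union> L))"
    proof
      fix f assume f: "f \<in> End scale"
      show "f \<in> F.span (t ` (B \<union> L))"
      proof (rule ccontr)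
        assume n: "f \<notin> F.span (t ` (B \<union> L))"
        then have "F.independent (insert f (t ` (B \<union> L)))" using t(2) by (rule F.independent_insertI)
        moreover have "insert f (t ` (B \<union> L)) \<subseteq> F.span (B \<union> L)" using f tE unfolding BL(6) by simp
        ultimately have "card (insert f (t ` (B \<union> L))) \<le> card (B \<union> L)"
          using F.independent_span_bound[OF fin] by metis
        moreover have "f \<notin> t ` (B \<union> L)" using n F.span_base by metis
        ultimately show False using fin t(1) by (simp add: card_image)
      qed
    qed
    then have "id - h \<in> F.span (t ` (B \<union> L))" using diff_End[OF id_End hE] by blast
    then obtain c where "id - h = (\<Sum>i\<in>B \<union> L. fs (c i) (t i))"
      unfolding F.span_image_family[OF fin] by blast
    then have c: "id - h = (h \<circ> (\<Sum>i\<in>B. fs (c i) i)) + (\<Sum>i\<in>L. fs (c i) i)" unfolding tsum .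
    let ?l = "\<Sum>i\<in>L. fs (c i) i"
    \<comment> \<open>With \<open>beta\<close> for the sum over \<open>B\<close>, this says
      \<open>id - ?l = h (id + beta)\<close>, and \<open>beta\<close> annihilates \<open>v\<close>
      and commutes with \<open>x\<close>. So \<open>- ?l\<close> solves the system.\<close>
    have eq: "- ?l = h + (h \<circ> (\<Sum>i\<in>B. fs (c i) i)) - id"
      using c by (simp add: algebra_simps)
    have "A y (- ?l) = A y h - A y id"
      unfolding eq by (simp add: linear_addD[OF lin] linear_diffD[OF lin] Ah[OF annB])
    also have "\<dots> = b w"
      unfolding A_def act_diff_def b_def wuy using h(2,3) by simp
    finally have "A (snd w) (- ?l) = b w" unfolding wuy by simp
    moreover have "- ?l \<in> F.span L" by (intro F.span_neg F.span_sum F.span_scale F.span_base)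
    ultimately show ?thesis by blast
  qed
  have \<sigma>L: "\<sigma> w \<in> F.span L" for w unfolding \<sigma>_def by (intro F.span_sum F.span_scale F.span_base)
  have \<sigma>_eq: "A (snd w) (\<sigma> w) = b w" if "w \<in> ?O" "good w" for w
    using exists_l[OF that] \<sigma>_unique[OF that] by blast
  have good_ev: "eventually good (nhdsin (zariski ps ?O) (v, x))" using R(3) unfolding good_def .
  have good0: "good (v, x)" using good_ev unfolding eventually_nhdsin_zariski[OF w0] using w0 by blast
  have "A x 0 = b (v, x)"
    by (simp add: A_def act_diff_def b_def fun_eq_iff End_zero[OF x])
  then have \<sigma>0: "\<sigma> (v, x) = 0" using \<sigma>_unique[OF w0 good0, of 0] F.span_zero by simp
  have \<sigma>_reg: "vregular_at ps fs X w \<sigma>"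
    if "w \<in> X" "X \<subseteq> ?O" "\<forall>i\<in>L. regular_at ps ?O w (\<lambda>w. R i w (b w))" for w X
    unfolding \<sigma>_def using that
    by (intro vregular_at_sum vregular_at_scale vregular_at_const) (auto intro: regular_at_subset)
  have GL_ev: "eventually (\<lambda>w. id + \<sigma> w \<in> carrier (GL scale)) (nhdsin (zariski ps ?O) (v, x))"
  proof -
    obtain q where q: "q \<in> poly_funs fs" "q id \<noteq> 0" "\<And>g. g \<in> End scale \<Longrightarrow> q g \<noteq> 0 \<Longrightarrow> g \<in> carrier (GL scale)"
      using openin_zariskiD[OF openin_GL id_GL] by blast
    have "vregular_at ps fs ?O (v, x) (\<lambda>w. id + \<sigma> w)"
      using R(2) w0 by (intro vregular_at_add vregular_at_const \<sigma>_reg) auto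
    from regular_at_eventually_nonzero[OF regular_at_compose_poly[OF q(1) this]]
    have "eventually (\<lambda>w. q (id + \<sigma> w) \<noteq> 0) (nhdsin (zariski ps ?O) (v, x))"
      using q(2) by (simp add: \<sigma>0)
    then show ?thesis
      by (rule eventually_mono) (use q(3) add_End[OF id_End] \<sigma>L LE in blast)
  qed
  \<comment> \<open>The three open conditions cutting out \<open>O'\<close>: unique solvability,
    invertibility of \<open>id + \<sigma> w\<close>, and regularity of \<open>\<sigma>\<close> at
    each point and not only at the base point.\<close>
  have "eventually (\<lambda>w. good w \<and> id + \<sigma> w \<in> carrier (GL scale) \<and>
      (\<forall>i\<in>L. regular_at ps ?O w (\<lambda>w. R i w (b w)))) (nhdsin (zariski ps ?O) (v, x))"
    by (intro eventually_conj good_ev GL_ev eventually_ball_finite BL(2) ballI regular_at_eventually R(2))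
  then obtain O' where O': "openin (zariski ps ?O) O'" "(v, x) \<in> O'"
    "\<And>w. w \<in> O' \<Longrightarrow> good w" "\<And>w. w \<in> O' \<Longrightarrow> id + \<sigma> w \<in> carrier (GL scale)"
    "\<And>w. w \<in> O' \<Longrightarrow> \<forall>i\<in>L. regular_at ps ?O w (\<lambda>w. R i w (b w))"
    using w0 unfolding eventually_nhdsin by auto
  have O'sub: "O' \<subseteq> ?O" using openin_subset[OF O'(1)] by simp
  define \<psi> where "\<psi> l = ((id + l) v, (id + l) \<circ> x \<circ> inv_into UNIV (id + l))" for l :: "'b \<Rightarrow> 'b"
  define L' where "L' = {l \<in> F.span L. id + l \<in> carrier (GL scale)}"
  have L'sub: "L' \<subseteq> {l \<in> End scale. id + l \<in> carrier (GL scale)}" using LE unfolding L'_def by blast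
  have \<psi>_reg: "vregular_at fs ps L' l0 \<psi>" if l0: "l0 \<in> L'" for l0
  proof -
    have "Vector_Spaces.linear fs ps (\<lambda>y. (0, y))" by (rule linear_fs_psI) (auto simp: fun_eq_iff)
    note Y = vregular_at_compose_linear[OF vregular_comp_inv[OF x L'sub l0] this]
    have "vregular_at fs ps L' l0 (\<lambda>l. (l v, 0) + (v, 0))"
      by (intro vregular_at_add vregular_at_const vregular_at_linear linear_fs_psI l0) (auto simp: fun_eq_iff)
    from vregular_at_add[OF this Y]
    have "vregular_at fs ps L' l0 (\<lambda>l. ((l v, 0) + (v, 0)) + (0, (id + l) \<circ> x \<circ> inv_into UNIV (id + l)))" .
    also have "(\<lambda>l. ((l v, 0) + (v, 0)) + (0, (id + l) \<circ> x \<circ> inv_into UNIV (id + l))) = \<psi>"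
      unfolding \<psi>_def by (simp add: add.commute)
    finally show ?thesis .
  qed
  have \<psi>_orb: "\<psi> l \<in> ?O" if "l \<in> L'" for l using that unfolding \<psi>_def L'_def orbit_def by blast
  have \<psi>_cont: "continuous_map (zariski fs L') (zariski ps ?O) \<psi>"
    using \<psi>_reg \<psi>_orb by (intro continuous_map_zariski) auto
  \<comment> \<open>Pulling back \<open>O'\<close> ensures that \<open>\<psi>\<close> maps
    \<open>U\<close> into \<open>O'\<close>; conversely \<open>\<sigma>\<close> lands in
    \<open>U\<close> because \<open>\<psi> (\<sigma> w) = w\<close> on \<open>O'\<close>.\<close>
  define U where "U = {l \<in> L'. \<psi> l \<in> O'}"
  have "continuous_map (zariski fs (F.span L)) (zariski fs (End scale)) (\<lambda>l. id + l)"
    using LE add_End[OF id_End]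
    by (intro continuous_map_zariski vregular_at_add vregular_at_const vregular_at_linear) (auto intro: F.linear_ident)
  from openin_continuous_map_preimage[OF this openin_GL]
  have L'_open: "openin (zariski fs (F.span L)) L'" unfolding L'_def by simp
  have "openin (zariski fs L') U"
    using openin_continuous_map_preimage[OF \<psi>_cont O'(1)] unfolding U_def by simp
  moreover have "zariski fs L' = subtopology (zariski fs (F.span L)) L'"
    unfolding subtopology_zariski L'_def by (simp add: Int_absorb1 subset_iff Collect_conj_eq Int_assoc[symmetric])
  ultimately have U_open: "openin (zariski fs (F.span L)) U"
    using L'_open by (simp add: openin_open_subtopology)
  have \<psi>\<sigma>: "\<psi> (\<sigma> w) = w" if w: "w \<in> O'" for w
  proof -
    obtain u y where wuy: "w = (u, y)" by (cases w)
    let ?g = "id + \<sigma> w"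
    have "w \<in> ?O" using w O'sub by blast
    from \<sigma>_eq[OF this O'(3)[OF w]] have e: "\<sigma> w v = u - v" "(y \<circ> \<sigma> w) - (\<sigma> w \<circ> x) = x - y"
      unfolding A_def act_diff_def b_def wuy by auto
    have yE': "y \<in> End scale" using yE \<open>w \<in> ?O\<close> wuy by auto
    have comm: "y \<circ> ?g = ?g \<circ> x"
    proof
      fix z show "(y \<circ> ?g) z = (?g \<circ> x) z"
        using fun_cong[OF e(2), of z] by (simp add: End_add[OF yE'] algebra_simps)
    qed
    have "?g \<circ> inv_into UNIV ?g = id" using O'(4)[OF w] by (rule GL_inv_right)
    then have "?g \<circ> x \<circ> inv_into UNIV ?g = y" unfolding comm[symmetric] by (simp only: comp_assoc comp_id)
    then show ?thesis unfolding \<psi>_def using e(1) by (simp add: wuy)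
  qed
  \<comment> \<open>By construction \<open>l\<close> solves the system attached to the point
    \<open>\<psi> l\<close>, so uniqueness applies.\<close>
  have \<sigma>\<psi>: "\<sigma> (\<psi> l) = l" if l: "l \<in> U" for l
  proof -
    have l': "l \<in> F.span L" "id + l \<in> carrier (GL scale)" "\<psi> l \<in> O'" using l unfolding U_def L'_def by auto
    then have w: "\<psi> l \<in> ?O" "good (\<psi> l)" using O'sub O'(3) by auto
    define y where "y = snd (\<psi> l)"
    have yE': "y \<in> End scale" unfolding y_def by (rule yE[OF w(1)])
    have "inv_into UNIV (id + l) \<circ> (id + l) = id" by (rule GL_inv_left[OF l'(2)])
    then have "y \<circ> (id + l) = (id + l) \<circ> x" unfolding y_def \<psi>_def by (simp only: snd_conv comp_assoc comp_id)
    then have "y z + y (l z) = x z + l (x z)" for z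
      using End_add[OF yE'] by (metis comp_apply id_apply plus_fun_apply)
    then have "A y l = b (\<psi> l)"
      unfolding A_def act_diff_def b_def y_def[symmetric]
      by (auto simp: \<psi>_def fun_eq_iff algebra_simps)
    then show ?thesis using \<sigma>_unique[OF w l'(1)] unfolding y_def by simp
  qed
  have "homeomorphic_maps (zariski ps O') (zariski fs U) \<sigma> \<psi>"
    unfolding homeomorphic_maps_def
  proof (intro conjI ballI)
    have "\<sigma> w \<in> U" if "w \<in> O'" for w
      using \<sigma>L O'(4)[OF that] \<psi>\<sigma>[OF that] that unfolding U_def L'_def by simp
    then show "continuous_map (zariski ps O') (zariski fs U) \<sigma>"
      using O'sub O'(5) by (intro continuous_map_zariski \<sigma>_reg) auto
    show "continuous_map (zariski fs U) (zariski ps O') \<psi>"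
      by (rule continuous_map_zariski) (auto simp: U_def intro: vregular_at_subset[OF \<psi>_reg])
  qed (use \<psi>\<sigma> \<sigma>\<psi> in auto)
  then have "zariski ps O' homeomorphic_space zariski fs U" unfolding homeomorphic_space_def by blast
  moreover have "U \<noteq> {}"
  proof -
    have "\<sigma> (v, x) \<in> U" using \<psi>\<sigma>[OF O'(2)] \<sigma>L O'(4)[OF O'(2)] O'(2) unfolding U_def L'_def by simp
    then show ?thesis by blast
  qed
  ultimately show thesis using that[OF O'(1,2) BL(2) indL] BL(7,8) U_open by (simp add: add.commute)
qed

section \<open>Moving the chart along the orbit\<close>

lemma orbit_eq:
  assumes "(u, y) \<in> orbit v x" "x \<in> End scale"
  shows "orbit u y = orbit v x"
proof -
  obtain h where h: "h \<in> carrier (GL scale)" "h v = u" "y \<circ> h = h \<circ> x" "y \<in> End scale"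
    using orbitE[OF assms] by blast
  define k where "k = inv_into UNIV h"
  have kh: "k \<circ> h = id" "h \<circ> k = id" and k: "k \<in> carrier (GL scale)"
    unfolding k_def using h(1) by (auto intro: GL_inv GL_inv_left GL_inv_right)
  have ku: "k u = v" using kh(1) h(2) by (metis comp_apply id_apply)
  have ky: "x \<circ> k = k \<circ> y"
    by (metis comp_assoc comp_id id_comp h(3) kh)
  show ?thesis
  proof (rule Set.set_eqI, clarify)
    fix u' y'
    show "(u', y') \<in> orbit u y \<longleftrightarrow> (u', y') \<in> orbit v x"
    proof
      assume "(u', y') \<in> orbit u y"
      then obtain g where g: "g \<in> carrier (GL scale)" "g u = u'" "y' \<circ> g = g \<circ> y"
        using h(4) by (elim orbitE)
      have "y' \<circ> (g \<circ> h) = (g \<circ> h) \<circ> x" by (metis comp_assoc g(3) h(3))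
      from orbitI[OF GL_comp[OF g(1) h(1)] this, of v] show "(u', y') \<in> orbit v x"
        using g(2) h(2) by simp
    next
      assume "(u', y') \<in> orbit v x"
      then obtain g where g: "g \<in> carrier (GL scale)" "g v = u'" "y' \<circ> g = g \<circ> x"
        using assms(2) by (elim orbitE)
      have "y' \<circ> (g \<circ> k) = (g \<circ> k) \<circ> y" by (metis comp_assoc g(3) ky)
      from orbitI[OF GL_comp[OF g(1) k] this, of u] show "(u', y') \<in> orbit u y"
        using g(2) ku by simp
    qed
  qed
qed

text \<open>Conjugation by \<open>g\<close> is an injective linear map carrying one annihilator onto
  the other.\<close>

lemma dim_End_ann_conj:
  assumes g: "g \<in> carrier (GL scale)" "y \<circ> g = g \<circ> x" and E: "x \<in> End scale" "y \<in> End scale"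
  shows "F.dim (End_ann scale (g v) y) = F.dim (End_ann scale v x)"
proof -
  define k where "k = inv_into UNIV g"
  have kg: "k \<circ> g = id" "g \<circ> k = id" and k: "k \<in> carrier (GL scale)"
    unfolding k_def using g(1) by (auto intro: GL_inv GL_inv_left GL_inv_right)
  have gE: "g \<in> End scale" and kE: "k \<in> End scale" using g(1) k by (auto simp: GL_iff)
  have xk: "x \<circ> k = k \<circ> y" by (metis comp_assoc comp_id id_comp g(2) kg)
  define T where "T \<epsilon> = g \<circ> \<epsilon> \<circ> k" for \<epsilon> :: "'b \<Rightarrow> 'b"
  have lin: "Vector_Spaces.linear fs fs T"
    by (rule linear_fsI) (auto simp: T_def fun_eq_iff End_add[OF gE] End_scale[OF gE])
  have inj: "inj T"
  proof (rule inj_on_inverseI[where g = "\<lambda>\<epsilon>. k \<circ> \<epsilon> \<circ> g"])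
    show "k \<circ> T \<epsilon> \<circ> g = \<epsilon>" for \<epsilon> unfolding T_def by (metis comp_assoc comp_id id_comp kg(1))
  qed
  have "T ` End_ann scale v x = End_ann scale (g v) y"
  proof
    show "T ` End_ann scale v x \<subseteq> End_ann scale (g v) y"
    proof safe
      fix \<epsilon> assume "\<epsilon> \<in> End_ann scale v x"
      then have e: "\<epsilon> \<in> End scale" "x \<circ> \<epsilon> = \<epsilon> \<circ> x" "\<epsilon> v = 0" unfolding End_ann_def End_cent_def by auto
      have "y \<circ> T \<epsilon> = T \<epsilon> \<circ> y" unfolding T_def by (metis comp_assoc e(2) g(2) xk)
      moreover have "T \<epsilon> (g v) = 0" unfolding T_def using e(3) End_zero[OF gE] kg(1) by (metis comp_apply id_apply)
      ultimately show "T \<epsilon> \<in> End_ann scale (g v) y"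
        unfolding End_ann_def End_cent_def using comp_End gE e(1) kE by (simp add: T_def)
    qed
    show "End_ann scale (g v) y \<subseteq> T ` End_ann scale v x"
    proof
      fix \<epsilon> assume "\<epsilon> \<in> End_ann scale (g v) y"
      then have e: "\<epsilon> \<in> End scale" "y \<circ> \<epsilon> = \<epsilon> \<circ> y" "\<epsilon> (g v) = 0" unfolding End_ann_def End_cent_def by auto
      have "x \<circ> (k \<circ> \<epsilon> \<circ> g) = (k \<circ> \<epsilon> \<circ> g) \<circ> x" by (metis comp_assoc e(2) g(2) xk)
      moreover have "(k \<circ> \<epsilon> \<circ> g) v = 0" using e(3) End_zero[OF kE] by simp
      ultimately have "k \<circ> \<epsilon> \<circ> g \<in> End_ann scale v x"
        unfolding End_ann_def End_cent_def using comp_End gE e(1) kE by simp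
      moreover have "T (k \<circ> \<epsilon> \<circ> g) = \<epsilon>" unfolding T_def by (metis comp_assoc comp_id id_comp kg(2))
      ultimately show "\<epsilon> \<in> T ` End_ann scale v x" by (metis imageI)
    qed
  qed
  moreover have "F.dim (T ` End_ann scale v x) = F.dim (End_ann scale v x)"
  proof -
    interpret FF: vector_space_pair fs fs by unfold_locales
    obtain C where C: "C \<subseteq> End_ann scale v x" "F.independent C" "End_ann scale v x \<subseteq> F.span C"
      using F.maximal_independent_subset by blast
    have "F.independent (T ` C)" using FF.linear_independent_injective_image[OF lin C(2)] inj
      by (simp add: inj_on_subset[OF inj subset_UNIV])
    moreover have "T ` C \<subseteq> T ` End_ann scale v x" using C(1) by blast
    moreover have "T ` End_ann scale v x \<subseteq> F.span (T ` C)"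
      using FF.linear_spans_image[OF lin C(3)] .
    ultimately have "card (T ` C) = F.dim (T ` End_ann scale v x)" by (rule_tac F.basis_card_eq_dim)
    moreover have "card (T ` C) = card C" using inj by (intro card_image inj_on_subset[OF inj subset_UNIV])
    moreover have "card C = F.dim (End_ann scale v x)" by (rule F.basis_card_eq_dim[OF C(1,3,2)])
    ultimately show ?thesis by simp
  qed
  ultimately show ?thesis by simp
qed

text \<open>\<open>orbit_chart\<close> covers only a neighbourhood of its base point. Any orbit
  point may be taken as base point, with the same orbit and an annihilator of the same dimension, so
  all charts agree in dimension. The first conclusion makes the truncated subtraction in the second
  a true difference.\<close>

theorem krull_dim_orbit:
  assumes x: "x \<in> End scale"
  shows "F.dim (End_ann scale v x) \<le> dim UNIV ^ 2"
    and "krull_dim (zariski ps (orbit v x)) = ereal (real (dim UNIV ^ 2 - F.dim (End_ann scale v x)))"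
proof -
  let ?d = "ereal (real (dim UNIV ^ 2 - F.dim (End_ann scale v x)))"
  have chart: "\<exists>W. openin (zariski ps (orbit v x)) W \<and> p \<in> W \<and>
      krull_dim (zariski ps W) = ?d \<and> F.dim (End_ann scale v x) \<le> dim UNIV ^ 2"
    if p: "p \<in> orbit v x" for p
  proof -
    obtain u y where uy: "p = (u, y)" by (cases p)
    obtain h where h: "h \<in> carrier (GL scale)" "h v = u" "y \<circ> h = h \<circ> x" "y \<in> End scale"
      using p x unfolding uy by (elim orbitE)
    have d: "F.dim (End_ann scale u y) = F.dim (End_ann scale v x)"
      using dim_End_ann_conj[OF h(1,3) x h(4), of v] h(2) by simp
    have o: "orbit u y = orbit v x" using orbit_eq p x uy by blast
    obtain W U L where W: "openin (zariski ps (orbit u y)) W" "(u, y) \<in> W" "finite L" "F.independent L"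
      "card L + F.dim (End_ann scale u y) = dim UNIV ^ 2"
      "openin (zariski fs (F.span L)) U" "U \<noteq> {}" "zariski ps W homeomorphic_space zariski fs U"
      by (rule orbit_chart[OF h(4)])
    have "krull_dim (zariski ps W) = krull_dim (zariski fs U)" by (rule krull_dim_homeomorphic[OF W(8)])
    also have "\<dots> = ereal (real (card L))"
      by (rule F.krull_dim_open_affine[OF W(3,4), of 0]) (use W(6,7) in simp_all)
    also have "card L = dim UNIV ^ 2 - F.dim (End_ann scale v x)" using W(5) d by linarith
    finally show ?thesis using W(1,2,5) unfolding o uy d by (auto simp del: fs_apply)
  qed
  have w0: "(v, x) \<in> orbit v x" using orbitI[OF id_GL, of x x v] by simp
  show "F.dim (End_ann scale v x) \<le> dim UNIV ^ 2" using chart[OF w0] by blast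
  have sub: "subtopology (zariski ps (orbit v x)) W = zariski ps W" if "openin (zariski ps (orbit v x)) W" for W
    using openin_subset[OF that] by (simp add: subtopology_zariski Int_absorb1)
  show "krull_dim (zariski ps (orbit v x)) = ?d"
  proof (rule antisym)
    show "krull_dim (zariski ps (orbit v x)) \<le> ?d"
    proof (rule krull_dim_le_locally)
      fix p assume "p \<in> topspace (zariski ps (orbit v x))"
      then obtain W where "openin (zariski ps (orbit v x)) W" "p \<in> W" "krull_dim (zariski ps W) = ?d"
        using chart[of p] by auto
      then show "\<exists>W. openin (zariski ps (orbit v x)) W \<and> p \<in> W \<and>
          krull_dim (subtopology (zariski ps (orbit v x)) W) \<le> ?d"
        using sub by (intro exI[of _ W]) simp
    qed
    obtain W where "openin (zariski ps (orbit v x)) W" "krull_dim (zariski ps W) = ?d"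
      using chart[OF w0] by blast
    then show "?d \<le> krull_dim (zariski ps (orbit v x))"
      using krull_dim_subtopology_le[of "zariski ps (orbit v x)" W] sub by simp
  qed
qed

end

section \<open>Partitions\<close>

lemma downward_closed_eq:
  fixes S :: "nat set"
  assumes "finite S" "0 \<notin> S" "\<And>i. i \<ge> 1 \<Longrightarrow> Suc i \<in> S \<Longrightarrow> i \<in> S"
  shows "S = {1..card S}"
proof (cases "S = {}")
  case False
  have down: "j \<in> S" if "i \<in> S" "1 \<le> j" "j \<le> i" for i j
    using that(3,1,2)
  proof (induction i rule: dec_induct)
    case (step i)
    then show ?case using assms(3)[of i] by simp
  qed
  have "S = {1..Max S}"
  proof
    show "S \<subseteq> {1..Max S}" using assms(1,2) by (auto simp: Suc_le_eq intro: gr0I)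
    show "{1..Max S} \<subseteq> S" using down Max_in[OF assms(1) False] by auto
  qed
  then show ?thesis by (metis card_atLeastAtMost diff_Suc_1)
qed simp

lemma partition_nonzero:
  assumes "is_partition p"
  shows "{i. p i \<noteq> 0} = {1..plength p}"
proof -
  have p: "p 0 = 0" "\<And>i. i \<ge> 1 \<Longrightarrow> p (Suc i) \<le> p i" "finite {i. p i \<noteq> 0}"
    using assms unfolding is_partition_def by auto
  show ?thesis
    unfolding plength_def
  proof (rule downward_closed_eq)
    fix i assume "i \<ge> 1" "Suc i \<in> {i. p i \<noteq> 0}"
    then show "i \<in> {i. p i \<noteq> 0}" using p(2)[of i] by simp
  qed (use p(1,3) in simp_all)
qed

lemma partition_antimono:
  assumes "is_partition p" "1 \<le> i" "i \<le> j"
  shows "p j \<le> p i"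
  using assms(3)
proof (induction j rule: dec_induct)
  case (step j)
  have "p (Suc j) \<le> p j" using assms(1,2) step.hyps unfolding is_partition_def by auto
  then show ?case using step by simp
qed simp

lemma partition_pos_iff:
  assumes "is_partition p"
  shows "0 < p i \<longleftrightarrow> 1 \<le> i \<and> i \<le> plength p"
proof -
  have "i \<in> {i. p i \<noteq> 0} \<longleftrightarrow> i \<in> {1..plength p}" unfolding partition_nonzero[OF assms] ..
  then show ?thesis by simp
qed

text \<open>Parts beyond the length are 0, so any sufficiently long range may be used; this lets
  \<open>mu\<close>, \<open>nu\<close> and \<open>mu + nu\<close> be summed over a common
  range.\<close>

lemma partition_sum:
  assumes "is_partition p" "plength p \<le> N"
  shows "psize p = (\<Sum>i=1..N. p i)" "pn p = (\<Sum>i=1..N. (i - 1) * p i)"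
proof -
  have "p i = 0" if "i \<notin> {1..plength p}" for i using that partition_pos_iff[OF assms(1), of i] by auto
  then show "psize p = (\<Sum>i=1..N. p i)" "pn p = (\<Sum>i=1..N. (i - 1) * p i)"
    unfolding psize_def pn_def partition_nonzero[OF assms(1)]
    using assms(2) by (auto intro!: sum.mono_neutral_left)
qed

lemma partition_add:
  assumes "is_partition mu" "is_partition nu"
  shows "is_partition (mu + nu)" "plength mu \<le> plength (mu + nu)" "plength nu \<le> plength (mu + nu)"
    "psize (mu + nu) = psize mu + psize nu" "pn (mu + nu) = pn mu + pn nu"
proof -
  have "{i. (mu + nu) i \<noteq> 0} = {i. mu i \<noteq> 0} \<union> {i. nu i \<noteq> 0}" by auto
  then show p: "is_partition (mu + nu)"
    using assms unfolding is_partition_def by (auto intro: add_mono)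
  have f: "finite {i. (mu + nu) i \<noteq> 0}" using p unfolding is_partition_def by blast
  show l: "plength mu \<le> plength (mu + nu)" "plength nu \<le> plength (mu + nu)"
    unfolding plength_def by (rule card_mono[OF f], force)+
  show "psize (mu + nu) = psize mu + psize nu" "pn (mu + nu) = pn mu + pn nu"
    unfolding partition_sum[OF p order_refl] partition_sum[OF assms(1) l(1)] partition_sum[OF assms(2) l(2)]
    by (simp_all add: sum.distrib distrib_left)
qed

lemma is_partition_zero: "is_partition 0"
  by (simp add: is_partition_def)

lemma psize_pn_zero: "psize 0 = 0" "pn 0 = 0" "plength 0 = 0"
  by (simp_all add: psize_def pn_def plength_def)

lemma boxes_Sigma: "boxes p = (SIGMA i:{1..plength p}. {1..p i})"
  by (auto simp: boxes_def)

lemma finite_boxes: "finite (boxes p)"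
  by (simp add: boxes_Sigma)

lemma card_boxes:
  assumes "is_partition p"
  shows "card (boxes p) = psize p"
  unfolding boxes_Sigma partition_sum[OF assms order_refl] by simp

text \<open>The diagonal contributes \<open>p i\<close>. For \<open>j < i\<close> the minimum is
  \<open>p i\<close>, and it occurs for both orders of the pair, with \<open>i - 1\<close> choices
  of \<open>j\<close>.\<close>

lemma sum_min_antimono:
  fixes p :: "nat \<Rightarrow> nat"
  assumes "\<And>i j. 1 \<le> i \<Longrightarrow> i \<le> j \<Longrightarrow> p j \<le> p i"
  shows "(\<Sum>i=1..N. \<Sum>j=1..N. min (p i) (p j)) = (\<Sum>i=1..N. p i) + 2 * (\<Sum>i=1..N. (i - 1) * p i)"
proof (induction N)
  case (Suc N)
  have "(\<Sum>j=1..N. min (p (Suc N)) (p j)) = (\<Sum>j=1..N. p (Suc N))"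
    "(\<Sum>i=1..N. min (p i) (p (Suc N))) = (\<Sum>i=1..N. p (Suc N))"
    by (intro sum.cong; use assms in \<open>simp add: min_def antisym\<close>)+
  then show ?case using Suc by (simp add: sum.distrib)
qed simp

lemma cent_index_Sigma:
  "cent_index p = (SIGMA i1:{1..plength p}. SIGMA i2:{1..plength p}. {p i1 - p i2..p i1 - 1})"
  by (auto simp: cent_index_def)

lemma finite_cent_index: "finite (cent_index p)"
  by (simp add: cent_index_Sigma)

text \<open>For fixed \<open>i1\<close> and \<open>i2\<close> the admissible \<open>s\<close> number
  \<open>min (p i1) (p i2)\<close>; both parts are positive here, so the truncated
  \<open>- 1\<close> is harmless.\<close>

lemma card_cent_index:
  assumes "is_partition p"
  shows "card (cent_index p) = psize p + 2 * pn p"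
proof -
  have "card (cent_index p) = (\<Sum>i1=1..plength p. \<Sum>i2=1..plength p. card {p i1 - p i2..p i1 - 1})"
    unfolding cent_index_Sigma by (simp add: card_SigmaI)
  also have "\<dots> = (\<Sum>i1=1..plength p. \<Sum>i2=1..plength p. min (p i1) (p i2))"
  proof (intro sum.cong refl)
    fix i1 i2 assume "i1 \<in> {1..plength p}" "i2 \<in> {1..plength p}"
    then have "0 < p i1" "0 < p i2" using partition_pos_iff[OF assms] by auto
    then show "card {p i1 - p i2..p i1 - 1} = min (p i1) (p i2)" by auto
  qed
  also have "\<dots> = psize p + 2 * pn p"
    unfolding partition_sum[OF assms order_refl]
    by (rule sum_min_antimono) (rule partition_antimono[OF assms])
  finally show ?thesis .
qed

section \<open>The centralizer of a nilpotent endomorphism\<close>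

locale jordan = fin_zariski scale Basis
  for scale :: "'a::field \<Rightarrow> 'b::ab_group_add \<Rightarrow> 'b" and Basis :: "'b set" +
  fixes p :: "nat \<Rightarrow> nat" and x :: "'b \<Rightarrow> 'b" and e :: "nat \<Rightarrow> nat \<Rightarrow> 'b"
  assumes part: "is_partition p" and x: "x \<in> End scale" and jb: "jordan_basis scale p x e"
begin

lemma box_iff: "(i, j) \<in> boxes p \<longleftrightarrow> 1 \<le> j \<and> j \<le> p i"
  using partition_pos_iff[OF part, of i] by (auto simp: boxes_def)

lemma e_indep: "(\<Sum>k\<in>boxes p. scale (c k) (case_prod e k)) = 0 \<Longrightarrow> \<forall>k\<in>boxes p. c k = 0"
  and e_span: "span (case_prod e ` boxes p) = UNIV"
  and e_inj: "inj_on (case_prod e) (boxes p)" "independent (case_prod e ` boxes p)"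
  using jb independent_family_iff[OF finite_boxes, of "case_prod e" p]
  unfolding jordan_basis_def basis_family_def by auto

lemma x_e: "(i, j) \<in> boxes p \<Longrightarrow> x (e i j) = (if j > 1 then e i (j - 1) else 0)"
  using jb unfolding jordan_basis_def by auto

lemma e_rep: "\<exists>c. u = (\<Sum>k\<in>boxes p. scale (c k) (case_prod e k))"
  using e_span unfolding span_image_family[OF finite_boxes] by blast

lemma End_eq_on_e:
  assumes "f \<in> End scale" "g \<in> End scale" "\<And>i j. (i, j) \<in> boxes p \<Longrightarrow> f (e i j) = g (e i j)"
  shows "f = g"
proof
  fix u
  obtain c where "u = (\<Sum>k\<in>boxes p. scale (c k) (case_prod e k))" using e_rep by blast
  then show "f u = g u"
    using assms by (auto simp: End_sum End_scale intro!: sum.cong)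
qed

lemma End_on_e: "\<exists>f. f \<in> End scale \<and> (\<forall>(i, j)\<in>boxes p. f (e i j) = h i j)"
proof -
  interpret vector_space_pair scale scale ..
  let ?B = "case_prod e ` boxes p"
  let ?f = "construct ?B (\<lambda>u. case_prod h (the_inv_into (boxes p) (case_prod e) u))"
  have "?f (e i j) = h i j" if "(i, j) \<in> boxes p" for i j
  proof -
    have "e i j \<in> ?B" using that by force
    then have "?f (e i j) = case_prod h (the_inv_into (boxes p) (case_prod e) (e i j))"
      by (rule construct_basis[OF e_inj(2)])
    also have "the_inv_into (boxes p) (case_prod e) (e i j) = (i, j)"
      using the_inv_into_f_f[OF e_inj(1) that] by simp
    finally show ?thesis by simp
  qed
  then show ?thesis using linear_construct[OF e_inj(2)] by (intro exI[of _ ?f]) (auto simp: End_iff)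
qed

abbreviation y :: "nat \<times> nat \<times> nat \<Rightarrow> 'b \<Rightarrow> 'b" where
  "y \<equiv> \<lambda>(i1, i2, s). cent_map scale p e i1 i2 s"

text \<open>The defining description of \<open>cent_map\<close> is met by exactly one linear map, so
  its values on the basis may be used.\<close>

lemma cent_map:
  shows cent_map_End: "cent_map scale p e i1 i2 s \<in> End scale"
    and cent_map_e: "(i, j) \<in> boxes p \<Longrightarrow> cent_map scale p e i1 i2 s (e i j) =
      (if i = i1 \<and> s + 1 \<le> j then e i2 (j - s) else 0)"
proof -
  let ?Q = "\<lambda>y. y \<in> End scale \<and> (\<forall>(i, j) \<in> boxes p. y (e i j) =
           (if i = i1 \<and> s + 1 \<le> j \<and> j \<le> p i then e i2 (j - s) else 0))"
  obtain f where f: "?Q f"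
    using End_on_e[of "\<lambda>i j. if i = i1 \<and> s + 1 \<le> j \<and> j \<le> p i then e i2 (j - s) else 0"] by blast
  have uniq: "g = f" if g: "?Q g" for g
  proof (rule End_eq_on_e)
    fix i j assume "(i, j) \<in> boxes p"
    then show "g (e i j) = f (e i j)"
      using bspec[OF conjunct2[OF f], of "(i, j)"] bspec[OF conjunct2[OF g], of "(i, j)"] by simp
  qed (use f g in blast)+
  have "?Q (cent_map scale p e i1 i2 s)"
    unfolding cent_map_def by (rule theI[of ?Q f]) (use f uniq in blast)+
  note Q = this
  show "cent_map scale p e i1 i2 s \<in> End scale" by (rule conjunct1[OF Q])
  show "(i, j) \<in> boxes p \<Longrightarrow> cent_map scale p e i1 i2 s (e i j) =
      (if i = i1 \<and> s + 1 \<le> j then e i2 (j - s) else 0)"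
    using bspec[OF conjunct2[OF Q], of "(i, j)"] by (simp add: box_iff)
qed

lemma cent_map_cent:
  assumes "(i1, i2, s) \<in> cent_index p"
  shows "cent_map scale p e i1 i2 s \<in> End_cent scale x"
proof -
  let ?y = "cent_map scale p e i1 i2 s"
  have s: "p i1 - p i2 \<le> s" using assms by (simp add: cent_index_def)
  have "x \<circ> ?y = ?y \<circ> x"
  proof (rule End_eq_on_e[OF comp_End[OF x cent_map_End] comp_End[OF cent_map_End x]])
    fix i j assume ij: "(i, j) \<in> boxes p"
    then have ij': "1 \<le> j" "j \<le> p i" by (auto simp: box_iff)
    show "(x \<circ> ?y) (e i j) = (?y \<circ> x) (e i j)"
    proof (cases "i = i1 \<and> s + 1 \<le> j")
      case True
      \<comment> \<open>The lower bound on \<open>s\<close> enters here: \<open>j - s\<close> is at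
        most \<open>p i1 - s\<close>, which is at most \<open>p i2\<close>.\<close>
      then have b: "(i2, j - s) \<in> boxes p" using True s ij' by (auto simp: box_iff)
      show ?thesis
      proof (cases "j > 1")
        case True2: True
        then have b': "(i, j - 1) \<in> boxes p" using ij' by (auto simp: box_iff)
        have i1: "i1 = i" "s + 1 \<le> j" using True by auto
        have "?y (e i j) = e i2 (j - s)" using cent_map_e[OF ij, of i1 i2 s] i1 by simp
        moreover have "?y (e i (j - 1)) = (if s + 1 \<le> j - 1 then e i2 (j - 1 - s) else 0)"
          using cent_map_e[OF b', of i1 i2 s] i1(1) by simp
        ultimately show ?thesis using True2 by (auto simp: x_e[OF ij] x_e[OF b] diff_commute)
      next
        case False
        moreover have "?y (e i j) = e i2 (j - s)" using cent_map_e[OF ij, of i1 i2 s] True by simp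
        moreover have "\<not> j - s > 1" using False by linarith
        ultimately show ?thesis by (simp add: x_e[OF ij] x_e[OF b] End_zero[OF cent_map_End])
      qed
    next
      case False
      have "(i, j - 1) \<in> boxes p" if "j > 1" using that ij' by (auto simp: box_iff)
      then show ?thesis using False
        by (auto simp: x_e[OF ij] cent_map_e[OF ij] cent_map_e End_zero[OF cent_map_End] End_zero[OF x])
    qed
  qed
  then show ?thesis unfolding End_cent_def using cent_map_End by simp
qed

text \<open>On the last vector of chain \<open>i1\<close>, the map with indices
  \<open>i1, i2, s\<close> gives the basis vector at the box \<open>(i2, p i1 - s)\<close>. Thus the
  triples starting with \<open>i1\<close> correspond bijectively to the boxes \<open>(i2, j)\<close>
  with \<open>j \<le> p i1\<close>, and boxes with larger \<open>j\<close> get coefficient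
  0.\<close>

lemma cent_map_comb:
  assumes i1: "1 \<le> i1" "i1 \<le> plength p"
  shows "(\<Sum>k\<in>cent_index p. fs (c k) (y k)) (e i1 (p i1)) =
    (\<Sum>k\<in>boxes p. scale (if snd k \<le> p i1 then c (i1, fst k, p i1 - snd k) else 0) (case_prod e k))"
proof -
  have top: "(i1, p i1) \<in> boxes p" using i1 partition_pos_iff[OF part, of i1] by (simp add: box_iff)
  have "(\<Sum>k\<in>cent_index p. fs (c k) (y k)) (e i1 (p i1)) = (\<Sum>k\<in>cent_index p. scale (c k) (y k (e i1 (p i1))))"
    by (simp add: sum_fun_apply)
  also have "\<dots> = (\<Sum>k\<in>{k \<in> cent_index p. fst k = i1}. scale (c k) (y k (e i1 (p i1))))"
    by (rule sum.mono_neutral_right[OF finite_cent_index]) (auto simp: cent_map_e[OF top] split: if_splits)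
  also have "\<dots> = (\<Sum>k\<in>{k \<in> boxes p. snd k \<le> p i1}. scale (c (i1, fst k, p i1 - snd k)) (case_prod e k))"
  proof (rule sum.reindex_bij_witness[where i = "\<lambda>(i2, j). (i1, i2, p i1 - j)" and j = "\<lambda>(i1, i2, s). (i2, p i1 - s)"])
    fix k assume k: "k \<in> {k \<in> cent_index p. fst k = i1}"
    then obtain i2 s where k': "k = (i1, i2, s)" by (cases k) auto
    have *: "1 \<le> i2" "i2 \<le> plength p" "p i1 - p i2 \<le> s" "s \<le> p i1 - 1" "0 < p i1"
      using k i1 partition_pos_iff[OF part, of i1] unfolding k' cent_index_def by auto
    have *: "1 \<le> i2" "i2 \<le> plength p" "p i1 - p i2 \<le> s" "s < p i1" using * by auto
    show "(case case k of (i1, i2, s) \<Rightarrow> (i2, p i1 - s) of (i2, j) \<Rightarrow> (i1, i2, p i1 - j)) = k"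
      using * unfolding k' by simp
    show "(case k of (i1, i2, s) \<Rightarrow> (i2, p i1 - s)) \<in> {k \<in> boxes p. snd k \<le> p i1}"
      using * unfolding k' by (auto simp: box_iff)
    show "scale (c (i1, fst (case k of (i1, i2, s) \<Rightarrow> (i2, p i1 - s)), p i1 - snd (case k of (i1, i2, s) \<Rightarrow> (i2, p i1 - s))))
        (case_prod e (case k of (i1, i2, s) \<Rightarrow> (i2, p i1 - s))) = scale (c k) (y k (e i1 (p i1)))"
      using * unfolding k' by (simp add: cent_map_e[OF top])
  next
    fix k assume k: "k \<in> {k \<in> boxes p. snd k \<le> p i1}"
    then obtain i2 j where k': "k = (i2, j)" by (cases k) auto
    have *: "1 \<le> i2" "i2 \<le> plength p" "1 \<le> j" "j \<le> p i2" "j \<le> p i1"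
      using k unfolding k' by (auto simp: boxes_def)
    show "(case case k of (i2, j) \<Rightarrow> (i1, i2, p i1 - j) of (i1, i2, s) \<Rightarrow> (i2, p i1 - s)) = k"
      using * unfolding k' by simp
    show "(case k of (i2, j) \<Rightarrow> (i1, i2, p i1 - j)) \<in> {k \<in> cent_index p. fst k = i1}"
      using * i1 unfolding k' cent_index_def by auto
  qed
  also have "\<dots> = (\<Sum>k\<in>{k \<in> boxes p. snd k \<le> p i1}.
      scale (if snd k \<le> p i1 then c (i1, fst k, p i1 - snd k) else 0) (case_prod e k))"
    by (intro sum.cong) auto
  also have "\<dots> = (\<Sum>k\<in>boxes p. scale (if snd k \<le> p i1 then c (i1, fst k, p i1 - snd k) else 0) (case_prod e k))"
    by (rule sum.mono_neutral_left[OF finite_boxes]) auto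
  finally show ?thesis .
qed

text \<open>Every coefficient can be read off from the values at the last vectors of the chains, by
  \<open>cent_map_comb\<close>.\<close>

lemma cent_map_indep: "inj_on y (cent_index p) \<and> F.independent (y ` cent_index p)"
  unfolding F.independent_family_iff[OF finite_cent_index]
proof (intro allI impI ballI)
  fix c k assume z: "(\<Sum>k\<in>cent_index p. fs (c k) (y k)) = 0" and k: "k \<in> cent_index p"
  obtain i1 i2 s where k': "k = (i1, i2, s)" by (cases k)
  have *: "1 \<le> i1" "i1 \<le> plength p" "1 \<le> i2" "i2 \<le> plength p" "p i1 - p i2 \<le> s" "s \<le> p i1 - 1"
    using k unfolding k' cent_index_def by auto
  have pos: "0 < p i1" using * partition_pos_iff[OF part] by auto
  let ?d = "\<lambda>k. if snd k \<le> p i1 then c (i1, fst k, p i1 - snd k) else 0"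
  have "(\<Sum>k\<in>boxes p. scale (?d k) (case_prod e k)) = 0"
    using cent_map_comb[OF *(1,2), of c] z by simp
  then have "\<forall>k\<in>boxes p. ?d k = 0" by (rule e_indep)
  moreover have "(i2, p i1 - s) \<in> boxes p" using * pos by (auto simp: box_iff)
  ultimately have "?d (i2, p i1 - s) = 0" by blast
  moreover have "p i1 - (p i1 - s) = s" using * pos by linarith
  ultimately show "c k = 0" unfolding k' by simp
qed

lemma x_pow_End: "x ^^ m \<in> End scale"
  by (induction m) (simp_all only: funpow.simps id_End comp_End x)

lemma x_pow_e: "(i, j) \<in> boxes p \<Longrightarrow> (x ^^ m) (e i j) = (if j > m then e i (j - m) else 0)"
proof (induction m)
  case (Suc m)
  have "(i, j - m) \<in> boxes p" if "j > m" using that Suc.prems by (auto simp: box_iff)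
  then show ?case using Suc by (auto simp: x_e End_zero[OF x])
qed (simp add: box_iff)

lemma cent_pow: "z \<in> End_cent scale x \<Longrightarrow> z ((x ^^ m) u) = (x ^^ m) (z u)"
proof (induction m)
  case (Suc m)
  then have "z (x w) = x (z w)" for w unfolding End_cent_def by (auto simp: fun_eq_iff)
  then show ?case using Suc by simp
qed simp

lemma subspace_End_cent: "F.subspace (End_cent scale x)"
  using subspace_End_ann[OF x] by (simp add: End_cent_eq_ann)

text \<open>The last vectors of the chains generate \<open>V\<close> under powers of
  \<open>x\<close>, so a commuting map is determined by its values there. Such a value must be
  killed by \<open>x ^^ p i\<close>, and the combinations in \<open>cent_map_comb\<close> realize
  exactly the vectors with this property.\<close>

lemma cent_map_span: "F.span (y ` cent_index p) = End_cent scale x"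
proof
  show "F.span (y ` cent_index p) \<subseteq> End_cent scale x"
    by (rule F.span_minimal[OF _ subspace_End_cent]) (auto intro: cent_map_cent)
  show "End_cent scale x \<subseteq> F.span (y ` cent_index p)"
  proof
    fix z assume z: "z \<in> End_cent scale x"
    then have zE: "z \<in> End scale" unfolding End_cent_def by blast
    define a where "a i = (SOME c. z (e i (p i)) = (\<Sum>k\<in>boxes p. scale (c k) (case_prod e k)))" for i
    have a: "z (e i (p i)) = (\<Sum>k\<in>boxes p. scale (a i k) (case_prod e k))" for i
      unfolding a_def by (rule someI_ex[OF e_rep])
    \<comment> \<open>Commuting with \<open>x ^^ p i\<close> forbids components in columns beyond
      \<open>p i\<close>.\<close>
    have a0: "a i k = 0" if i: "1 \<le> i" "i \<le> plength p" and k: "k \<in> boxes p" "p i < snd k" for i k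
    proof -
      have top: "(i, p i) \<in> boxes p" using i partition_pos_iff[OF part, of i] by (simp add: box_iff)
      have "0 = z ((x ^^ p i) (e i (p i)))" by (simp add: x_pow_e[OF top] End_zero[OF zE])
      also have "\<dots> = (\<Sum>k\<in>boxes p. scale (a i k) ((x ^^ p i) (case_prod e k)))"
        by (simp add: cent_pow[OF z] a End_sum[OF x_pow_End] End_scale[OF x_pow_End])
      also have "\<dots> = (\<Sum>k\<in>{k \<in> boxes p. p i < snd k}. scale (a i k) ((x ^^ p i) (case_prod e k)))"
        by (rule sum.mono_neutral_right[OF finite_boxes]) (auto simp: x_pow_e split: if_splits)
      \<comment> \<open>The surviving boxes are shifted left by \<open>p i\<close>; the shift is
        injective, so distinct basis vectors appear and the coefficients must vanish.\<close>
      also have "\<dots> = (\<Sum>k\<in>{k \<in> boxes p. snd k + p i \<le> p (fst k)}. scale (a i (fst k, snd k + p i)) (case_prod e k))"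
        by (rule sum.reindex_bij_witness[where i = "\<lambda>(i', j). (i', j + p i)" and j = "\<lambda>(i', j). (i', j - p i)"])
           (auto simp: box_iff x_pow_e)
      also have "\<dots> = (\<Sum>k\<in>{k \<in> boxes p. snd k + p i \<le> p (fst k)}.
          scale (if snd k + p i \<le> p (fst k) then a i (fst k, snd k + p i) else 0) (case_prod e k))"
        by (intro sum.cong) auto
      also have "\<dots> = (\<Sum>k\<in>boxes p. scale (if snd k + p i \<le> p (fst k) then a i (fst k, snd k + p i) else 0) (case_prod e k))"
        by (rule sum.mono_neutral_left[OF finite_boxes]) auto
      finally have "\<forall>k\<in>boxes p. (if snd k + p i \<le> p (fst k) then a i (fst k, snd k + p i) else 0) = 0"
        by (intro e_indep) simp
      moreover have "(fst k, snd k - p i) \<in> boxes p" using k by (cases k) (auto simp: box_iff)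
      ultimately have "(if snd k - p i + p i \<le> p (fst k) then a i (fst k, snd k - p i + p i) else 0) = 0"
        by fastforce
      then show "a i k = 0" using k by (cases k) (auto simp: box_iff)
    qed
    \<comment> \<open>Chosen so that \<open>cent_map_comb\<close> returns the coefficients
      \<open>a\<close> of \<open>z\<close> at the last vectors.\<close>
    define c where "c = (\<lambda>(i1, i2, s). a i1 (i2, p i1 - s))"
    let ?w = "\<Sum>k\<in>cent_index p. fs (c k) (y k)"
    have w_span: "?w \<in> F.span (y ` cent_index p)" by (intro F.span_sum F.span_scale F.span_base imageI)
    then have w: "?w \<in> End_cent scale x" using \<open>F.span (y ` cent_index p) \<subseteq> End_cent scale x\<close> by blast
    then have wE: "?w \<in> End scale" unfolding End_cent_def by blast
    have top: "z (e i (p i)) = ?w (e i (p i))" if i: "1 \<le> i" "i \<le> plength p" for i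
      unfolding cent_map_comb[OF i] a
    proof (rule sum.cong[OF refl])
      fix k assume k: "k \<in> boxes p"
      show "scale (a i k) (case_prod e k) =
          scale (if snd k \<le> p i then c (i, fst k, p i - snd k) else 0) (case_prod e k)"
        using a0[OF i k] by (cases k) (auto simp: c_def)
    qed
    have "z = ?w"
    proof (rule End_eq_on_e[OF zE wE])
      fix i j assume ij: "(i, j) \<in> boxes p"
      then have i: "1 \<le> i" "i \<le> plength p" "1 \<le> j" "j \<le> p i" by (auto simp: boxes_def)
      have b: "(i, p i) \<in> boxes p" using i by (simp add: box_iff)
      have "e i j = (x ^^ (p i - j)) (e i (p i))" using i by (simp add: x_pow_e[OF b])
      then show "z (e i j) = ?w (e i j)" using cent_pow[OF z] cent_pow[OF w] top[OF i(1,2)] by simp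
    qed
    then show "z \<in> F.span (y ` cent_index p)" using w_span by simp
  qed
qed

lemma dim_End_cent: "F.dim (End_cent scale x) = psize p + 2 * pn p"
proof -
  have "F.dim (End_cent scale x) = card (y ` cent_index p)"
    unfolding cent_map_span[symmetric] by (rule F.dim_span_eq_card_independent) (use cent_map_indep in blast)
  then show ?thesis using cent_map_indep card_cent_index[OF part] by (simp add: card_image)
qed

end

text \<open>Rank-nullity for the restriction to a subspace \<open>W\<close>; the finite set
  \<open>E\<close> supplies finite-dimensionality of \<open>W\<close>, since the ambient space of
  functions need not have it.\<close>

lemma dim_kernel_image:
  assumes lin: "Vector_Spaces.linear s t T" and W: "module.subspace s W"
    and E: "finite E" "W \<subseteq> module.span s E"
  shows "vector_space.dim s W = vector_space.dim s {w \<in> W. T w = 0} + vector_space.dim t (T ` W)"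
proof -
  interpret T: Vector_Spaces.linear s t T by fact
  let ?K = "{w \<in> W. T w = 0}"
  have K: "T.vs1.subspace ?K"
    using T.vs1.subspace_inter[OF W T.subspace_kernel] by (simp add: Collect_conj_eq)
  obtain B where B: "B \<subseteq> ?K" "T.vs1.independent B" "?K \<subseteq> T.vs1.span B"
    using T.vs1.maximal_independent_subset by blast
  obtain C where C: "B \<subseteq> C" "C \<subseteq> W" "T.vs1.independent C" "W \<subseteq> T.vs1.span C"
    using T.vs1.maximal_independent_subset_extend[of B W] B by blast
  have fin: "finite C" using T.vs1.independent_span_bound[OF E(1) C(3)] C(2) E(2) by blast
  then have finB: "finite B" and finD: "finite (C - B)" using C(1) finite_subset by auto
  have Cspan: "T.vs1.span C = W" using C W by (intro equalityI T.vs1.span_minimal) auto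
  have ind: "inj_on T (C - B) \<and> T.vs2.independent (T ` (C - B))"
    unfolding T.vs2.independent_family_iff[OF finD]
  proof (intro allI impI)
    fix c assume z: "(\<Sum>i\<in>C - B. t (c i) (T i)) = 0"
    let ?w = "\<Sum>i\<in>C - B. s (c i) i"
    have "T ?w = 0" using z by (simp add: T.sum T.scale)
    moreover have "?w \<in> W" using C(2) by (intro T.vs1.subspace_sum[OF W] T.vs1.subspace_scale[OF W]) auto
    ultimately have "?w \<in> T.vs1.span B" using B(3) by blast
    then obtain d where d: "?w = (\<Sum>i\<in>B. s (d i) i)"
      using T.vs1.span_image_family[OF finB, of "\<lambda>i. i"] by auto
    let ?c = "\<lambda>i. if i \<in> B then - d i else c i"
    have "(\<Sum>i\<in>C. s (?c i) i) = (\<Sum>i\<in>C - B. s (?c i) i) + (\<Sum>i\<in>B. s (?c i) i)"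
      by (rule sum.subset_diff[OF C(1) fin])
    also have "(\<Sum>i\<in>C - B. s (?c i) i) = ?w" by (intro sum.cong) auto
    also have "(\<Sum>i\<in>B. s (?c i) i) = - (\<Sum>i\<in>B. s (d i) i)"
      unfolding sum_negf[symmetric] by (intro sum.cong) auto
    finally have "(\<Sum>i\<in>C. s (?c i) i) = 0" using d by simp
    then have "?c i = 0" if "i \<in> C" for i
      using T.vs1.independentD[OF C(3) fin, of ?c i] that by blast
    then show "\<forall>i\<in>C - B. c i = 0" by (metis DiffE)
  qed
  have im: "T.vs2.span (T ` (C - B)) = T ` W"
  proof
    show "T.vs2.span (T ` (C - B)) \<subseteq> T ` W"
      using C(2) by (intro T.vs2.span_minimal T.subspace_image W) auto
    have "T ` W = T.vs2.span (T ` C)" unfolding Cspan[symmetric] T.span_image ..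
    also have "\<dots> \<subseteq> T.vs2.span (insert 0 (T ` (C - B)))"
      using B(1) by (intro T.vs2.span_mono) auto
    finally show "T ` W \<subseteq> T.vs2.span (T ` (C - B))" by simp
  qed
  have "T.vs1.dim W = card C" unfolding Cspan[symmetric] by (rule T.vs1.dim_span_eq_card_independent[OF C(3)])
  moreover have "T.vs1.dim ?K = card B"
    using T.vs1.basis_card_eq_dim[OF B(1,3,2)] by simp
  moreover have "T.vs2.dim (T ` W) = card (C - B)"
    unfolding im[symmetric] using ind by (simp add: T.vs2.dim_eq_card_independent card_image)
  ultimately show ?thesis using fin C(1) by (simp add: card_Diff_subset[OF finB] card_mono)
qed

section \<open>Normal bases\<close>

locale normal = fin_zariski scale Basis
  for scale :: "'a::field \<Rightarrow> 'b::ab_group_add \<Rightarrow> 'b" and Basis :: "'b set" +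
  fixes mu nu :: "nat \<Rightarrow> nat" and v :: 'b and x :: "'b \<Rightarrow> 'b" and e :: "nat \<Rightarrow> nat \<Rightarrow> 'b"
  assumes mu: "is_partition mu" and nu: "is_partition nu" and xE: "x \<in> End scale"
    and nb: "normal_basis scale mu nu v x e"
begin

sublocale jordan scale Basis "mu + nu" x e
  using partition_add(1)[OF mu nu] xE nb unfolding normal_basis_def by unfold_locales auto

lemma v_eq: "v = (\<Sum>i = 1..plength mu. e i (mu i))"
  using nb unfolding normal_basis_def by blast

lemma mu_box: "1 \<le> i \<Longrightarrow> i \<le> plength mu \<Longrightarrow> (i, mu i) \<in> boxes (mu + nu)"
  using partition_pos_iff[OF mu, of i] by (simp add: box_iff)

lemma boxes_mu: "boxes mu \<subseteq> boxes (mu + nu)"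
proof
  fix k assume "k \<in> boxes mu"
  then show "k \<in> boxes (mu + nu)" by (cases k) (auto simp: box_iff, auto simp: boxes_def)
qed

text \<open>Each chain up to \<open>plength mu\<close> contributes exactly one vector to
  \<open>v\<close>, so only the summand from chain \<open>i1\<close> survives.\<close>

lemma cent_map_v: "cent_map scale (mu + nu) e i1 i2 s v =
    (if 1 \<le> i1 \<and> i1 \<le> plength mu \<and> s + 1 \<le> mu i1 then e i2 (mu i1 - s) else 0)"
proof -
  have "cent_map scale (mu + nu) e i1 i2 s v =
      (\<Sum>i = 1..plength mu. if i = i1 then (if s + 1 \<le> mu i1 then e i2 (mu i1 - s) else 0) else 0)"
    unfolding v_eq End_sum[OF cent_map_End]
    by (intro sum.cong) (auto simp: cent_map_e[OF mu_box])
  then show ?thesis by simp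
qed

text \<open>Basis elements of the centralizer send \<open>v\<close> to single basis vectors or to 0,
  so the claim is which boxes are reached. That none lies outside the diagram of \<open>mu\<close>
  rests on monotonicity of both partitions.\<close>

lemma cent_orbit_eq:
  "(\<lambda>z. z v) ` End_cent scale x = span (case_prod e ` boxes mu)"
proof
  show "(\<lambda>z. z v) ` End_cent scale x \<subseteq> span (case_prod e ` boxes mu)"
  proof (rule image_subsetI)
    fix z assume "z \<in> End_cent scale x"
    then obtain c where z: "z = (\<Sum>k\<in>cent_index (mu + nu). fs (c k) (y k))"
      unfolding cent_map_span[symmetric] F.span_image_family[OF finite_cent_index] by blast
    have "y k v \<in> span (case_prod e ` boxes mu)" if "k \<in> cent_index (mu + nu)" for k
    proof -
      obtain i1 i2 s where k: "k = (i1, i2, s)" by (cases k)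
      show ?thesis
      proof (cases "1 \<le> i1 \<and> i1 \<le> plength mu \<and> s + 1 \<le> mu i1")
        case True
        have i2: "1 \<le> i2" and s: "mu i1 + nu i1 - (mu i2 + nu i2) \<le> s"
          using that unfolding k cent_index_def by auto
        \<comment> \<open>For \<open>i1 \<le> i2\<close>, \<open>nu\<close> does not increase, so
          the lower bound on \<open>s\<close> already forces \<open>s\<close> to be at least
          \<open>mu i1 - mu i2\<close>. Otherwise \<open>mu i1 \<le> mu i2\<close> by monotonicity
          of \<open>mu\<close>.\<close>
        have le: "mu i1 - s \<le> mu i2"
        proof (cases "i1 \<le> i2")
          case True2: True
          then have "nu i2 \<le> nu i1" using partition_antimono[OF nu] True by blast
          then show ?thesis using s by linarith
        next
          case False
          then have "mu i1 \<le> mu i2" using partition_antimono[OF mu i2] by simp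
          then show ?thesis by linarith
        qed
        have "0 < mu i2" using le True by linarith
        then have "(i2, mu i1 - s) \<in> boxes mu"
          using True le partition_pos_iff[OF mu, of i2] by (auto simp: boxes_def)
        then have "e i2 (mu i1 - s) \<in> case_prod e ` boxes mu" by force
        then show ?thesis using True unfolding k by (simp add: cent_map_v span_base)
      next
        case False
        then show ?thesis unfolding k by (auto simp: cent_map_v span_zero)
      qed
    qed
    then show "z v \<in> span (case_prod e ` boxes mu)"
      unfolding z sum_fun_apply fs_apply by (intro span_sum span_scale)
  qed
  show "span (case_prod e ` boxes mu) \<subseteq> (\<lambda>z. z v) ` End_cent scale x"
  proof (rule span_minimal)
    interpret ev: Vector_Spaces.linear fs scale "\<lambda>z. z v" by (rule linear_eval)
    show "subspace ((\<lambda>z. z v) ` End_cent scale x)" by (rule ev.subspace_image[OF subspace_End_cent])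
    show "case_prod e ` boxes mu \<subseteq> (\<lambda>z. z v) ` End_cent scale x"
    proof (rule image_subsetI)
      fix k assume "k \<in> boxes mu"
      then obtain i j where k: "k = (i, j)" "1 \<le> i" "i \<le> plength mu" "1 \<le> j" "j \<le> mu i"
        by (cases k) (auto simp: boxes_def)
      \<comment> \<open>Shifting within chain \<open>i\<close> alone by \<open>mu i - j\<close>
        moves its contribution to \<open>v\<close> onto the box \<open>(i, j)\<close> and kills the
        others.\<close>
      have "(i, i, mu i - j) \<in> cent_index (mu + nu)"
        using k partition_add(2)[OF mu nu] unfolding cent_index_def by auto
      then have "cent_map scale (mu + nu) e i i (mu i - j) \<in> End_cent scale x" by (rule cent_map_cent)
      moreover have "cent_map scale (mu + nu) e i i (mu i - j) v = case_prod e k"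
      proof -
        have "mu i - j + 1 \<le> mu i" "mu i - (mu i - j) = j" using k by linarith+
        then show ?thesis using k by (simp add: cent_map_v)
      qed
      ultimately show "case_prod e k \<in> (\<lambda>z. z v) ` End_cent scale x" by (metis image_eqI)
    qed
  qed
qed

text \<open>Rank-nullity for evaluation at \<open>v\<close> on the centralizer: the kernel is the
  annihilator and the image has one basis vector per box of \<open>mu\<close>. Since
  \<open>psize\<close> and \<open>pn\<close> are additive, subtracting \<open>psize mu\<close>
  leaves \<open>bstat mu nu\<close>.\<close>

lemma dim_End_ann: "F.dim (End_ann scale v x) = bstat mu nu"
proof -
  have "F.dim (End_cent scale x) = F.dim {z \<in> End_cent scale x. z v = 0} + dim ((\<lambda>z. z v) ` End_cent scale x)"
    by (rule dim_kernel_image[OF linear_eval subspace_End_cent, of "y ` cent_index (mu + nu)"])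
       (simp_all add: finite_cent_index cent_map_span)
  moreover have "dim ((\<lambda>z. z v) ` End_cent scale x) = psize mu"
  proof -
    have "independent (case_prod e ` boxes mu)"
      using independent_mono[OF e_inj(2)] boxes_mu by (meson image_mono)
    then have "dim (span (case_prod e ` boxes mu)) = card (case_prod e ` boxes mu)"
      by (rule dim_span_eq_card_independent)
    also have "\<dots> = psize mu"
      using inj_on_subset[OF e_inj(1) boxes_mu] card_boxes[OF mu] by (simp add: card_image)
    finally show ?thesis unfolding cent_orbit_eq .
  qed
  ultimately show ?thesis
    using partition_add(4,5)[OF mu nu] unfolding dim_End_cent End_ann_def bstat_def by simp
qed

text \<open>The linear map matching two normal bases of the same type intertwines the nilpotents and
  carries one vector to the other; conversely an invertible map transports a normal basis.\<close>

lemma enh_orbit_eq: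
  assumes "x \<in> Nilp scale"
  shows "enh_orbit scale mu nu = orbit v x"
proof (rule Set.set_eqI, clarify)
  fix u z
  show "(u, z) \<in> enh_orbit scale mu nu \<longleftrightarrow> (u, z) \<in> orbit v x"
  proof
    assume "(u, z) \<in> enh_orbit scale mu nu"
    then obtain e' where z: "z \<in> End scale" and nb': "normal_basis scale mu nu u z e'"
      unfolding enh_orbit_def Nilp_def by auto
    interpret n': normal scale Basis mu nu u z e'
      by unfold_locales (use mu nu z nb' in auto)
    obtain g where g: "g \<in> End scale" "\<And>i j. (i, j) \<in> boxes (mu + nu) \<Longrightarrow> g (e i j) = e' i j"
      using End_on_e[of e'] by blast
    obtain h where h: "h \<in> End scale" "\<And>i j. (i, j) \<in> boxes (mu + nu) \<Longrightarrow> h (e' i j) = e i j"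
      using n'.End_on_e[of e] by blast
    \<comment> \<open>A left inverse makes \<open>g\<close> injective, which is enough for
      invertibility in finite dimension.\<close>
    have "h \<circ> g = id"
      by (rule End_eq_on_e[OF comp_End[OF h(1) g(1)] id_End]) (simp add: g h)
    then have "g \<in> carrier (GL scale)"
      by (intro End_inj_GL[OF g(1)]) (metis End_zero[OF h(1)] comp_apply id_apply)
    moreover have "z \<circ> g = g \<circ> x"
    proof (rule End_eq_on_e[OF comp_End[OF z g(1)] comp_End[OF g(1) xE]])
      fix i j assume ij: "(i, j) \<in> boxes (mu + nu)"
      have "(i, j - 1) \<in> boxes (mu + nu)" if "j > 1" using that ij by (auto simp: box_iff)
      then show "(z \<circ> g) (e i j) = (g \<circ> x) (e i j)"
        using ij by (auto simp: g n'.x_e x_e End_zero[OF g(1)])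
    qed
    moreover have "g v = u"
      unfolding v_eq n'.v_eq End_sum[OF g(1)] by (intro sum.cong) (auto simp: g(2)[OF mu_box])
    ultimately show "(u, z) \<in> orbit v x" using orbitI by blast
  next
    assume "(u, z) \<in> orbit v x"
    then obtain g where g: "g \<in> carrier (GL scale)" "g v = u" "z \<circ> g = g \<circ> x" "z \<in> End scale"
      using xE by (elim orbitE)
    have gE: "g \<in> End scale" and bij: "bij g" using g(1) by (auto simp: GL_iff)
    interpret g: Vector_Spaces.linear scale scale g using gE by (simp add: End_iff)
    have zg: "z (g w) = g (x w)" for w using g(3) by (simp add: fun_eq_iff)
    obtain k where k: "x ^^ k = (\<lambda>_. 0)" using assms unfolding Nilp_def by blast
    have pow: "(z ^^ m) (g w) = g ((x ^^ m) w)" for m w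
      by (induction m arbitrary: w) (simp_all add: zg)
    have "(z ^^ k) w = 0" for w
    proof -
      obtain w' where "w = g w'" using bij by (metis bij_pointE)
      then show ?thesis using pow[of k w'] k End_zero[OF gE] by simp
    qed
    then have zN: "z \<in> Nilp scale" unfolding Nilp_def using g(4) by auto
    define e' where "e' i j = g (e i j)" for i j
    have im: "case_prod e' ` boxes (mu + nu) = g ` (case_prod e ` boxes (mu + nu))"
      unfolding e'_def by (auto simp: image_image case_prod_beta)
    have "inj_on (case_prod e') (boxes (mu + nu))"
    proof -
      have "case_prod e' = g \<circ> case_prod e" by (auto simp: e'_def fun_eq_iff)
      then show ?thesis
        using comp_inj_on[OF e_inj(1) inj_on_subset[OF bij_is_inj[OF bij] subset_UNIV]] by (simp only:)
    qed
    moreover have "independent (case_prod e' ` boxes (mu + nu))"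
      unfolding im by (rule g.independent_injective_image[OF e_inj(2)])
        (rule inj_on_subset[OF bij_is_inj[OF bij] subset_UNIV])
    moreover have "span (case_prod e' ` boxes (mu + nu)) = UNIV"
      unfolding im g.span_image e_span using bij by (rule bij_is_surj)
    moreover have "z (e' i j) = (if j > 1 then e' i (j - 1) else 0)" if "(i, j) \<in> boxes (mu + nu)" for i j
      unfolding e'_def zg x_e[OF that] using End_zero[OF gE] by simp
    ultimately have "jordan_basis scale (mu + nu) z e'"
      unfolding jordan_basis_def basis_family_def by auto
    moreover have "u = (\<Sum>i = 1..plength mu. e' i (mu i))"
      unfolding e'_def g(2)[symmetric] v_eq by (rule End_sum[OF gE])
    ultimately show "(u, z) \<in> enh_orbit scale mu nu"
      unfolding enh_orbit_def normal_basis_def using zN by blast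
  qed
qed

theorem krull_dim_enh_orbit:
  assumes "x \<in> Nilp scale"
  shows "krull_dim (subtopology (VEnd_top scale) (enh_orbit scale mu nu)) =
      ereal (real (dim UNIV) ^ 2 - real (bstat mu nu))"
proof -
  have "enh_orbit scale mu nu \<subseteq> UNIV \<times> End scale" unfolding enh_orbit_def Nilp_def by auto
  then have "subtopology (VEnd_top scale) (enh_orbit scale mu nu) = zariski ps (enh_orbit scale mu nu)"
    unfolding VEnd_top_def subtopology_zariski by (simp only: Int_absorb1)
  then show ?thesis
    using krull_dim_orbit[OF xE, of v] unfolding enh_orbit_eq[OF assms] dim_End_ann
    by (simp add: of_nat_diff del: fs_apply)
qed

end

section \<open>Nilpotent orbits as enhanced orbits of type \<open>(0, p)\<close>\<close>

context fin_zariski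
begin

text \<open>The zero partition has length 0, so the sum defining the vector of a normal basis is
  empty.\<close>

lemma enh_orbit_zero: "enh_orbit scale 0 p = {0} \<times> nilp_orbit scale p"
  unfolding enh_orbit_def nilp_orbit_def normal_basis_def by (auto simp: psize_pn_zero)

lemma krull_dim_nilp_orbit:
  "krull_dim (subtopology (End_top scale) (nilp_orbit scale p)) =
   krull_dim (subtopology (VEnd_top scale) (enh_orbit scale 0 p))"
proof -
  let ?N = "nilp_orbit scale p"
  have sub: "?N \<subseteq> End scale" unfolding nilp_orbit_def Nilp_def by auto
  then have "subtopology (VEnd_top scale) (enh_orbit scale 0 p) = zariski ps ({0} \<times> ?N)"
    unfolding VEnd_top_def subtopology_zariski enh_orbit_zero by (simp add: Int_absorb1 Sigma_mono)
  moreover have "subtopology (End_top scale) ?N = zariski fs ?N"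
    unfolding End_top_eq using sub by (simp add: Int_absorb1)
  moreover have "zariski fs ?N homeomorphic_space zariski ps ({0} \<times> ?N)"
    unfolding homeomorphic_space_def
  proof (intro exI)
    have "Vector_Spaces.linear fs ps (\<lambda>z. (0, z))" by (rule linear_fs_psI) (auto simp: fun_eq_iff)
    moreover have "Vector_Spaces.linear ps fs snd"
      unfolding Vector_Spaces.linear_iff using F.vector_space_axioms P.vector_space_axioms
      by (auto simp: prod_scale_def)
    ultimately show "homeomorphic_maps (zariski fs ?N) (zariski ps ({0} \<times> ?N)) (\<lambda>z. (0, z)) snd"
      unfolding homeomorphic_maps_def
      by (auto intro!: continuous_map_zariski vregular_at_linear)
  qed
  ultimately show ?thesis by (simp add: krull_dim_homeomorphic)
qed

end

text \<open>Over a finite field, the product of all \<open>X - a\<close>, increased by 1, is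
  nonconstant and takes the value 1 everywhere, so it has no root.\<close>

lemma alg_closed_infinite: "infinite (UNIV :: 'a::alg_closed_field set)"
proof
  assume fin: "finite (UNIV :: 'a set)"
  let ?q = "\<Prod>a::'a\<in>UNIV. [:- a, 1:]"
  have "degree ?q = card (UNIV :: 'a set)"
    by (subst degree_prod_eq_sum_degree) auto
  then have "degree ?q > 0" using fin by (simp add: card_gt_0_iff)
  then have "degree (?q + 1) > 0" by (simp add: degree_add_eq_left)
  then obtain z where z: "poly (?q + 1) z = 0" using alg_closed_imp_poly_has_root by blast
  have "poly ?q z = 0" using fin by (simp add: poly_prod prod_zero_iff)
  then show False using z by simp
qed

theorem proposition2p8:
  fixes scale :: "'a::alg_closed_field \<Rightarrow> 'b::ab_group_add \<Rightarrow> 'b"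
    and Basis :: "'b set"
    and n :: nat
    and mu nu lam :: "nat \<Rightarrow> nat"
    and v :: 'b and x :: "'b \<Rightarrow> 'b"
    and e :: "nat \<Rightarrow> nat \<Rightarrow> 'b"
  assumes V: "finite_dimensional_vector_space scale Basis"
    and n: "vector_space.dim scale UNIV = n"
    and bip: "(mu, nu) \<in> bipartitions n"
    and lam: "lam = mu + nu"
    and orb: "(v, x) \<in> enh_orbit scale mu nu"
    and nb: "normal_basis scale mu nu v x e"
  shows
    "basis_family (fun_scale scale) (\<lambda>(i1, i2, s). cent_map scale lam e i1 i2 s)
       (cent_index lam) (End_cent scale x)
   \<and> vector_space.dim (fun_scale scale) (End_cent scale x) = n + 2 * pn lam
   \<and> (connected_alg_subgroup scale (GL_cent scale x) \<and>
      krull_dim (subtopology (End_top scale) (GL_cent scale x)) = ereal (real (n + 2 * pn lam)))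
   \<and> krull_dim (subtopology (End_top scale) (nilp_orbit scale lam))
       = ereal (real n ^ 2 - real n - 2 * real (pn lam))
   \<and> {y v | y. y \<in> End_cent scale x}
       = module.span scale {e i j | i j. 1 \<le> i \<and> i \<le> plength mu \<and> 1 \<le> j \<and> j \<le> mu i}
   \<and> vector_space.dim (fun_scale scale) (End_ann scale v x) = bstat mu nu
   \<and> (connected_alg_subgroup scale (GL_stab scale v x) \<and>
      krull_dim (subtopology (End_top scale) (GL_stab scale v x)) = ereal (real (bstat mu nu)))
   \<and> (krull_dim (subtopology (VEnd_top scale) (enh_orbit scale mu nu))
        = krull_dim (subtopology (End_top scale) (nilp_orbit scale lam)) + ereal (real (psize mu))
      \<and> krull_dim (subtopology (VEnd_top scale) (enh_orbit scale mu nu))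
        = ereal (real n ^ 2 - real (bstat mu nu)))"
proof -
  interpret V: finite_dimensional_vector_space scale Basis by fact
  interpret fin_zariski scale Basis
    by unfold_locales (rule alg_closed_infinite)
  have mu: "is_partition mu" and nu: "is_partition nu" and size: "psize mu + psize nu = n"
    using bip unfolding bipartitions_def by auto
  have xN: "x \<in> Nilp scale" using orb unfolding enh_orbit_def by auto
  then have xE: "x \<in> End scale" unfolding Nilp_def by blast
  interpret N: normal scale Basis mu nu v x e
    by unfold_locales (use mu nu xE nb in auto)
  have lam_part: "is_partition lam" unfolding lam by (rule N.part)
  \<comment> \<open>The same Jordan basis is a normal basis of type \<open>(0, lam)\<close> for
    \<open>(0, x)\<close>; interpreting \<open>normal\<close> a second time yields the dimension of
    the nilpotent orbit.\<close>
  have nb0: "normal_basis scale 0 lam 0 x e"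
    using nb unfolding normal_basis_def lam by (simp add: psize_pn_zero)
  interpret Z: normal scale Basis 0 lam 0 x e
    by unfold_locales (use is_partition_zero lam_part xE nb0 in auto)
  have size_lam: "psize lam = n" and pn_lam: "pn lam = pn mu + pn nu"
    unfolding lam using partition_add(4,5)[OF mu nu] size by auto
  have bstat0: "bstat 0 lam = n + 2 * pn lam"
    unfolding bstat_def by (simp add: psize_pn_zero size_lam)
  \<comment> \<open>This numerical identity accounts for the difference \<open>psize mu\<close>
    between the two orbit dimensions.\<close>
  have b: "bstat mu nu + psize mu = n + 2 * pn lam"
    unfolding bstat_def pn_lam using size by simp
  have dim_n: "vector_space.dim scale (UNIV :: 'b set) = n" by (rule n)
  have basis: "basis_family fs (\<lambda>(i1, i2, s). cent_map scale lam e i1 i2 s) (cent_index lam) (End_cent scale x)"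
    unfolding basis_family_def lam using N.cent_map_indep N.cent_map_span by blast
  have dim_cent: "F.dim (End_cent scale x) = n + 2 * pn lam"
    using N.dim_End_cent size_lam unfolding lam by simp
  have nilp: "krull_dim (subtopology (End_top scale) (nilp_orbit scale lam))
      = ereal (real n ^ 2 - real n - 2 * real (pn lam))"
    unfolding krull_dim_nilp_orbit Z.krull_dim_enh_orbit[OF xN] dim_n bstat0 by simp
  have enh: "krull_dim (subtopology (VEnd_top scale) (enh_orbit scale mu nu)) = ereal (real n ^ 2 - real (bstat mu nu))"
    using N.krull_dim_enh_orbit[OF xN] unfolding dim_n .
  have "real (bstat mu nu) + real (psize mu) = real n + 2 * real (pn lam)" using b by linarith
  then have enh2: "krull_dim (subtopology (VEnd_top scale) (enh_orbit scale mu nu))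
        = krull_dim (subtopology (End_top scale) (nilp_orbit scale lam)) + ereal (real (psize mu))"
    unfolding nilp enh by simp
  have "{e i j | i j. 1 \<le> i \<and> i \<le> plength mu \<and> 1 \<le> j \<and> j \<le> mu i} = case_prod e ` boxes mu"
    unfolding boxes_def by force
  then have cent_v: "{y v | y. y \<in> End_cent scale x}
       = module.span scale {e i j | i j. 1 \<le> i \<and> i \<le> plength mu \<and> 1 \<le> j \<and> j \<le> mu i}"
    using N.cent_orbit_eq by (simp add: image_def Bex_def conj_commute)
  show ?thesis
    using basis dim_cent nilp cent_v N.dim_End_ann enh enh2
      GL_stab_connected_dim[OF xE, of v] GL_stab_connected_dim[OF xE, of 0]
    unfolding GL_cent_eq_stab End_cent_eq_ann by (simp del: fs_apply)
qed

end
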